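(* Let $\mathcal{M}$ be an object of $\mathcal{M}on_{\rm ini}$, $\mathcal{A}$ an object of $\mathcal{M}on_{\rm nul}$, $\Phi:\mathcal{M}\to\mathcal{A}$ a morphism of $\mathcal{M}on_{\rm ini}$ and $\mathcal{C}$ a monoidal subcategory of $\mathcal{A}$ with the same objects. Assume: 1. if $f$ and $g$ are two composable morphisms of $\mathcal{A}$ whose composite $g\circ f$ belongs to $\mathcal{C}$, then $f$ is in $\mathcal{C}$; 2. for every object $a$ of $\mathcal{A}$, there exists an object $x$ of $\mathcal{A}$ such that $a\oplus x$ belongs to the essential image of $\Phi$; 3. $\Phi$ takes values in $\mathcal{C}$; 4. for every morphism $f:x\to y$ of $\mathcal{M}$, there exist an object $z$ and a morphism $g:y\to x\oplus z$ of $\mathcal{M}$ such that $g\circ f$ equals the canonical morphism $x\to x\oplus z$; 5. (a) for all objects $a$, $b$ of $\mathcal{M}$ and every morphism $f:\Phi(a)\to\Phi(b)$ of $\mathcal{A}$, there exist an object $t$ and a morphism $\varphi:a\to b\oplus t$ of $\mathcal{M}$ such that the composite $\Phi(a)\xrightarrow{\Phi(\varphi)}\Phi(b\oplus t)=\Phi(b)\oplus\Phi(t)\to\Phi(b)$ equals $f$ and the composite $\Phi(a)\xrightarrow{\Phi(\varphi)}\Phi(b\oplus t)=\Phi(b)\oplus\Phi(t)\to\Phi(t)$ belongs to $\mathcal{C}$ (the last maps being the canonical ones); (b) moreover, if $\varphi':a\to b\oplus t'$ is another morphism with the same property (for the same $f$), then there exist an object $u$ and morphisms $\psi:t\to u$,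 $\psi':t'\to u$ of $\mathcal{M}$ such that $(b\oplus\psi)\circ\varphi=(b\oplus\psi')\circ\varphi'$ as morphisms $a\to b\oplus u$. Then precomposition with the extension $\widetilde{\mathcal{M}}\to\mathcal{A}$ of $\Phi$ induces an equivalence of categories $$\mathcal{P}ol_n(\mathcal{A},\mathcal{B})\xrightarrow{\simeq}\mathcal{P}ol_n(\widetilde{\mathcal{M}},\mathcal{B})$$ for every $n\in\mathbb{N}$ and every abelian category $\mathcal{B}$.
   Context: $\mathcal{M}on_{\rm ini}$ is the category of small strict symmetric monoidal categories $(\mathcal{M},\oplus,0)$ whose unit $0$ is an initial object, with strict symmetric monoidal functors as morphisms; $\mathcal{M}on_{\rm nul}$ is the full subcategory of those whose unit is a null object. In $\mathcal{M}on_{\rm ini}$ the canonical morphism $x\to x\oplus z$ is $x=x\oplus 0\to x\oplus z$ induced by $0\to z$; in $\mathcal{M}on_{\rm nul}$ the canonical morphisms $x\oplus y\to x$, $x\oplus y\to y$ are induced by $y\to0$, $x\to 0$. **The category $\widetilde{\mathcal{M}}$.** For $\mathcal{M}$ in $\mathcal{M}on_{\rm ini}$, $\widetilde{\mathcal{M}}$ has the same objects and $\widetilde{\mathcal{M}}(a,b)=\mathrm{colim}_{t\in\mathcal{M}}\,\mathcal{M}(a,b\oplus t)$; the composite of the classes of $f:a\to b\oplus t$ and $g:b\to c\oplus u$ is the class of $(g\oplus t)\circ f$. It is an object of $\mathcal{M}on_{\rm nul}$ via $\oplus$, and there is a monoidal functor $\eta_{\mathcal{M}}:\mathcal{M}\to\widetilde{\mathcal{M}}$,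 the identity on objects, sending $f:a\to b$ to its class with $t=0$. Any morphism $\Phi:\mathcal{M}\to\mathcal{N}$ of $\mathcal{M}on_{\rm ini}$ with $\mathcal{N}$ in $\mathcal{M}on_{\rm nul}$ extends uniquely to a morphism $\widetilde{\mathcal{M}}\to\mathcal{N}$ along $\eta_{\mathcal{M}}$: it sends the class of $f:a\to b\oplus t$ to $\Phi(a)\xrightarrow{\Phi(f)}\Phi(b)\oplus\Phi(t)\to\Phi(b)$. **Polynomial functors.** For $\mathcal{N}$ in $\mathcal{M}on_{\rm nul}$ and an abelian category $\mathcal{B}$, $\mathcal{P}ol_n(\mathcal{N},\mathcal{B})$ is the full subcategory of the category $\mathbf{Fct}(\mathcal{N},\mathcal{B})$ of functors defined inductively by: $\{0\}$ for $n<0$; for $n\ge0$, the functors $F$ such that for every object $x$ the cokernel $\delta_x(F)$ of the map $F\to F(x\oplus-)$ induced by $0\to x$ lies in $\mathcal{P}ol_{n-1}(\mathcal{N},\mathcal{B})$. *)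

theory Defs
  imports "HOL-Algebra.Group"
begin

section \<open>Categories, functors, natural transformations\<close>

text \<open>
  \<open>Obj\<close> and \<open>Arr\<close> are carriers; the operations are unspecified outside them.
  \<open>Comp C g f\<close>, written \<open>g \<cdot> f\<close>, is ``\<open>g\<close> after \<open>f\<close>''.
\<close>

record ('o, 'a) cat =
  Obj :: "'o set"
  Arr :: "'a set"
  Dom :: "'a \<Rightarrow> 'o"
  Cod :: "'a \<Rightarrow> 'o"
  Ide :: "'o \<Rightarrow> 'a"
  Comp :: "'a \<Rightarrow> 'a \<Rightarrow> 'a"  (infixr "\<cdot>\<index>" 70)

definition Hom :: "('o, 'a, 'z) cat_scheme \<Rightarrow> 'o \<Rightarrow> 'o \<Rightarrow> 'a set" where
  "Hom C a b = {f \<in> Arr C. Dom C f = a \<and> Cod C f = b}"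

locale category =
  fixes C :: "('o, 'a, 'z) cat_scheme" (structure)
  assumes Dom_closed: "f \<in> Arr C \<Longrightarrow> Dom C f \<in> Obj C"
    and Cod_closed: "f \<in> Arr C \<Longrightarrow> Cod C f \<in> Obj C"
    and Ide_Hom: "a \<in> Obj C \<Longrightarrow> Ide C a \<in> Hom C a a"
    and Comp_Hom: "\<lbrakk>f \<in> Hom C a b; g \<in> Hom C b c\<rbrakk> \<Longrightarrow> g \<cdot> f \<in> Hom C a c"
    and Comp_Ide_right: "f \<in> Hom C a b \<Longrightarrow> f \<cdot> Ide C a = f"
    and Comp_Ide_left: "f \<in> Hom C a b \<Longrightarrow> Ide C b \<cdot> f = f"
    and Comp_assoc:
      "\<lbrakk>f \<in> Hom C a b; g \<in> Hom C b c; h \<in> Hom C c d\<rbrakk> \<Longrightarrow> (h \<cdot> g) \<cdot> f = h \<cdot> (g \<cdot> f)"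

definition is_iso :: "('o, 'a, 'z) cat_scheme \<Rightarrow> 'a \<Rightarrow> bool" where
  "is_iso C f \<longleftrightarrow> f \<in> Arr C \<and>
     (\<exists>g \<in> Hom C (Cod C f) (Dom C f).
        g \<cdot>\<^bsub>C\<^esub> f = Ide C (Dom C f) \<and> f \<cdot>\<^bsub>C\<^esub> g = Ide C (Cod C f))"

definition isomorphic :: "('o, 'a, 'z) cat_scheme \<Rightarrow> 'o \<Rightarrow> 'o \<Rightarrow> bool" where
  "isomorphic C a b \<longleftrightarrow> (\<exists>f \<in> Hom C a b. is_iso C f)"

definition full_subcategory :: "('o, 'a, 'z) cat_scheme \<Rightarrow> 'o set \<Rightarrow> ('o, 'a, 'z) cat_scheme" where
  "full_subcategory C S = C
     \<lparr>Obj := Obj C \<inter> S,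
      Arr := {f \<in> Arr C. Dom C f \<in> S \<and> Cod C f \<in> S}\<rparr>"

record ('o, 'a, 'p, 'b) functr =
  FO :: "'o \<Rightarrow> 'p"
  FA :: "'a \<Rightarrow> 'b"

definition is_functor ::
  "('o, 'a, 'z) cat_scheme \<Rightarrow> ('p, 'b, 'y) cat_scheme \<Rightarrow> ('o, 'a, 'p, 'b) functr \<Rightarrow> bool" where
  "is_functor C D F \<longleftrightarrow> category C \<and> category D \<and>
     (\<forall>a \<in> Obj C. FO F a \<in> Obj D) \<and>
     (\<forall>f \<in> Arr C. FA F f \<in> Hom D (FO F (Dom C f)) (FO F (Cod C f))) \<and>
     (\<forall>a \<in> Obj C. FA F (Ide C a) = Ide D (FO F a)) \<and>
     (\<forall>f \<in> Arr C. \<forall>g \<in> Arr C. Dom C g = Cod C f \<longrightarrow>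
        FA F (g \<cdot>\<^bsub>C\<^esub> f) = FA F g \<cdot>\<^bsub>D\<^esub> FA F f)"

text \<open>
  Composite functor, source category first.  The maps are restricted to the carriers of the
  source, so that equal functors are equal as records.
\<close>

definition functor_comp ::
  "('o, 'a, 'z) cat_scheme \<Rightarrow> ('p, 'b, 'q, 'c) functr \<Rightarrow> ('o, 'a, 'p, 'b) functr
    \<Rightarrow> ('o, 'a, 'q, 'c) functr" where
  "functor_comp C G F =
     \<lparr>FO = (\<lambda>a \<in> Obj C. FO G (FO F a)), FA = (\<lambda>f \<in> Arr C. FA G (FA F f))\<rparr>"

definition functor_id :: "('o, 'a, 'z) cat_scheme \<Rightarrow> ('o, 'a, 'o, 'a) functr" where
  "functor_id C = \<lparr>FO = (\<lambda>a \<in> Obj C. a), FA = (\<lambda>f \<in> Arr C. f)\<rparr>"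

definition natural_transformation ::
  "('o, 'a, 'z) cat_scheme \<Rightarrow> ('p, 'b, 'y) cat_scheme \<Rightarrow> ('o, 'a, 'p, 'b) functr
    \<Rightarrow> ('o, 'a, 'p, 'b) functr \<Rightarrow> ('o \<Rightarrow> 'b) \<Rightarrow> bool" where
  "natural_transformation C D F G \<tau> \<longleftrightarrow>
     (\<forall>a \<in> Obj C. \<tau> a \<in> Hom D (FO F a) (FO G a)) \<and>
     (\<forall>f \<in> Arr C. FA G f \<cdot>\<^bsub>D\<^esub> \<tau> (Dom C f) = \<tau> (Cod C f) \<cdot>\<^bsub>D\<^esub> FA F f)"

definition natural_isomorphism ::
  "('o, 'a, 'z) cat_scheme \<Rightarrow> ('p, 'b, 'y) cat_scheme \<Rightarrow> ('o, 'a, 'p, 'b) functr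
    \<Rightarrow> ('o, 'a, 'p, 'b) functr \<Rightarrow> ('o \<Rightarrow> 'b) \<Rightarrow> bool" where
  "natural_isomorphism C D F G \<tau> \<longleftrightarrow>
     natural_transformation C D F G \<tau> \<and> (\<forall>a \<in> Obj C. is_iso D (\<tau> a))"

definition equivalence_of_categories ::
  "('o, 'a, 'z) cat_scheme \<Rightarrow> ('p, 'b, 'y) cat_scheme \<Rightarrow> ('o, 'a, 'p, 'b) functr \<Rightarrow> bool" where
  "equivalence_of_categories C D F \<longleftrightarrow> is_functor C D F \<and>
     (\<exists>G \<eta> \<epsilon>. is_functor D C G \<and>
        natural_isomorphism C C (functor_id C) (functor_comp C G F) \<eta> \<and>
        natural_isomorphism D D (functor_comp D F G) (functor_id D) \<epsilon>)"

text \<open>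
  The functor category.  Its objects are the functors, normalised to be \<open>undefined\<close> outside the
  carriers of the source; an arrow is a triple of source, target and (normalised) family of
  components.
\<close>

type_synonym ('o, 'a, 'p, 'b) nat_arrow =
  "('o, 'a, 'p, 'b) functr \<times> ('o, 'a, 'p, 'b) functr \<times> ('o \<Rightarrow> 'b)"

definition Fct_Obj ::
  "('o, 'a, 'z) cat_scheme \<Rightarrow> ('p, 'b, 'y) cat_scheme \<Rightarrow> ('o, 'a, 'p, 'b) functr set" where
  "Fct_Obj C D =
     {F. is_functor C D F \<and> FO F \<in> extensional (Obj C) \<and> FA F \<in> extensional (Arr C)}"

definition Fct ::
  "('o, 'a, 'z) cat_scheme \<Rightarrow> ('p, 'b, 'y) cat_scheme
    \<Rightarrow> (('o, 'a, 'p, 'b) functr, ('o, 'a, 'p, 'b) nat_arrow) cat" where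
  "Fct C D =
     \<lparr>Obj = Fct_Obj C D,
      Arr = {(F, G, \<tau>). F \<in> Fct_Obj C D \<and> G \<in> Fct_Obj C D \<and>
               natural_transformation C D F G \<tau> \<and> \<tau> \<in> extensional (Obj C)},
      Dom = (\<lambda>(F, G, \<tau>). F),
      Cod = (\<lambda>(F, G, \<tau>). G),
      Ide = (\<lambda>F. (F, F, \<lambda>a \<in> Obj C. Ide D (FO F a))),
      Comp = (\<lambda>(G', H, \<sigma>) (F, G, \<tau>). (F, H, \<lambda>a \<in> Obj C. \<sigma> a \<cdot>\<^bsub>D\<^esub> \<tau> a))\<rparr>"

text \<open>Precomposition with a functor \<open>K\<close> with source \<open>C\<close>, on functors and on their arrows.\<close>

definition precomp ::
  "('o, 'a, 'z) cat_scheme \<Rightarrow> ('o, 'a, 'p, 'b) functr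
    \<Rightarrow> (('p, 'b, 'q, 'c) functr, ('p, 'b, 'q, 'c) nat_arrow,
        ('o, 'a, 'q, 'c) functr, ('o, 'a, 'q, 'c) nat_arrow) functr" where
  "precomp C K =
     \<lparr>FO = (\<lambda>F. functor_comp C F K),
      FA = (\<lambda>(F, G, \<tau>). (functor_comp C F K, functor_comp C G K, \<lambda>a \<in> Obj C. \<tau> (FO K a)))\<rparr>"


section \<open>Zero objects, cokernels, abelian categories\<close>

definition initial_object :: "('o, 'a, 'z) cat_scheme \<Rightarrow> 'o \<Rightarrow> bool" where
  "initial_object C z \<longleftrightarrow> z \<in> Obj C \<and> (\<forall>a \<in> Obj C. \<exists>!f. f \<in> Hom C z a)"

definition terminal_object :: "('o, 'a, 'z) cat_scheme \<Rightarrow> 'o \<Rightarrow> bool" where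
  "terminal_object C z \<longleftrightarrow> z \<in> Obj C \<and> (\<forall>a \<in> Obj C. \<exists>!f. f \<in> Hom C a z)"

definition null_object :: "('o, 'a, 'z) cat_scheme \<Rightarrow> 'o \<Rightarrow> bool" where
  "null_object C z \<longleftrightarrow> initial_object C z \<and> terminal_object C z"

definition zero_arrow :: "('o, 'a, 'z) cat_scheme \<Rightarrow> 'a \<Rightarrow> bool" where
  "zero_arrow C f \<longleftrightarrow> f \<in> Arr C \<and>
     (\<exists>z g h. null_object C z \<and> g \<in> Hom C (Dom C f) z \<and> h \<in> Hom C z (Cod C f) \<and>
        f = h \<cdot>\<^bsub>C\<^esub> g)"

definition is_kernel :: "('o, 'a, 'z) cat_scheme \<Rightarrow> 'a \<Rightarrow> 'a \<Rightarrow> bool" where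
  "is_kernel C f k \<longleftrightarrow> f \<in> Arr C \<and> k \<in> Arr C \<and> Cod C k = Dom C f \<and>
     zero_arrow C (f \<cdot>\<^bsub>C\<^esub> k) \<and>
     (\<forall>h \<in> Arr C. Cod C h = Dom C f \<and> zero_arrow C (f \<cdot>\<^bsub>C\<^esub> h) \<longrightarrow>
        (\<exists>!w. w \<in> Hom C (Dom C h) (Dom C k) \<and> k \<cdot>\<^bsub>C\<^esub> w = h))"

definition is_cokernel :: "('o, 'a, 'z) cat_scheme \<Rightarrow> 'a \<Rightarrow> 'a \<Rightarrow> bool" where
  "is_cokernel C f q \<longleftrightarrow> f \<in> Arr C \<and> q \<in> Arr C \<and> Dom C q = Cod C f \<and>
     zero_arrow C (q \<cdot>\<^bsub>C\<^esub> f) \<and>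
     (\<forall>h \<in> Arr C. Dom C h = Cod C f \<and> zero_arrow C (h \<cdot>\<^bsub>C\<^esub> f) \<longrightarrow>
        (\<exists>!w. w \<in> Hom C (Cod C q) (Cod C h) \<and> w \<cdot>\<^bsub>C\<^esub> q = h))"

definition monic :: "('o, 'a, 'z) cat_scheme \<Rightarrow> 'a \<Rightarrow> bool" where
  "monic C f \<longleftrightarrow> f \<in> Arr C \<and>
     (\<forall>x \<in> Obj C. \<forall>g \<in> Hom C x (Dom C f). \<forall>h \<in> Hom C x (Dom C f).
        f \<cdot>\<^bsub>C\<^esub> g = f \<cdot>\<^bsub>C\<^esub> h \<longrightarrow> g = h)"

definition epic :: "('o, 'a, 'z) cat_scheme \<Rightarrow> 'a \<Rightarrow> bool" where
  "epic C f \<longleftrightarrow> f \<in> Arr C \<and>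
     (\<forall>x \<in> Obj C. \<forall>g \<in> Hom C (Cod C f) x. \<forall>h \<in> Hom C (Cod C f) x.
        g \<cdot>\<^bsub>C\<^esub> f = h \<cdot>\<^bsub>C\<^esub> f \<longrightarrow> g = h)"

locale preadditive_category = category B
  for B :: "('o, 'a, 'z) cat_scheme" (structure) and add :: "'a \<Rightarrow> 'a \<Rightarrow> 'a" +
  assumes Hom_group:
      "\<lbrakk>a \<in> Obj B; b \<in> Obj B\<rbrakk> \<Longrightarrow>
        \<exists>z. comm_group \<lparr>carrier = Hom B a b, monoid.mult = add, one = z\<rparr>"
    and Comp_add_right:
      "\<lbrakk>f \<in> Hom B a b; f' \<in> Hom B a b; g \<in> Hom B b c\<rbrakk> \<Longrightarrow>
        g \<cdot> add f f' = add (g \<cdot> f) (g \<cdot> f')"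
    and Comp_add_left:
      "\<lbrakk>f \<in> Hom B a b; g \<in> Hom B b c; g' \<in> Hom B b c\<rbrakk> \<Longrightarrow>
        add g g' \<cdot> f = add (g \<cdot> f) (g' \<cdot> f)"

text \<open>
  The group structure on the hom sets of an abelian category is determined by the category, so
  that its mere existence is required.
\<close>

locale abelian_category = category B
  for B :: "('o, 'a, 'z) cat_scheme" (structure) +
  assumes null_exists: "\<exists>z. null_object B z"
    and biproducts:
      "\<exists>add. preadditive_category B add \<and>
        (\<forall>a \<in> Obj B. \<forall>b \<in> Obj B. \<exists>c \<in> Obj B.
           \<exists>i \<in> Hom B a c. \<exists>j \<in> Hom B b c. \<exists>p \<in> Hom B c a. \<exists>q \<in> Hom B c b.
             p \<cdot> i = Ide B a \<and> q \<cdot> j = Ide B b \<and> add (i \<cdot> p) (j \<cdot> q) = Ide B c)"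
    and kernel_exists: "f \<in> Arr B \<Longrightarrow> \<exists>k. is_kernel B f k"
    and cokernel_exists: "f \<in> Arr B \<Longrightarrow> \<exists>q. is_cokernel B f q"
    and monic_normal: "monic B f \<Longrightarrow> \<exists>g. is_kernel B g f"
    and epic_normal: "epic B f \<Longrightarrow> \<exists>g. is_cokernel B g f"


section \<open>Strict symmetric monoidal categories\<close>

text \<open>
  Strictness concerns associativity and the unit; the symmetry
  \<open>Sym M x y : x \<oplus> y \<rightarrow> y \<oplus> x\<close> is an arbitrary involutive braiding.
\<close>

record ('o, 'a) smcat = "('o, 'a) cat" +
  SumO :: "'o \<Rightarrow> 'o \<Rightarrow> 'o"  (infixr "\<oplus>\<index>" 75)
  SumA :: "'a \<Rightarrow> 'a \<Rightarrow> 'a"  (infixr "\<uplus>\<index>" 75)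
  Unit :: 'o
  Sym :: "'o \<Rightarrow> 'o \<Rightarrow> 'a"

locale strict_symmetric_monoidal = category M
  for M :: "('o, 'a, 'z) smcat_scheme" (structure) +
  assumes Unit_closed: "Unit M \<in> Obj M"
    and SumO_closed: "\<lbrakk>x \<in> Obj M; y \<in> Obj M\<rbrakk> \<Longrightarrow> x \<oplus> y \<in> Obj M"
    and SumA_Hom:
      "\<lbrakk>f \<in> Hom M a b; g \<in> Hom M c d\<rbrakk> \<Longrightarrow> f \<uplus> g \<in> Hom M (a \<oplus> c) (b \<oplus> d)"
    and SumA_Ide: "\<lbrakk>x \<in> Obj M; y \<in> Obj M\<rbrakk> \<Longrightarrow> Ide M x \<uplus> Ide M y = Ide M (x \<oplus> y)"
    and SumA_Comp:
      "\<lbrakk>f \<in> Hom M a b; g \<in> Hom M b c; f' \<in> Hom M a' b'; g' \<in> Hom M b' c'\<rbrakk> \<Longrightarrow>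
        (g \<cdot> f) \<uplus> (g' \<cdot> f') = (g \<uplus> g') \<cdot> (f \<uplus> f')"
    and SumO_assoc: "\<lbrakk>x \<in> Obj M; y \<in> Obj M; z \<in> Obj M\<rbrakk> \<Longrightarrow> (x \<oplus> y) \<oplus> z = x \<oplus> (y \<oplus> z)"
    and SumA_assoc: "\<lbrakk>f \<in> Arr M; g \<in> Arr M; h \<in> Arr M\<rbrakk> \<Longrightarrow> (f \<uplus> g) \<uplus> h = f \<uplus> (g \<uplus> h)"
    and SumO_Unit_left: "x \<in> Obj M \<Longrightarrow> Unit M \<oplus> x = x"
    and SumO_Unit_right: "x \<in> Obj M \<Longrightarrow> x \<oplus> Unit M = x"
    and SumA_Unit_left: "f \<in> Arr M \<Longrightarrow> Ide M (Unit M) \<uplus> f = f"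
    and SumA_Unit_right: "f \<in> Arr M \<Longrightarrow> f \<uplus> Ide M (Unit M) = f"
    and Sym_Hom: "\<lbrakk>x \<in> Obj M; y \<in> Obj M\<rbrakk> \<Longrightarrow> Sym M x y \<in> Hom M (x \<oplus> y) (y \<oplus> x)"
    and Sym_natural:
      "\<lbrakk>f \<in> Hom M a b; g \<in> Hom M c d\<rbrakk> \<Longrightarrow> Sym M b d \<cdot> (f \<uplus> g) = (g \<uplus> f) \<cdot> Sym M a c"
    and Sym_involutive:
      "\<lbrakk>x \<in> Obj M; y \<in> Obj M\<rbrakk> \<Longrightarrow> Sym M y x \<cdot> Sym M x y = Ide M (x \<oplus> y)"
    and Sym_Unit: "x \<in> Obj M \<Longrightarrow> Sym M x (Unit M) = Ide M x"
    and Sym_hexagon: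
      "\<lbrakk>x \<in> Obj M; y \<in> Obj M; z \<in> Obj M\<rbrakk> \<Longrightarrow>
        Sym M (x \<oplus> y) z = (Sym M x z \<uplus> Ide M y) \<cdot> (Ide M x \<uplus> Sym M y z)"

locale Mon_ini = strict_symmetric_monoidal M
  for M :: "('o, 'a, 'z) smcat_scheme" (structure) +
  assumes Unit_initial: "initial_object M (Unit M)"

locale Mon_nul = strict_symmetric_monoidal M
  for M :: "('o, 'a, 'z) smcat_scheme" (structure) +
  assumes Unit_null: "null_object M (Unit M)"

definition strict_symmetric_monoidal_functor ::
  "('o, 'a, 'z) smcat_scheme \<Rightarrow> ('p, 'b, 'y) smcat_scheme \<Rightarrow> ('o, 'a, 'p, 'b) functr \<Rightarrow> bool" where
  "strict_symmetric_monoidal_functor M N F \<longleftrightarrow> is_functor M N F \<and>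
     FO F (Unit M) = Unit N \<and>
     (\<forall>x \<in> Obj M. \<forall>y \<in> Obj M. FO F (x \<oplus>\<^bsub>M\<^esub> y) = FO F x \<oplus>\<^bsub>N\<^esub> FO F y) \<and>
     (\<forall>f \<in> Arr M. \<forall>g \<in> Arr M. FA F (f \<uplus>\<^bsub>M\<^esub> g) = FA F f \<uplus>\<^bsub>N\<^esub> FA F g) \<and>
     (\<forall>x \<in> Obj M. \<forall>y \<in> Obj M. FA F (Sym M x y) = Sym N (FO F x) (FO F y))"

text \<open>
  A monoidal subcategory with the same objects is given by its set of arrows.
\<close>

definition wide_monoidal_subcategory :: "('o, 'a, 'z) smcat_scheme \<Rightarrow> 'a set \<Rightarrow> bool" where
  "wide_monoidal_subcategory A S \<longleftrightarrow> S \<subseteq> Arr A \<and>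
     (\<forall>x \<in> Obj A. Ide A x \<in> S) \<and>
     (\<forall>f \<in> S. \<forall>g \<in> S. Dom A g = Cod A f \<longrightarrow> g \<cdot>\<^bsub>A\<^esub> f \<in> S) \<and>
     (\<forall>f \<in> S. \<forall>g \<in> S. f \<uplus>\<^bsub>A\<^esub> g \<in> S)"

text \<open>The canonical arrows when the unit is initial, respectively null.\<close>

definition from_Unit :: "('o, 'a, 'z) smcat_scheme \<Rightarrow> 'o \<Rightarrow> 'a" where
  "from_Unit M x = (THE f. f \<in> Hom M (Unit M) x)"

definition to_Unit :: "('o, 'a, 'z) smcat_scheme \<Rightarrow> 'o \<Rightarrow> 'a" where
  "to_Unit M x = (THE f. f \<in> Hom M x (Unit M))"

definition inj1 :: "('o, 'a, 'z) smcat_scheme \<Rightarrow> 'o \<Rightarrow> 'o \<Rightarrow> 'a" where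
  "inj1 M x z = Ide M x \<uplus>\<^bsub>M\<^esub> from_Unit M z"

definition proj1 :: "('o, 'a, 'z) smcat_scheme \<Rightarrow> 'o \<Rightarrow> 'o \<Rightarrow> 'a" where
  "proj1 M x y = Ide M x \<uplus>\<^bsub>M\<^esub> to_Unit M y"

definition proj2 :: "('o, 'a, 'z) smcat_scheme \<Rightarrow> 'o \<Rightarrow> 'o \<Rightarrow> 'a" where
  "proj2 M x y = to_Unit M x \<uplus>\<^bsub>M\<^esub> Ide M y"


section \<open>The category obtained by making the unit null\<close>

text \<open>
  Colimit over \<open>C\<close> of the set-valued functor given by \<open>X\<close> on objects and \<open>act\<close> on arrows: the
  quotient of the disjoint union by the equivalence relation generated by
  \<open>(s, x) \<sim> (t, act h x)\<close> for \<open>h : s \<rightarrow> t\<close>.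
\<close>

definition colim_rel ::
  "('o, 'a, 'z) cat_scheme \<Rightarrow> ('o \<Rightarrow> 'x set) \<Rightarrow> ('a \<Rightarrow> 'x \<Rightarrow> 'x) \<Rightarrow> (('o \<times> 'x) \<times> ('o \<times> 'x)) set" where
  "colim_rel C X act =
     {((s, x), (t, act h x)) | s x t h. s \<in> Obj C \<and> t \<in> Obj C \<and> h \<in> Hom C s t \<and> x \<in> X s}"

definition colim_class ::
  "('o, 'a, 'z) cat_scheme \<Rightarrow> ('o \<Rightarrow> 'x set) \<Rightarrow> ('a \<Rightarrow> 'x \<Rightarrow> 'x) \<Rightarrow> 'o \<times> 'x \<Rightarrow> ('o \<times> 'x) set" where
  "colim_class C X act p = (colim_rel C X act \<union> (colim_rel C X act)\<inverse>)\<^sup>* `` {p}"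

definition colim_set ::
  "('o, 'a, 'z) cat_scheme \<Rightarrow> ('o \<Rightarrow> 'x set) \<Rightarrow> ('a \<Rightarrow> 'x \<Rightarrow> 'x) \<Rightarrow> ('o \<times> 'x) set set" where
  "colim_set C X act = colim_class C X act ` Sigma (Obj C) X"

text \<open>
  An arrow \<open>a \<rightarrow> b\<close> of the new category is a triple \<open>(a, b, c)\<close> with \<open>c\<close> an element of the colimit
  over \<open>t\<close> of the sets \<open>Hom M a (b \<oplus> t)\<close>.
\<close>

type_synonym ('o, 'a) tarrow = "'o \<times> 'o \<times> ('o \<times> 'a) set"

definition tclass :: "('o, 'a, 'z) smcat_scheme \<Rightarrow> 'o \<Rightarrow> 'o \<Rightarrow> 'o \<Rightarrow> 'a \<Rightarrow> ('o, 'a) tarrow" where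
  "tclass M a b t f =
     (a, b, colim_class M (\<lambda>t. Hom M a (b \<oplus>\<^bsub>M\<^esub> t)) (\<lambda>h f. (Ide M b \<uplus>\<^bsub>M\<^esub> h) \<cdot>\<^bsub>M\<^esub> f) (t, f))"

definition tHom :: "('o, 'a, 'z) smcat_scheme \<Rightarrow> 'o \<Rightarrow> 'o \<Rightarrow> ('o, 'a) tarrow set" where
  "tHom M a b =
     {a} \<times> {b} \<times>
       colim_set M (\<lambda>t. Hom M a (b \<oplus>\<^bsub>M\<^esub> t)) (\<lambda>h f. (Ide M b \<uplus>\<^bsub>M\<^esub> h) \<cdot>\<^bsub>M\<^esub> f)"

text \<open>
  Operations on classes are computed on representatives; \<open>the_elem\<close> extracts the common value.

  In the sum of the classes of \<open>f : a \<rightarrow> b \<oplus> t\<close> and \<open>f' : a' \<rightarrow> b' \<oplus> t'\<close> the symmetry of \<open>M\<close> is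
  used to pass from \<open>b \<oplus> t \<oplus> b' \<oplus> t'\<close> to \<open>(b \<oplus> b') \<oplus> (t \<oplus> t')\<close>.
\<close>

definition tComp ::
  "('o, 'a, 'z) smcat_scheme \<Rightarrow> ('o, 'a) tarrow \<Rightarrow> ('o, 'a) tarrow \<Rightarrow> ('o, 'a) tarrow" where
  "tComp M = (\<lambda>(b, c, G) (a, _, F).
     the_elem {tclass M a c (u \<oplus>\<^bsub>M\<^esub> t) ((g \<uplus>\<^bsub>M\<^esub> Ide M t) \<cdot>\<^bsub>M\<^esub> f) | u g t f.
                 (u, g) \<in> G \<and> (t, f) \<in> F})"

definition tSum ::
  "('o, 'a, 'z) smcat_scheme \<Rightarrow> ('o, 'a) tarrow \<Rightarrow> ('o, 'a) tarrow \<Rightarrow> ('o, 'a) tarrow" where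
  "tSum M = (\<lambda>(a, b, F) (a', b', F').
     the_elem {tclass M (a \<oplus>\<^bsub>M\<^esub> a') (b \<oplus>\<^bsub>M\<^esub> b') (t \<oplus>\<^bsub>M\<^esub> t')
                 ((Ide M b \<uplus>\<^bsub>M\<^esub> Sym M t b' \<uplus>\<^bsub>M\<^esub> Ide M t') \<cdot>\<^bsub>M\<^esub> (f \<uplus>\<^bsub>M\<^esub> f')) | t f t' f'.
                 (t, f) \<in> F \<and> (t', f') \<in> F'})"

definition tilde :: "('o, 'a, 'z) smcat_scheme \<Rightarrow> ('o, ('o, 'a) tarrow) smcat" where
  "tilde M =
     \<lparr>Obj = Obj M,
      Arr = (\<Union>a \<in> Obj M. \<Union>b \<in> Obj M. tHom M a b),
      Dom = (\<lambda>(a, b, c). a),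
      Cod = (\<lambda>(a, b, c). b),
      Ide = (\<lambda>a. tclass M a a (Unit M) (Ide M a)),
      Comp = tComp M,
      SumO = SumO M,
      SumA = tSum M,
      Unit = Unit M,
      Sym = (\<lambda>x y. tclass M (x \<oplus>\<^bsub>M\<^esub> y) (y \<oplus>\<^bsub>M\<^esub> x) (Unit M) (Sym M x y))\<rparr>"

text \<open>The functor \<open>\<eta>\<close> from \<open>M\<close> to \<open>tilde M\<close>, and the extension along it of a functor \<open>\<Phi>\<close> on \<open>M\<close>.\<close>

definition tilde_eta :: "('o, 'a, 'z) smcat_scheme \<Rightarrow> ('o, 'a, 'o, ('o, 'a) tarrow) functr" where
  "tilde_eta M =
     \<lparr>FO = (\<lambda>a. a), FA = (\<lambda>f. tclass M (Dom M f) (Cod M f) (Unit M) f)\<rparr>"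

definition tilde_extension ::
  "('p, 'b, 'y) smcat_scheme \<Rightarrow> ('o, 'a, 'p, 'b) functr
    \<Rightarrow> ('o, ('o, 'a) tarrow, 'p, 'b) functr" where
  "tilde_extension N \<Phi> =
     \<lparr>FO = FO \<Phi>,
      FA = (\<lambda>(a, b, c). the_elem {proj1 N (FO \<Phi> b) (FO \<Phi> t) \<cdot>\<^bsub>N\<^esub> FA \<Phi> f | t f. (t, f) \<in> c})\<rparr>"


section \<open>Polynomial functors\<close>

text \<open>
  \<open>shift N x F\<close> is \<open>F(x \<oplus> -)\<close>, and \<open>shift_arrow N x F\<close> is the arrow \<open>F \<rightarrow> F(x \<oplus> -)\<close> of the functor
  category induced by \<open>0 \<rightarrow> x\<close>; recall that \<open>y = 0 \<oplus> y\<close>.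
\<close>

definition shift ::
  "('o, 'a, 'z) smcat_scheme \<Rightarrow> 'o \<Rightarrow> ('o, 'a, 'p, 'b) functr \<Rightarrow> ('o, 'a, 'p, 'b) functr" where
  "shift N x F = functor_comp N F \<lparr>FO = (\<lambda>y. x \<oplus>\<^bsub>N\<^esub> y), FA = (\<lambda>f. Ide N x \<uplus>\<^bsub>N\<^esub> f)\<rparr>"

definition shift_arrow ::
  "('o, 'a, 'z) smcat_scheme \<Rightarrow> 'o \<Rightarrow> ('o, 'a, 'p, 'b) functr \<Rightarrow> ('o, 'a, 'p, 'b) nat_arrow" where
  "shift_arrow N x F =
     (F, shift N x F, \<lambda>y \<in> Obj N. FA F (from_Unit N x \<uplus>\<^bsub>N\<^esub> Ide N y))"

text \<open>
  The cokernel \<open>\<delta>\<^sub>x(F)\<close> is defined up to isomorphism only and the classes of functors below are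
  closed under isomorphism; in particular \<open>{0}\<close> is the class of all null objects of the functor
  category.
\<close>

inductive polynomial ::
  "('o, 'a, 'z) smcat_scheme \<Rightarrow> ('p, 'b, 'y) cat_scheme \<Rightarrow> int \<Rightarrow> ('o, 'a, 'p, 'b) functr \<Rightarrow> bool"
  for N :: "('o, 'a, 'z) smcat_scheme" and B :: "('p, 'b, 'y) cat_scheme" where
  polynomial_neg: "\<lbrakk>n < 0; null_object (Fct N B) F\<rbrakk> \<Longrightarrow> polynomial N B n F"
| polynomial_step:
    "\<lbrakk>n \<ge> 0; F \<in> Obj (Fct N B);
      \<forall>x \<in> Obj N. \<exists>q. is_cokernel (Fct N B) (shift_arrow N x F) q \<and>
        polynomial N B (n - 1) (Cod (Fct N B) q)\<rbrakk> \<Longrightarrow> polynomial N B n F"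

definition Pol ::
  "int \<Rightarrow> ('o, 'a, 'z) smcat_scheme \<Rightarrow> ('p, 'b, 'y) cat_scheme
    \<Rightarrow> (('o, 'a, 'p, 'b) functr, ('o, 'a, 'p, 'b) nat_arrow) cat" where
  "Pol n N B = full_subcategory (Fct N B) {F. polynomial N B n F}"

end

theory Submission
  imports Defs
begin

text \<open>
  By 5(a) and 2 the extension \<open>E\<close> of \<open>\<Phi>\<close> is full and every object of \<open>A\<close> is a retract of one in its
  image.  Idempotents split in \<open>B\<close>, hence precomposition with \<open>E\<close> is fully faithful and its image
  consists, up to isomorphism, of the functors that do not distinguish arrows with the same image
  under \<open>E\<close>.

  A functor \<open>F\<close> has degree less than \<open>k\<close> iff the product over the \<open>x\<^sub>i\<close> of the operators
  \<open>1 - F(e\<^sub>i)\<close> vanishes on all \<open>F(x\<^sub>1 \<oplus> \<dots> \<oplus> x\<^sub>k \<oplus> w)\<close>, where the idempotent \<open>e\<^sub>i\<close> kills the summand \<open>x\<^sub>i\<close>.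
  This condition passes to retracts, so that being polynomial can be tested on the image of \<open>E\<close>.

  It remains to see that a polynomial \<open>F\<close> on \<open>tilde M\<close> satisfies \<open>F(\<phi>) = F(\<phi>')\<close> if \<open>E(\<phi>) = E(\<phi>')\<close>.
  Iterating 5(a) for the identity of \<open>a\<close> gives \<open>\<alpha> : a \<rightarrow> Y = t \<oplus> \<dots> \<oplus> t \<oplus> a\<close> in \<open>M\<close> whose components at the
  summands \<open>t\<close> lie in \<open>C\<close>.  By 4 it has a left inverse \<open>p\<close> in \<open>tilde M\<close>, so \<open>\<phi> = \<phi> p \<alpha>\<close> and
  \<open>\<phi>' = \<phi>' p \<alpha>\<close>.  If \<open>e\<close> kills some summand \<open>t\<close>, then \<open>\<phi> p e \<alpha> = \<phi>' p e \<alpha>\<close> by 1 and 5(b).  Expanding the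
  vanishing product on \<open>F(Y)\<close> gives \<open>F(\<phi>) = F(\<phi>')\<close>.
\<close>

section \<open>Equivalences of categories\<close>

text \<open>The inductive definition speaks of cokernels in a functor category, which are determined
  only up to isomorphism and are hard to follow when the source category changes. When the unit is
  null, \<open>F -> F(x \<oplus> -)\<close> is split by the projection, so that its cokernel is a
  direct summand, cut out by an idempotent. Degree conditions thereby become equations between
  arrows, and these can be carried along functors and retracts. The number of summands t in Y is
  dictated by the degree: a product of k factors needs k of them, and every term of its expansion
  except the identity kills at least one. Killing a summand moves it into the part of the target
  that the colimit discards, so its component in C becomes what 5(b) asks to lie in C; hypothesis 1
  keeps this true when later arrows discard more. Hypothesis 4 gives a left inverse in
  \<open>tilde M\<close>, though in general not in M, because the colimit identifies the canonical
  arrow x -> x \<oplus> z with the identity. Cross effects are studied in a structure weaker than a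
  monoidal category, common to \<open>tilde M\<close> and \<open>A\<close>.\<close>

context category begin

lemma HomD:
  assumes "f \<in> Hom C a b"
  shows "f \<in> Arr C" "Dom C f = a" "Cod C f = b" "a \<in> Obj C" "b \<in> Obj C"
  using assms Dom_closed Cod_closed by (auto simp: Hom_def)

lemma Hom_DomI: "f \<in> Arr C \<Longrightarrow> f \<in> Hom C (Dom C f) (Cod C f)"
  by (simp add: Hom_def)

lemma is_isoI:
  assumes "f \<in> Hom C a b" "g \<in> Hom C b a" "g \<cdot> f = Ide C a" "f \<cdot> g = Ide C b"
  shows "is_iso C f"
  using assms HomD[OF assms(1)] unfolding is_iso_def by auto

lemma is_isoE:
  assumes "is_iso C f" "f \<in> Hom C a b"
  obtains g where "g \<in> Hom C b a" "g \<cdot> f = Ide C a" "f \<cdot> g = Ide C b"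
  using assms HomD[OF assms(2)] unfolding is_iso_def by auto

lemma full_subcategory_Hom:
  "Hom (full_subcategory C S) a b = (if a \<in> S \<and> b \<in> S then Hom C a b else {})"
  by (auto simp: full_subcategory_def Hom_def)

lemma full_subcategory_category: "category (full_subcategory C S)"
proof -
  have H: "f \<in> Hom (full_subcategory C S) a b \<longleftrightarrow> a \<in> S \<and> b \<in> S \<and> f \<in> Hom C a b" for f a b
    by (auto simp: full_subcategory_Hom)
  show ?thesis
  proof (unfold_locales, goal_cases)
    case (3 a) then show ?case using H Ide_Hom by (simp add: full_subcategory_def)
  next
    case (4 f a b g c) then show ?case
      using Comp_Hom[of f a b g c] unfolding H by (simp add: full_subcategory_def)
  next
    case (5 f a b) then show ?case using Comp_Ide_right[of f a b] unfolding H by (simp add: full_subcategory_def)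
  next
    case (6 f a b) then show ?case using Comp_Ide_left[of f a b] unfolding H by (simp add: full_subcategory_def)
  next
    case (7 f a b g c h d) then show ?case using Comp_assoc[of f a b g c h d] unfolding H by (simp add: full_subcategory_def)
  qed (use Dom_closed Cod_closed in \<open>auto simp: full_subcategory_def\<close>)
qed

end

lemma functor_Obj: "is_functor C D F \<Longrightarrow> a \<in> Obj C \<Longrightarrow> FO F a \<in> Obj D"
  by (simp add: is_functor_def)

lemma functor_Hom: "is_functor C D F \<Longrightarrow> f \<in> Hom C a b \<Longrightarrow> FA F f \<in> Hom D (FO F a) (FO F b)"
  by (auto simp: is_functor_def Hom_def)

lemma functor_Ide: "is_functor C D F \<Longrightarrow> a \<in> Obj C \<Longrightarrow> FA F (Ide C a) = Ide D (FO F a)"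
  by (simp add: is_functor_def)

lemma functor_Comp:
  "is_functor C D F \<Longrightarrow> f \<in> Hom C a b \<Longrightarrow> g \<in> Hom C b c \<Longrightarrow>
    FA F (g \<cdot>\<^bsub>C\<^esub> f) = FA F g \<cdot>\<^bsub>D\<^esub> FA F f"
  by (simp add: is_functor_def Hom_def)

lemma is_functorI:
  assumes "category C" "category D"
    and "\<And>a. a \<in> Obj C \<Longrightarrow> FO F a \<in> Obj D"
    and "\<And>f a b. f \<in> Hom C a b \<Longrightarrow> FA F f \<in> Hom D (FO F a) (FO F b)"
    and "\<And>a. a \<in> Obj C \<Longrightarrow> FA F (Ide C a) = Ide D (FO F a)"
    and "\<And>f g a b c. f \<in> Hom C a b \<Longrightarrow> g \<in> Hom C b c \<Longrightarrow> FA F (g \<cdot>\<^bsub>C\<^esub> f) = FA F g \<cdot>\<^bsub>D\<^esub> FA F f"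
  shows "is_functor C D F"
  using assms unfolding is_functor_def by (auto simp: Hom_def)

lemma functor_categories: "is_functor C D F \<Longrightarrow> category C" "is_functor C D F \<Longrightarrow> category D"
  by (simp_all add: is_functor_def)

lemma functor_comp_FO [simp]: "a \<in> Obj C \<Longrightarrow> FO (functor_comp C G F) a = FO G (FO F a)"
  by (simp add: functor_comp_def)

lemma functor_comp_FA_Hom [simp]: "f \<in> Hom C a b \<Longrightarrow> FA (functor_comp C G F) f = FA G (FA F f)"
  by (simp add: functor_comp_def Hom_def)

lemma functor_comp_functor:
  assumes F: "is_functor C D F" and G: "is_functor D E G"
  shows "is_functor C E (functor_comp C G F)"
proof -
  interpret C: category C using functor_categories[OF F] by simp
  note cats = functor_categories[OF F] functor_categories[OF G]
  show ?thesis
  proof (rule is_functorI)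
    fix f g a b c assume f: "f \<in> Hom C a b" and g: "g \<in> Hom C b c"
    show "FA (functor_comp C G F) (g \<cdot>\<^bsub>C\<^esub> f)
        = FA (functor_comp C G F) g \<cdot>\<^bsub>E\<^esub> FA (functor_comp C G F) f"
      using f g C.Comp_Hom[OF f g]
      by (simp add: functor_Comp[OF F f g] functor_Comp[OF G functor_Hom[OF F f] functor_Hom[OF F g]])
  next
    fix f a b assume f: "f \<in> Hom C a b"
    show "FA (functor_comp C G F) f \<in> Hom E (FO (functor_comp C G F) a) (FO (functor_comp C G F) b)"
      using functor_Hom[OF G functor_Hom[OF F f]] f C.HomD[OF f] by simp
  next
    fix a assume a: "a \<in> Obj C"
    show "FA (functor_comp C G F) (Ide C a) = Ide E (FO (functor_comp C G F) a)"
      using C.Ide_Hom[OF a] a by (simp add: functor_Ide[OF F] functor_Ide[OF G functor_Obj[OF F a]])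
  qed (use cats in \<open>simp_all add: functor_Obj[OF F] functor_Obj[OF G]\<close>)
qed

lemma functor_comp_Fct_Obj:
  assumes F: "is_functor C D F" and G: "is_functor D E G"
  shows "functor_comp C G F \<in> Fct_Obj C E"
  using functor_comp_functor[OF assms] by (simp add: Fct_Obj_def functor_comp_def)

lemma natural_transformationI:
  assumes "\<And>a. a \<in> Obj C \<Longrightarrow> \<tau> a \<in> Hom D (FO F a) (FO G a)"
    and "\<And>f a b. f \<in> Hom C a b \<Longrightarrow> FA G f \<cdot>\<^bsub>D\<^esub> \<tau> a = \<tau> b \<cdot>\<^bsub>D\<^esub> FA F f"
  shows "natural_transformation C D F G \<tau>"
  using assms unfolding natural_transformation_def by (simp add: Hom_def)

lemma natural_transformation_Hom:
  "natural_transformation C D F G \<tau> \<Longrightarrow> a \<in> Obj C \<Longrightarrow> \<tau> a \<in> Hom D (FO F a) (FO G a)"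
  by (simp add: natural_transformation_def)

lemma natural_transformation_nat:
  "natural_transformation C D F G \<tau> \<Longrightarrow> f \<in> Hom C a b \<Longrightarrow> FA G f \<cdot>\<^bsub>D\<^esub> \<tau> a = \<tau> b \<cdot>\<^bsub>D\<^esub> FA F f"
  by (auto simp: natural_transformation_def Hom_def)

text \<open>A quasi-inverse is built by choice: objects \<open>c d\<close> with isomorphisms
  \<open>e d\<close>, and on arrows a preimage of the arrow conjugated by these isomorphisms.
  Faithfulness turns every identity to be proved in \<open>C\<close> into one in \<open>D\<close>,
  where the isomorphisms cancel.\<close>

lemma equivalence_of_categoriesI:
  fixes R :: "('o, 'a, 'p, 'b) functr"
  assumes R: "is_functor C D R"
    and faithful: "\<And>a b f g. f \<in> Hom C a b \<Longrightarrow> g \<in> Hom C a b \<Longrightarrow> FA R f = FA R g \<Longrightarrow> f = g"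
    and full: "\<And>a b h. a \<in> Obj C \<Longrightarrow> b \<in> Obj C \<Longrightarrow> h \<in> Hom D (FO R a) (FO R b) \<Longrightarrow>
      \<exists>f \<in> Hom C a b. FA R f = h"
    and ess_surj: "\<And>d. d \<in> Obj D \<Longrightarrow> \<exists>c \<in> Obj C. isomorphic D (FO R c) d"
  shows "equivalence_of_categories C D R"
proof -
  interpret C: category C using functor_categories[OF R] by simp
  interpret D: category D using functor_categories[OF R] by simp
  have "\<exists>c e e'. c \<in> Obj C \<and> e \<in> Hom D (FO R c) d \<and> e' \<in> Hom D d (FO R c) \<and>
      e' \<cdot>\<^bsub>D\<^esub> e = Ide D (FO R c) \<and> e \<cdot>\<^bsub>D\<^esub> e' = Ide D d" if "d \<in> Obj D" for d
    using ess_surj[OF that] unfolding isomorphic_def by (elim bexE D.is_isoE) blast+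
  then obtain c e e' where c: "\<And>d. d \<in> Obj D \<Longrightarrow> c d \<in> Obj C"
    and e: "\<And>d. d \<in> Obj D \<Longrightarrow> e d \<in> Hom D (FO R (c d)) d"
    and e': "\<And>d. d \<in> Obj D \<Longrightarrow> e' d \<in> Hom D d (FO R (c d))"
    and e'e: "\<And>d. d \<in> Obj D \<Longrightarrow> e' d \<cdot>\<^bsub>D\<^esub> e d = Ide D (FO R (c d))"
    and ee': "\<And>d. d \<in> Obj D \<Longrightarrow> e d \<cdot>\<^bsub>D\<^esub> e' d = Ide D d"
    by metis
  define l where "l a b h = (SOME f. f \<in> Hom C a b \<and> FA R f = h)" for a b h
  have l: "l a b h \<in> Hom C a b" "FA R (l a b h) = h"
    if "a \<in> Obj C" "b \<in> Obj C" "h \<in> Hom D (FO R a) (FO R b)" for a b h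
    using someI_ex[of "\<lambda>f. f \<in> Hom C a b \<and> FA R f = h"] full[OF that] unfolding l_def by auto
  define lift where "lift f = e' (Cod D f) \<cdot>\<^bsub>D\<^esub> (f \<cdot>\<^bsub>D\<^esub> e (Dom D f))" for f
  have lift_Hom: "lift f \<in> Hom D (FO R (c a)) (FO R (c b))" if "f \<in> Hom D a b" for f a b
    unfolding lift_def using D.HomD[OF that] that by (auto intro: D.Comp_Hom e e')
  have lift_eq: "lift f = e' b \<cdot>\<^bsub>D\<^esub> (f \<cdot>\<^bsub>D\<^esub> e a)" if "f \<in> Hom D a b" for f a b
    unfolding lift_def using D.HomD[OF that] by simp
  define G where "G = \<lparr>FO = c, FA = (\<lambda>f. l (c (Dom D f)) (c (Cod D f)) (lift f))\<rparr>"
  have G_FO: "FO G d = c d" for d by (simp add: G_def)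
  have G_FA: "FA G f = l (c a) (c b) (lift f)" if "f \<in> Hom D a b" for f a b
    using D.HomD[OF that] by (simp add: G_def)
  have GH: "FA G f \<in> Hom C (c a) (c b)" and RG: "FA R (FA G f) = lift f" if "f \<in> Hom D a b" for f a b
    using l[OF c c lift_Hom[OF that]] D.HomD[OF that] by (simp_all add: G_FA[OF that])
  have G: "is_functor D C G"
  proof (rule is_functorI)
    fix a assume a: "a \<in> Obj D"
    show "FO G a \<in> Obj C" using c a by (simp add: G_FO)
    show "FA G (Ide D a) = Ide C (FO G a)"
    proof (rule faithful)
      show "FA G (Ide D a) \<in> Hom C (c a) (c a)" using GH[OF D.Ide_Hom[OF a]] .
      show "Ide C (FO G a) \<in> Hom C (c a) (c a)" using C.Ide_Hom[OF c[OF a]] by (simp add: G_FO)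
      show "FA R (FA G (Ide D a)) = FA R (Ide C (FO G a))"
        by (simp add: RG[OF D.Ide_Hom[OF a]] G_FO functor_Ide[OF R c[OF a]]
            lift_eq[OF D.Ide_Hom[OF a]] D.Comp_Ide_left[OF e[OF a]] e'e[OF a])
    qed
  next
    fix f a b assume f: "f \<in> Hom D a b"
    show "FA G f \<in> Hom C (FO G a) (FO G b)" using GH[OF f] by (simp add: G_FO)
    fix g d assume g: "g \<in> Hom D b d"
    note o = D.HomD[OF f] D.HomD[OF g]
    have "lift (g \<cdot>\<^bsub>D\<^esub> f) = lift g \<cdot>\<^bsub>D\<^esub> lift f"
    proof -
      have "lift g \<cdot>\<^bsub>D\<^esub> lift f = e' d \<cdot>\<^bsub>D\<^esub> ((g \<cdot>\<^bsub>D\<^esub> e b) \<cdot>\<^bsub>D\<^esub> (e' b \<cdot>\<^bsub>D\<^esub> (f \<cdot>\<^bsub>D\<^esub> e a)))"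
        using D.Comp_assoc[OF lift_Hom[OF f] D.Comp_Hom[OF e g] e'] o
        by (simp add: lift_eq[OF g] lift_eq[OF f])
      also have "(g \<cdot>\<^bsub>D\<^esub> e b) \<cdot>\<^bsub>D\<^esub> (e' b \<cdot>\<^bsub>D\<^esub> (f \<cdot>\<^bsub>D\<^esub> e a)) = g \<cdot>\<^bsub>D\<^esub> (e b \<cdot>\<^bsub>D\<^esub> (e' b \<cdot>\<^bsub>D\<^esub> (f \<cdot>\<^bsub>D\<^esub> e a)))"
        using D.Comp_assoc[OF _ e g] D.Comp_Hom[OF D.Comp_Hom[OF e f] e'] o by simp
      also have "e b \<cdot>\<^bsub>D\<^esub> (e' b \<cdot>\<^bsub>D\<^esub> (f \<cdot>\<^bsub>D\<^esub> e a)) = f \<cdot>\<^bsub>D\<^esub> e a"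
        using D.Comp_assoc[OF D.Comp_Hom[OF e f] e' e] D.Comp_Ide_left[OF D.Comp_Hom[OF e f]] o
        by (simp add: ee')
      also have "g \<cdot>\<^bsub>D\<^esub> (f \<cdot>\<^bsub>D\<^esub> e a) = (g \<cdot>\<^bsub>D\<^esub> f) \<cdot>\<^bsub>D\<^esub> e a"
        using D.Comp_assoc[OF e f g] o by simp
      finally show ?thesis by (simp add: lift_eq[OF D.Comp_Hom[OF f g]])
    qed
    then show "FA G (g \<cdot>\<^bsub>D\<^esub> f) = FA G g \<cdot>\<^bsub>C\<^esub> FA G f"
      using faithful[OF GH[OF D.Comp_Hom[OF f g]] C.Comp_Hom[OF GH[OF f] GH[OF g]]]
      by (simp add: RG[OF D.Comp_Hom[OF f g]] RG[OF f] RG[OF g] functor_Comp[OF R GH[OF f] GH[OF g]])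
  qed (fact C.category_axioms D.category_axioms)+
  \<comment> \<open>The triangle identity forces \<open>R (\<eta> a)\<close> to be the inverse of
    the counit at \<open>R a\<close>; fullness provides such an arrow.\<close>
  define \<eta> where "\<eta> a = l a (c (FO R a)) (e' (FO R a))" for a
  have \<eta>: "\<eta> a \<in> Hom C a (c (FO R a))" "FA R (\<eta> a) = e' (FO R a)" if "a \<in> Obj C" for a
    unfolding \<eta>_def using l[OF that c e'] functor_Obj[OF R that] by auto
  have iso: "is_iso C (\<eta> a)" if a: "a \<in> Obj C" for a
  proof -
    have Ra: "FO R a \<in> Obj D" using functor_Obj[OF R a] .
    obtain i where i: "i \<in> Hom C (c (FO R a)) a" "FA R i = e (FO R a)"
      using full[OF c a e] Ra by auto
    show ?thesis
    proof (rule C.is_isoI[OF \<eta>(1)[OF a] i(1)])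
      show "i \<cdot>\<^bsub>C\<^esub> \<eta> a = Ide C a"
        using faithful[OF C.Comp_Hom[OF \<eta>(1)[OF a] i(1)] C.Ide_Hom[OF a]] Ra
        by (simp add: functor_Comp[OF R \<eta>(1)[OF a] i(1)] i(2) \<eta>(2)[OF a] ee' functor_Ide[OF R a])
      show "\<eta> a \<cdot>\<^bsub>C\<^esub> i = Ide C (c (FO R a))"
        using faithful[OF C.Comp_Hom[OF i(1) \<eta>(1)[OF a]] C.Ide_Hom[OF c[OF Ra]]] Ra
        by (simp add: functor_Comp[OF R i(1) \<eta>(1)[OF a]] i(2) \<eta>(2)[OF a] e'e functor_Ide[OF R c])
    qed
  qed
  have "natural_transformation C C (functor_id C) (functor_comp C G R) \<eta>"
  proof (rule natural_transformationI)
    show "\<eta> a \<in> Hom C (FO (functor_id C) a) (FO (functor_comp C G R) a)" if "a \<in> Obj C" for a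
      using \<eta>[OF that] that by (simp add: functor_id_def G_FO)
    fix f a b assume f: "f \<in> Hom C a b"
    note o = C.HomD[OF f]
    have Rf: "FA R f \<in> Hom D (FO R a) (FO R b)" using functor_Hom[OF R f] .
    note o' = D.HomD[OF Rf]
    have "FA G (FA R f) \<cdot>\<^bsub>C\<^esub> \<eta> a = \<eta> b \<cdot>\<^bsub>C\<^esub> f"
    proof (rule faithful)
      show "FA G (FA R f) \<cdot>\<^bsub>C\<^esub> \<eta> a \<in> Hom C a (c (FO R b))" using C.Comp_Hom[OF \<eta>(1) GH[OF Rf]] o by simp
      show "\<eta> b \<cdot>\<^bsub>C\<^esub> f \<in> Hom C a (c (FO R b))" using C.Comp_Hom[OF f \<eta>(1)] o by simp
      have "(e' (FO R b) \<cdot>\<^bsub>D\<^esub> (FA R f \<cdot>\<^bsub>D\<^esub> e (FO R a))) \<cdot>\<^bsub>D\<^esub> e' (FO R a)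
         = e' (FO R b) \<cdot>\<^bsub>D\<^esub> ((FA R f \<cdot>\<^bsub>D\<^esub> e (FO R a)) \<cdot>\<^bsub>D\<^esub> e' (FO R a))"
        using D.Comp_assoc[OF e' D.Comp_Hom[OF e Rf] e'] o' by simp
      also have "(FA R f \<cdot>\<^bsub>D\<^esub> e (FO R a)) \<cdot>\<^bsub>D\<^esub> e' (FO R a) = FA R f"
        using D.Comp_assoc[OF e' e Rf] D.Comp_Ide_right[OF Rf] o' by (simp add: ee')
      finally show "FA R (FA G (FA R f) \<cdot>\<^bsub>C\<^esub> \<eta> a) = FA R (\<eta> b \<cdot>\<^bsub>C\<^esub> f)"
        using functor_Comp[OF R \<eta>(1) GH[OF Rf]] functor_Comp[OF R f \<eta>(1)] o
        by (simp add: RG[OF Rf] \<eta>(2) lift_eq[OF Rf])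
    qed
    then show "FA (functor_comp C G R) f \<cdot>\<^bsub>C\<^esub> \<eta> a = \<eta> b \<cdot>\<^bsub>C\<^esub> FA (functor_id C) f"
      using f o by (simp add: functor_id_def)
  qed
  then have 1: "natural_isomorphism C C (functor_id C) (functor_comp C G R) \<eta>"
    using iso by (simp add: natural_isomorphism_def)
  have "natural_transformation D D (functor_comp D R G) (functor_id D) e"
  proof (rule natural_transformationI)
    show "e a \<in> Hom D (FO (functor_comp D R G) a) (FO (functor_id D) a)" if "a \<in> Obj D" for a
      using e[OF that] that by (simp add: functor_id_def G_FO)
    fix f a b assume f: "f \<in> Hom D a b"
    note o = D.HomD[OF f]
    have "e b \<cdot>\<^bsub>D\<^esub> lift f = f \<cdot>\<^bsub>D\<^esub> e a"
      using D.Comp_assoc[OF D.Comp_Hom[OF e f] e' e] D.Comp_Ide_left[OF D.Comp_Hom[OF e f]] o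
      by (simp add: ee' lift_eq[OF f])
    then show "FA (functor_id D) f \<cdot>\<^bsub>D\<^esub> e a = e b \<cdot>\<^bsub>D\<^esub> FA (functor_comp D R G) f"
      using f o by (simp add: functor_id_def RG[OF f])
  qed
  moreover have "is_iso D (e a)" if "a \<in> Obj D" for a
    using D.is_isoI[OF e e' e'e ee'] that by auto
  ultimately have 2: "natural_isomorphism D D (functor_comp D R G) (functor_id D) e"
    by (simp add: natural_isomorphism_def)
  show ?thesis unfolding equivalence_of_categories_def using R G 1 2 by blast
qed

section \<open>Functor categories with values in an abelian category\<close>

text \<open>
  Only differences of parallel arrows and the splitting of idempotents are used of an abelian
  category.
\<close>

locale difference_category = category B
  for B :: "('o, 'a, 'z) cat_scheme" (structure) +
  fixes zer :: "'o \<Rightarrow> 'o \<Rightarrow> 'a" and sub :: "'a \<Rightarrow> 'a \<Rightarrow> 'a"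
  assumes zer_Hom: "\<lbrakk>a \<in> Obj B; b \<in> Obj B\<rbrakk> \<Longrightarrow> zer a b \<in> Hom B a b"
    and sub_Hom: "\<lbrakk>f \<in> Hom B a b; g \<in> Hom B a b\<rbrakk> \<Longrightarrow> sub f g \<in> Hom B a b"
    and sub_self: "f \<in> Hom B a b \<Longrightarrow> sub f f = zer a b"
    and sub_zer: "f \<in> Hom B a b \<Longrightarrow> sub f (zer a b) = f"
    and sub_eq_zer: "\<lbrakk>f \<in> Hom B a b; g \<in> Hom B a b; sub f g = zer a b\<rbrakk> \<Longrightarrow> f = g"
    and Comp_sub_right:
      "\<lbrakk>f \<in> Hom B a b; f' \<in> Hom B a b; g \<in> Hom B b c\<rbrakk> \<Longrightarrow> g \<cdot> sub f f' = sub (g \<cdot> f) (g \<cdot> f')"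
    and Comp_sub_left:
      "\<lbrakk>f \<in> Hom B a b; g \<in> Hom B b c; g' \<in> Hom B b c\<rbrakk> \<Longrightarrow> sub g g' \<cdot> f = sub (g \<cdot> f) (g' \<cdot> f)"
    and null_ex: "\<exists>z. null_object B z"
    and idempotent_splits:
      "\<lbrakk>e \<in> Hom B x x; e \<cdot> e = e\<rbrakk> \<Longrightarrow>
        \<exists>y. \<exists>k \<in> Hom B y x. \<exists>q \<in> Hom B x y. k \<cdot> q = e \<and> q \<cdot> k = Ide B y"
begin

lemma Comp_zer_right: "\<lbrakk>g \<in> Hom B b c; a \<in> Obj B\<rbrakk> \<Longrightarrow> g \<cdot> zer a b = zer a c"
  using Comp_sub_right[of "zer a b" a b "zer a b" g c] zer_Hom[of a b] sub_self HomD[of g b c]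
    Comp_Hom[of "zer a b" a b g c] by metis

lemma Comp_zer_left: "\<lbrakk>f \<in> Hom B a b; c \<in> Obj B\<rbrakk> \<Longrightarrow> zer b c \<cdot> f = zer a c"
  using Comp_sub_left[of f a b "zer b c" c "zer b c"] zer_Hom[of b c] sub_self HomD[of f a b]
    Comp_Hom[of f a b "zer b c" c] by metis

lemma null_object_zer:
  assumes "null_object B z"
  shows "a \<in> Obj B \<Longrightarrow> f \<in> Hom B z a \<Longrightarrow> f = zer z a"
    and "a \<in> Obj B \<Longrightarrow> f \<in> Hom B a z \<Longrightarrow> f = zer a z"
    and "z \<in> Obj B"
  using assms zer_Hom unfolding null_object_def initial_object_def terminal_object_def by blast+

text \<open>Every arrow from or to \<open>z\<close> is unchanged by composition with the identity of
  \<open>z\<close>, hence zero as soon as that identity is.\<close>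

lemma null_objectI:
  assumes z: "z \<in> Obj B" and i: "Ide B z = zer z z"
  shows "null_object B z"
proof -
  have "f = zer z a" if "f \<in> Hom B z a" for a f
    using Comp_Ide_right[OF that] Comp_zer_right[OF that z] i by simp
  moreover have "f = zer a z" if "f \<in> Hom B a z" for a f
    using Comp_Ide_left[OF that] Comp_zer_left[OF that z] i by simp
  ultimately show ?thesis
    using z zer_Hom unfolding null_object_def initial_object_def terminal_object_def by metis
qed

text \<open>Kernels, cokernels and null functors are phrased with arrows that factor through a null
  object. The comparison with the distinguished arrow \<open>zer a b\<close> makes them accessible
  to equational reasoning.\<close>

lemma zero_arrow_iff:
  assumes f: "f \<in> Hom B a b"
  shows "zero_arrow B f \<longleftrightarrow> f = zer a b"
proof
  note o = HomD[OF f]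
  assume "zero_arrow B f"
  then obtain z g h where z: "null_object B z" and g: "g \<in> Hom B a z" and h: "h \<in> Hom B z b"
    and fe: "f = h \<cdot> g"
    unfolding zero_arrow_def using o by auto
  show "f = zer a b"
    using null_object_zer(1)[OF z o(5) h] Comp_zer_left[OF g o(5)] fe by simp
next
  note o = HomD[OF f]
  assume fz: "f = zer a b"
  obtain z where z: "null_object B z" using null_ex by blast
  have zo: "z \<in> Obj B" using null_object_zer(3)[OF z] .
  have "f = zer z b \<cdot> zer a z" using Comp_zer_right[OF zer_Hom[OF zo o(5)] o(4)] fz by simp
  then show "zero_arrow B f"
    unfolding zero_arrow_def using o z zer_Hom zo by metis
qed

lemma eq_of_sub_zero:
  assumes "f \<in> Hom B a b" "g \<in> Hom B a b" "zero_arrow B (sub f g)"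
  shows "f = g"
  using assms zero_arrow_iff[OF sub_Hom[OF assms(1,2)]] sub_eq_zer by blast

lemma zero_arrow_sub_self: "f \<in> Hom B a b \<Longrightarrow> zero_arrow B (sub f f)"
  using zero_arrow_iff sub_Hom sub_self by metis

end

text \<open>Zero arrows and differences come from the group structure on the hom sets. An idempotent
  \<open>e\<close> splits through the kernel of \<open>1 - e\<close>.\<close>

lemma (in abelian_category) difference_category_exists:
  "\<exists>zer sub. difference_category B zer sub"
proof -
  obtain add where pre: "preadditive_category B add" using biproducts by blast
  interpret P: preadditive_category B add using pre .
  define G where "G a b z = \<lparr>carrier = Hom B a b, monoid.mult = add, one = z\<rparr>" for a b and z :: 'a
  \<comment> \<open>The axioms only assert that each hom set has some neutral element;
    \<open>zer a b\<close> selects it.\<close>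
  define zer where "zer a b = (SOME z. comm_group (G a b z))" for a b
  have cg: "comm_group (G a b (zer a b))" if "a \<in> Obj B" "b \<in> Obj B" for a b
    unfolding zer_def using someI_ex[OF P.Hom_group[OF that]] unfolding G_def .
  define sub where "sub f g = add f (m_inv (G (Dom B f) (Cod B f) (zer (Dom B f) (Cod B f))) g)" for f g
  have zH: "zer a b \<in> Hom B a b" if "a \<in> Obj B" "b \<in> Obj B" for a b
  proof -
    interpret comm_group "G a b (zer a b)" using cg[OF that] .
    show ?thesis using one_closed by (simp add: G_def)
  qed
  \<comment> \<open>differences are characterised by addition, which makes the composition laws transparent\<close>
  have key: "sub f g \<in> Hom B a b \<and> add (sub f g) g = f \<and>
      (\<forall>h \<in> Hom B a b. add h g = f \<longrightarrow> h = sub f g)" if f: "f \<in> Hom B a b" and g: "g \<in> Hom B a b" for f g a b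
  proof -
    interpret K: comm_group "G a b (zer a b)" using cg HomD[OF f] by simp
    have c: "carrier (G a b (zer a b)) = Hom B a b" and m: "\<And>x y. x \<otimes>\<^bsub>G a b (zer a b)\<^esub> y = add x y"
      by (simp_all add: G_def)
    have s: "sub f g = f \<otimes>\<^bsub>G a b (zer a b)\<^esub> inv\<^bsub>G a b (zer a b)\<^esub> g"
      using HomD[OF f] by (simp add: sub_def G_def)
    show ?thesis unfolding s m[symmetric] c[symmetric] using f g unfolding c[symmetric]
      by (auto simp: K.m_assoc)
  qed
  have zl: "add (zer a b) f = f" and zr: "add f (zer a b) = f" if f: "f \<in> Hom B a b" for f a b
  proof -
    interpret K: comm_group "G a b (zer a b)" using cg HomD[OF f] by simp
    show "add (zer a b) f = f" "add f (zer a b) = f"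
      using K.l_one[of f] K.r_one[of f] f by (simp_all add: G_def)
  qed
  have sub_self: "sub f f = zer a b" if "f \<in> Hom B a b" for f a b
    using key[OF that that] zl[OF that] zH HomD[OF that] by metis
  have subH: "sub f g \<in> Hom B a b" if "f \<in> Hom B a b" "g \<in> Hom B a b" for f g a b
    using key[OF that] by blast
  have sub_eq: "f = g" if "f \<in> Hom B a b" "g \<in> Hom B a b" "sub f g = zer a b" for f g a b
    using key[OF that(1,2)] zl[OF that(2)] that(3) by simp
  have cr: "g \<cdot> sub f f' = sub (g \<cdot> f) (g \<cdot> f')"
    if "f \<in> Hom B a b" "f' \<in> Hom B a b" "g \<in> Hom B b c" for f f' g a b c
  proof -
    have "add (g \<cdot> sub f f') (g \<cdot> f') = g \<cdot> f"
      using P.Comp_add_right[OF subH[OF that(1,2)] that(2,3)] key[OF that(1,2)] by simp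
    then show ?thesis
      using key[OF Comp_Hom[OF that(1,3)] Comp_Hom[OF that(2,3)]] Comp_Hom[OF subH[OF that(1,2)] that(3)] by blast
  qed
  have cl: "sub g g' \<cdot> f = sub (g \<cdot> f) (g' \<cdot> f)"
    if "f \<in> Hom B a b" "g \<in> Hom B b c" "g' \<in> Hom B b c" for f g g' a b c
  proof -
    have "add (sub g g' \<cdot> f) (g' \<cdot> f) = g \<cdot> f"
      using P.Comp_add_left[OF that(1) subH[OF that(2,3)] that(3)] key[OF that(2,3)] by simp
    then show ?thesis
      using key[OF Comp_Hom[OF that(1,2)] Comp_Hom[OF that(1,3)]] Comp_Hom[OF that(1) subH[OF that(2,3)]] by blast
  qed
  have zcr: "g \<cdot> zer a b = zer a c" if "g \<in> Hom B b c" "a \<in> Obj B" for g a b c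
  proof -
    note z = zH[OF that(2) HomD(4)[OF that(1)]]
    have "g \<cdot> zer a b = g \<cdot> sub (zer a b) (zer a b)" using sub_self[OF z] by simp
    also have "\<dots> = zer a c" using cr[OF z z that(1)] sub_self[OF Comp_Hom[OF z that(1)]] by simp
    finally show ?thesis .
  qed
  have zcl: "zer b c \<cdot> f = zer a c" if "f \<in> Hom B a b" "c \<in> Obj B" for f a b c
  proof -
    note z = zH[OF HomD(5)[OF that(1)] that(2)]
    have "zer b c \<cdot> f = sub (zer b c) (zer b c) \<cdot> f" using sub_self[OF z] by simp
    also have "\<dots> = zer a c" using cl[OF that(1) z z] sub_self[OF Comp_Hom[OF that(1) z]] by simp
    finally show ?thesis .
  qed
  \<comment> \<open>The kernel axiom is phrased with arrows through a null object, subtraction with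
    neutral elements; the two notions of zero have to be matched before a kernel of a difference can
    be used.\<close>
  have zero: "zero_arrow B f \<longleftrightarrow> f = zer a b" if f: "f \<in> Hom B a b" for f a b
  proof -
    note o = HomD[OF f]
    have *: "h = zer z b" if "null_object B z" "h \<in> Hom B z b" for h z
      using that zH[of z b] o unfolding null_object_def initial_object_def by metis
    obtain z0 where z0: "null_object B z0" "z0 \<in> Obj B"
      using null_exists unfolding null_object_def initial_object_def by blast
    show ?thesis
    proof
      assume "zero_arrow B f"
      then obtain z g h where "null_object B z" "g \<in> Hom B a z" "h \<in> Hom B z b" "f = h \<cdot> g"
        unfolding zero_arrow_def using o by auto
      then show "f = zer a b" using * zcl o by metis
    next
      assume "f = zer a b"
      then have "f = zer z0 b \<cdot> zer a z0" using zcr zH z0(2) o by metis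
      then show "zero_arrow B f"
        unfolding zero_arrow_def using o z0 zH by metis
    qed
  qed
  have split: "\<exists>y. \<exists>k \<in> Hom B y x. \<exists>q \<in> Hom B x y. k \<cdot> q = e \<and> q \<cdot> k = Ide B y"
    if e: "e \<in> Hom B x x" and ee: "e \<cdot> e = e" for e x
  proof -
    note x = HomD(4)[OF e]
    note i = Ide_Hom[OF x]
    \<comment> \<open>An arrow \<open>h\<close> satisfies \<open>d \<cdot> h = 0\<close> exactly
      when \<open>e \<cdot> h = h\<close>, so the kernel of \<open>d\<close> plays the role of the
      image of \<open>e\<close>.\<close>
    define d where "d = sub (Ide B x) e"
    have d: "d \<in> Hom B x x" unfolding d_def by (rule subH[OF i e])
    have de: "d \<cdot> e = zer x x"
      unfolding d_def using cl[OF e i e] Comp_Ide_left[OF e] ee sub_self[OF e] by simp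
    obtain k where k: "is_kernel B d k" using kernel_exists HomD(1)[OF d] by blast
    define y where "y = Dom B k"
    have kH: "k \<in> Hom B y x" using k HomD[OF d] unfolding is_kernel_def y_def by (auto simp: Hom_def)
    have dk: "d \<cdot> k = zer y x"
      using k zero[OF Comp_Hom[OF kH d]] unfolding is_kernel_def by simp
    have un: "\<exists>!w. w \<in> Hom B c y \<and> k \<cdot> w = h" if "h \<in> Hom B c x" "d \<cdot> h = zer c x" for h c
    proof -
      have "\<forall>h \<in> Arr B. Cod B h = Dom B d \<and> zero_arrow B (d \<cdot> h) \<longrightarrow>
          (\<exists>!w. w \<in> Hom B (Dom B h) (Dom B k) \<and> k \<cdot> w = h)"
        using k unfolding is_kernel_def by blast
      moreover have "zero_arrow B (d \<cdot> h)" using that(2) zero[OF Comp_Hom[OF that(1) d]] by simp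
      ultimately show ?thesis
        using HomD(1-3)[OF that(1)] HomD(2)[OF d] unfolding y_def by (metis (no_types, lifting))
    qed
    obtain q where q: "q \<in> Hom B x y" "k \<cdot> q = e" using un[OF e de] by blast
    have ek: "e \<cdot> k = k"
    proof -
      have "sub (Ide B x \<cdot> k) (e \<cdot> k) = zer y x" using cl[OF kH i e] dk unfolding d_def by simp
      then show ?thesis using sub_eq[OF kH Comp_Hom[OF kH e]] Comp_Ide_left[OF kH] by simp
    qed
    have "k \<cdot> (q \<cdot> k) = k" using Comp_assoc[OF kH q(1) kH] q(2) ek by simp
    \<comment> \<open>Both sides are factorisations of \<open>k\<close> through itself, and these
      are unique.\<close>
    then have "q \<cdot> k = Ide B y"
      using un[OF kH dk] Comp_Hom[OF kH q(1)] Ide_Hom HomD(4)[OF kH] Comp_Ide_right[OF kH] by blast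
    then show ?thesis using kH q by blast
  qed
  have "difference_category B zer sub"
  proof (unfold_locales, goal_cases)
    case (4 f a b)
    have "add f (zer a b) = f" using zr[OF 4] .
    then show ?case using key[OF 4 zH] HomD[OF 4] 4 by metis
  next
    case (5 f a b g) then show ?case using sub_eq by blast
  next
    case (9 e x) then show ?case using split by blast
  qed (fact zH subH sub_self cr cl null_exists | blast intro: zH subH sub_self cr cl)+
  then show ?thesis by blast
qed

section \<open>The category of functors and natural transformations\<close>

lemma Fct_simps [simp]:
  "Obj (Fct C D) = Fct_Obj C D"
  "Dom (Fct C D) (F, G, \<tau>) = F"
  "Cod (Fct C D) (F, G, \<tau>) = G"
  "Ide (Fct C D) F = (F, F, \<lambda>a \<in> Obj C. Ide D (FO F a))"
  "Comp (Fct C D) (G, H, \<sigma>) (F, G', \<tau>) = (F, H, \<lambda>a \<in> Obj C. \<sigma> a \<cdot>\<^bsub>D\<^esub> \<tau> a)"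
  by (simp_all add: Fct_def)

lemma Fct_Arr:
  "(F, G, \<tau>) \<in> Arr (Fct C D) \<longleftrightarrow> F \<in> Fct_Obj C D \<and> G \<in> Fct_Obj C D \<and>
     natural_transformation C D F G \<tau> \<and> \<tau> \<in> extensional (Obj C)"
  by (simp add: Fct_def)

lemma Fct_Hom:
  "(F', G', \<tau>) \<in> Hom (Fct C D) F G \<longleftrightarrow> F' = F \<and> G' = G \<and> F \<in> Fct_Obj C D \<and> G \<in> Fct_Obj C D \<and>
     natural_transformation C D F G \<tau> \<and> \<tau> \<in> extensional (Obj C)"
  by (auto simp: Hom_def Fct_Arr)

lemma Fct_HomE:
  assumes "f \<in> Hom (Fct C D) F G"
  obtains \<tau> where "f = (F, G, \<tau>)" "F \<in> Fct_Obj C D" "G \<in> Fct_Obj C D"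
    "natural_transformation C D F G \<tau>" "\<tau> \<in> extensional (Obj C)"
  using assms Fct_Hom by (metis prod_cases3)

lemma Fct_ObjD: "F \<in> Fct_Obj C D \<Longrightarrow> is_functor C D F"
  by (simp add: Fct_Obj_def)

lemma natural_transformation_cong:
  assumes "category C" "\<And>a. a \<in> Obj C \<Longrightarrow> \<tau> a = \<tau>' a" "natural_transformation C D F G \<tau>"
  shows "natural_transformation C D F G \<tau>'"
  using assms category.Dom_closed category.Cod_closed unfolding natural_transformation_def by metis

lemma natural_transformation_Comp:
  assumes F: "is_functor C D F" and G: "is_functor C D G" and H: "is_functor C D H"
    and \<tau>: "natural_transformation C D F G \<tau>" and \<sigma>: "natural_transformation C D G H \<sigma>"
  shows "natural_transformation C D F H (\<lambda>a. \<sigma> a \<cdot>\<^bsub>D\<^esub> \<tau> a)"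
proof (rule natural_transformationI)
  interpret C: category C using functor_categories[OF F] by simp
  interpret D: category D using functor_categories[OF F] by simp
  note T = natural_transformation_Hom[OF \<tau>] and S = natural_transformation_Hom[OF \<sigma>]
  show "\<sigma> a \<cdot>\<^bsub>D\<^esub> \<tau> a \<in> Hom D (FO F a) (FO H a)" if "a \<in> Obj C" for a
    using D.Comp_Hom[OF T[OF that] S[OF that]] .
  fix f a b assume f: "f \<in> Hom C a b"
  note o = C.HomD[OF f]
  have "FA H f \<cdot>\<^bsub>D\<^esub> (\<sigma> a \<cdot>\<^bsub>D\<^esub> \<tau> a) = (FA H f \<cdot>\<^bsub>D\<^esub> \<sigma> a) \<cdot>\<^bsub>D\<^esub> \<tau> a"
    using D.Comp_assoc[OF T S functor_Hom[OF H f]] o by simp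
  also have "\<dots> = (\<sigma> b \<cdot>\<^bsub>D\<^esub> FA G f) \<cdot>\<^bsub>D\<^esub> \<tau> a" using natural_transformation_nat[OF \<sigma> f] by simp
  also have "\<dots> = \<sigma> b \<cdot>\<^bsub>D\<^esub> (FA G f \<cdot>\<^bsub>D\<^esub> \<tau> a)"
    using D.Comp_assoc[OF T functor_Hom[OF G f] S] o by simp
  also have "\<dots> = \<sigma> b \<cdot>\<^bsub>D\<^esub> (\<tau> b \<cdot>\<^bsub>D\<^esub> FA F f)" using natural_transformation_nat[OF \<tau> f] by simp
  also have "\<dots> = (\<sigma> b \<cdot>\<^bsub>D\<^esub> \<tau> b) \<cdot>\<^bsub>D\<^esub> FA F f"
    using D.Comp_assoc[OF functor_Hom[OF F f] T S] o by simp
  finally show "FA H f \<cdot>\<^bsub>D\<^esub> (\<sigma> a \<cdot>\<^bsub>D\<^esub> \<tau> a) = (\<sigma> b \<cdot>\<^bsub>D\<^esub> \<tau> b) \<cdot>\<^bsub>D\<^esub> FA F f" .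
qed

lemma natural_transformation_Ide:
  assumes F: "is_functor C D F"
  shows "natural_transformation C D F F (\<lambda>a. Ide D (FO F a))"
proof (rule natural_transformationI)
  interpret C: category C using functor_categories[OF F] by simp
  interpret D: category D using functor_categories[OF F] by simp
  show "Ide D (FO F a) \<in> Hom D (FO F a) (FO F a)" if "a \<in> Obj C" for a
    using D.Ide_Hom functor_Obj[OF F that] .
  show "FA F f \<cdot>\<^bsub>D\<^esub> Ide D (FO F a) = Ide D (FO F b) \<cdot>\<^bsub>D\<^esub> FA F f" if "f \<in> Hom C a b" for f a b
    using D.Comp_Ide_left D.Comp_Ide_right functor_Hom[OF F that] by metis
qed

lemma Fct_category:
  assumes "category C" and "category D"
  shows "category (Fct C D)"
proof -
  interpret C: category C by fact
  interpret D: category D by fact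
  have cong: "natural_transformation C D F G (restrict \<tau> (Obj C))" if "natural_transformation C D F G \<tau>" for F G \<tau>
    by (rule natural_transformation_cong[OF C.category_axioms _ that]) simp
  have compH: "g \<cdot>\<^bsub>Fct C D\<^esub> f \<in> Hom (Fct C D) F H"
    if "f \<in> Hom (Fct C D) F G" "g \<in> Hom (Fct C D) G H" for f g F G H
    using that
  proof (elim Fct_HomE, goal_cases)
    case (1 \<tau> \<sigma>)
    then show ?case
      using cong[OF natural_transformation_Comp[OF Fct_ObjD Fct_ObjD Fct_ObjD, of F C D G H \<tau> \<sigma>]]
      by (simp add: Fct_Hom)
  qed
  show ?thesis
  proof (unfold_locales, goal_cases)
    case (1 f) then show ?case by (cases f) (simp add: Fct_Arr)
  next
    case (2 f) then show ?case by (cases f) (simp add: Fct_Arr)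
  next
    case (3 F) then show ?case
      using cong[OF natural_transformation_Ide] by (simp add: Fct_Hom Fct_ObjD)
  next
    case (4 f F G g H) then show ?case by (rule compH)
  next
    case (5 f F G)
    then obtain \<tau> where \<tau>: "f = (F, G, \<tau>)" "natural_transformation C D F G \<tau>" "\<tau> \<in> extensional (Obj C)"
      by (elim Fct_HomE)
    have "(\<lambda>a \<in> Obj C. \<tau> a \<cdot>\<^bsub>D\<^esub> (\<lambda>a \<in> Obj C. Ide D (FO F a)) a) = \<tau>"
      using \<tau> D.Comp_Ide_right[OF natural_transformation_Hom[OF \<tau>(2)]]
      by (auto simp: fun_eq_iff extensional_def)
    then show ?case using \<tau> by simp
  next
    case (6 f F G)
    then obtain \<tau> where \<tau>: "f = (F, G, \<tau>)" "natural_transformation C D F G \<tau>" "\<tau> \<in> extensional (Obj C)"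
      by (elim Fct_HomE)
    have "(\<lambda>a \<in> Obj C. (\<lambda>a \<in> Obj C. Ide D (FO G a)) a \<cdot>\<^bsub>D\<^esub> \<tau> a) = \<tau>"
      using \<tau> D.Comp_Ide_left[OF natural_transformation_Hom[OF \<tau>(2)]]
      by (auto simp: fun_eq_iff extensional_def)
    then show ?case using \<tau> by simp
  next
    case (7 f F G g H h K)
    then show ?case
      by (elim Fct_HomE)
        (auto simp: fun_eq_iff intro!: D.Comp_assoc natural_transformation_Hom)
  qed
qed

section \<open>Iterated cross effects\<close>

text \<open>The part of the structure of \<open>A\<close> and \<open>tilde M\<close> on which
  polynomial functors depend: the endofunctors \<open>x \<oplus> -\<close>, the natural inclusion of
  the identity functor into each of them, and a natural retraction \<open>pr\<close> of that
  inclusion. Verifying these laws for \<open>tilde M\<close> takes less than its full monoidal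
  structure.\<close>

locale shift_category = category N
  for N :: "('o, 'a, 'z) smcat_scheme" (structure) +
  fixes pr :: "'o \<Rightarrow> 'o \<Rightarrow> 'a"
  assumes SumO_Obj: "\<lbrakk>x \<in> Obj N; y \<in> Obj N\<rbrakk> \<Longrightarrow> x \<oplus> y \<in> Obj N"
    and shift_Hom: "\<lbrakk>x \<in> Obj N; f \<in> Hom N a b\<rbrakk> \<Longrightarrow> Ide N x \<uplus> f \<in> Hom N (x \<oplus> a) (x \<oplus> b)"
    and shift_Ide: "\<lbrakk>x \<in> Obj N; y \<in> Obj N\<rbrakk> \<Longrightarrow> Ide N x \<uplus> Ide N y = Ide N (x \<oplus> y)"
    and shift_Comp: "\<lbrakk>x \<in> Obj N; f \<in> Hom N a b; g \<in> Hom N b c\<rbrakk> \<Longrightarrow>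
      Ide N x \<uplus> (g \<cdot> f) = (Ide N x \<uplus> g) \<cdot> (Ide N x \<uplus> f)"
    and inc_Hom: "\<lbrakk>x \<in> Obj N; y \<in> Obj N\<rbrakk> \<Longrightarrow> from_Unit N x \<uplus> Ide N y \<in> Hom N y (x \<oplus> y)"
    and inc_nat: "\<lbrakk>x \<in> Obj N; f \<in> Hom N a b\<rbrakk> \<Longrightarrow>
      (Ide N x \<uplus> f) \<cdot> (from_Unit N x \<uplus> Ide N a) = (from_Unit N x \<uplus> Ide N b) \<cdot> f"
    and pr_Hom: "\<lbrakk>x \<in> Obj N; y \<in> Obj N\<rbrakk> \<Longrightarrow> pr x y \<in> Hom N (x \<oplus> y) y"
    and pr_nat: "\<lbrakk>x \<in> Obj N; f \<in> Hom N a b\<rbrakk> \<Longrightarrow> pr x b \<cdot> (Ide N x \<uplus> f) = f \<cdot> pr x a"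
    and pr_inc: "\<lbrakk>x \<in> Obj N; y \<in> Obj N\<rbrakk> \<Longrightarrow> pr x y \<cdot> (from_Unit N x \<uplus> Ide N y) = Ide N y"
begin

abbreviation inc :: "'o \<Rightarrow> 'o \<Rightarrow> 'a" where
  "inc x y \<equiv> from_Unit N x \<uplus> Ide N y"

lemma shift_endofunctor:
  assumes x: "x \<in> Obj N"
  shows "is_functor N N \<lparr>FO = (\<lambda>y. x \<oplus> y), FA = (\<lambda>f. Ide N x \<uplus> f)\<rparr>"
  by (rule is_functorI) (simp_all add: x SumO_Obj shift_Hom shift_Ide shift_Comp category_axioms)

lemma shift_functor: "x \<in> Obj N \<Longrightarrow> is_functor N B F \<Longrightarrow> is_functor N B (shift N x F)"
  unfolding shift_def by (rule functor_comp_functor[OF shift_endofunctor])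

lemma shift_Fct_Obj: "x \<in> Obj N \<Longrightarrow> is_functor N B F \<Longrightarrow> shift N x F \<in> Fct_Obj N B"
  unfolding shift_def by (rule functor_comp_Fct_Obj[OF shift_endofunctor])

lemma shift_FO [simp]: "y \<in> Obj N \<Longrightarrow> FO (shift N x F) y = FO F (x \<oplus> y)"
  by (simp add: shift_def)

lemma shift_FA [simp]: "f \<in> Hom N a b \<Longrightarrow> FA (shift N x F) f = FA F (Ide N x \<uplus> f)"
  by (simp add: shift_def)

lemma shift_natural_transformation:
  assumes x: "x \<in> Obj N" and q: "natural_transformation N B F G q"
  shows "natural_transformation N B (shift N x F) (shift N x G) (\<lambda>y. q (x \<oplus> y))"
proof (rule natural_transformationI)
  show "q (x \<oplus> a) \<in> Hom B (FO (shift N x F) a) (FO (shift N x G) a)" if "a \<in> Obj N" for a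
    using natural_transformation_Hom[OF q SumO_Obj[OF x that]] that by simp
  show "FA (shift N x G) f \<cdot>\<^bsub>B\<^esub> q (x \<oplus> a) = q (x \<oplus> b) \<cdot>\<^bsub>B\<^esub> FA (shift N x F) f" if "f \<in> Hom N a b" for f a b
    using natural_transformation_nat[OF q shift_Hom[OF x that]] that by simp
qed

end

locale shift_functors = shift_category N pr + B: difference_category B zer sub
  for N :: "('o, 'a, 'z) smcat_scheme" (structure) and pr :: "'o \<Rightarrow> 'o \<Rightarrow> 'a"
  and B :: "('p, 'b, 'y) cat_scheme" and zer :: "'p \<Rightarrow> 'p \<Rightarrow> 'b" and sub :: "'b \<Rightarrow> 'b \<Rightarrow> 'b"
begin

lemma zero_Fct_Hom:
  assumes F: "F \<in> Fct_Obj N B" and G: "G \<in> Fct_Obj N B"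
  shows "(F, G, \<lambda>w \<in> Obj N. zer (FO F w) (FO G w)) \<in> Hom (Fct N B) F G"
proof -
  note FF = Fct_ObjD[OF F] and GF = Fct_ObjD[OF G]
  have "natural_transformation N B F G (\<lambda>w \<in> Obj N. zer (FO F w) (FO G w))"
  proof (rule natural_transformationI)
    fix f a b assume f: "f \<in> Hom N a b"
    show "FA G f \<cdot>\<^bsub>B\<^esub> (\<lambda>w \<in> Obj N. zer (FO F w) (FO G w)) a
        = (\<lambda>w \<in> Obj N. zer (FO F w) (FO G w)) b \<cdot>\<^bsub>B\<^esub> FA F f"
      using HomD[OF f] by (simp add: B.Comp_zer_right[OF functor_Hom[OF GF f]]
          B.Comp_zer_left[OF functor_Hom[OF FF f]] functor_Obj[OF FF] functor_Obj[OF GF])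
  qed (simp add: B.zer_Hom functor_Obj[OF FF] functor_Obj[OF GF])
  then show ?thesis using F G by (simp add: Fct_Hom)
qed

text \<open>A null functor has a single endomorphism, so its identity coincides with the pointwise
  zero transformation. Conversely, null values leave no choice for the components of a
  transformation.\<close>

lemma null_functor_iff:
  assumes F: "F \<in> Fct_Obj N B"
  shows "null_object (Fct N B) F \<longleftrightarrow> (\<forall>w \<in> Obj N. zero_arrow B (Ide B (FO F w)))"
proof
  assume nl: "null_object (Fct N B) F"
  interpret Fct: category "Fct N B" by (rule Fct_category[OF category_axioms B.category_axioms])
  have "Ide (Fct N B) F = (F, F, \<lambda>w \<in> Obj N. zer (FO F w) (FO F w))"
  proof -
    have "\<exists>!f. f \<in> Hom (Fct N B) F F" using nl F unfolding null_object_def initial_object_def by simp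
    moreover have "Ide (Fct N B) F \<in> Hom (Fct N B) F F" using Fct.Ide_Hom F by simp
    ultimately show ?thesis using zero_Fct_Hom[OF F F] by blast
  qed
  then have "Ide B (FO F w) = zer (FO F w) (FO F w)" if "w \<in> Obj N" for w
    using that by (auto dest!: fun_cong[of _ _ w])
  then show "\<forall>w \<in> Obj N. zero_arrow B (Ide B (FO F w))"
    using B.zero_arrow_iff[OF B.Ide_Hom[OF functor_Obj[OF Fct_ObjD[OF F]]]] by simp
next
  assume z: "\<forall>w \<in> Obj N. zero_arrow B (Ide B (FO F w))"
  note FF = Fct_ObjD[OF F]
  have n: "null_object B (FO F w)" if "w \<in> Obj N" for w
    using B.null_objectI[OF functor_Obj[OF FF that]] z that
      B.zero_arrow_iff[OF B.Ide_Hom[OF functor_Obj[OF FF that]]] by blast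
  have "f = (F, G, \<lambda>w \<in> Obj N. zer (FO F w) (FO G w))" if f: "f \<in> Hom (Fct N B) F G" for f G
    using f
  proof (rule Fct_HomE)
    fix \<sigma> assume s: "f = (F, G, \<sigma>)" "G \<in> Fct_Obj N B" "natural_transformation N B F G \<sigma>" "\<sigma> \<in> extensional (Obj N)"
    have "\<sigma> = (\<lambda>w \<in> Obj N. zer (FO F w) (FO G w))"
      using s(4) B.null_object_zer(1)[OF n functor_Obj[OF Fct_ObjD[OF s(2)]] natural_transformation_Hom[OF s(3)]]
      by (auto simp: extensional_def fun_eq_iff)
    then show ?thesis using s by simp
  qed
  moreover have "f = (G, F, \<lambda>w \<in> Obj N. zer (FO G w) (FO F w))" if f: "f \<in> Hom (Fct N B) G F" for f G
    using f
  proof (rule Fct_HomE)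
    fix \<sigma> assume s: "f = (G, F, \<sigma>)" "G \<in> Fct_Obj N B" "natural_transformation N B G F \<sigma>" "\<sigma> \<in> extensional (Obj N)"
    have "\<sigma> = (\<lambda>w \<in> Obj N. zer (FO G w) (FO F w))"
      using s(4) B.null_object_zer(2)[OF n functor_Obj[OF Fct_ObjD[OF s(2)]] natural_transformation_Hom[OF s(3)]]
      by (auto simp: extensional_def fun_eq_iff)
    then show ?thesis using s by simp
  qed
  ultimately show "null_object (Fct N B) F"
    using F zero_Fct_Hom unfolding null_object_def terminal_object_def initial_object_def Fct_simps
    by blast
qed

lemma null_functor_ex: "\<exists>Z. null_object (Fct N B) Z"
proof -
  obtain z where z: "null_object B z" using B.null_ex by blast
  have zo: "z \<in> Obj B" using B.null_object_zer(3)[OF z] .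
  define Z :: "('o, 'a, 'p, 'b) functr" where
    "Z = \<lparr>FO = (\<lambda>_ \<in> Obj N. z), FA = (\<lambda>_ \<in> Arr N. Ide B z)\<rparr>"
  have "is_functor N B Z"
  proof (rule is_functorI)
    show "FA Z f \<in> Hom B (FO Z a) (FO Z b)" if "f \<in> Hom N a b" for f a b
      using HomD[OF that] zo B.Ide_Hom by (simp add: Z_def)
    show "FA Z (Ide N a) = Ide B (FO Z a)" if "a \<in> Obj N" for a
      using HomD[OF Ide_Hom[OF that]] by (simp add: Z_def)
    show "FA Z (g \<cdot> f) = FA Z g \<cdot>\<^bsub>B\<^esub> FA Z f" if f: "f \<in> Hom N a b" and g: "g \<in> Hom N b c" for f g a b c
      using HomD[OF f] HomD[OF g] HomD[OF Comp_Hom[OF f g]] B.Comp_Ide_left[OF B.Ide_Hom[OF zo]]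
      by (simp add: Z_def)
  qed (use zo in \<open>simp_all add: Z_def category_axioms B.category_axioms\<close>)
  then have Z: "Z \<in> Fct_Obj N B" by (simp add: Fct_Obj_def Z_def)
  have "zero_arrow B (Ide B z)"
    using B.zero_arrow_iff[OF B.Ide_Hom[OF zo]] B.null_object_zer(1)[OF z zo B.Ide_Hom[OF zo]] by simp
  then show ?thesis using null_functor_iff[OF Z] by (auto simp: Z_def)
qed

lemma zero_Fct_arrow_iff:
  assumes f: "(F, G, \<tau>) \<in> Arr (Fct N B)"
  shows "zero_arrow (Fct N B) (F, G, \<tau>) \<longleftrightarrow> (\<forall>w \<in> Obj N. zero_arrow B (\<tau> w))"
proof
  have F: "F \<in> Fct_Obj N B" and G: "G \<in> Fct_Obj N B" and \<tau>: "natural_transformation N B F G \<tau>"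
    and ext: "\<tau> \<in> extensional (Obj N)"
    using f by (simp_all add: Fct_Arr)
  note FF = Fct_ObjD[OF F] and GF = Fct_ObjD[OF G]
  { assume "zero_arrow (Fct N B) (F, G, \<tau>)"
    then obtain Z g h where Z: "null_object (Fct N B) Z" and g: "g \<in> Hom (Fct N B) F Z"
      and h: "h \<in> Hom (Fct N B) Z G" and e: "(F, G, \<tau>) = h \<cdot>\<^bsub>Fct N B\<^esub> g"
      unfolding zero_arrow_def by auto
    obtain \<gamma> where \<gamma>: "g = (F, Z, \<gamma>)" "Z \<in> Fct_Obj N B" "natural_transformation N B F Z \<gamma>"
      using g by (rule Fct_HomE)
    obtain \<chi> where \<chi>: "h = (Z, G, \<chi>)" "natural_transformation N B Z G \<chi>"
      using h by (rule Fct_HomE)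
    show "\<forall>w \<in> Obj N. zero_arrow B (\<tau> w)"
    proof
      fix w assume w: "w \<in> Obj N"
      have Zw: "FO Z w \<in> Obj B" using functor_Obj[OF Fct_ObjD[OF \<gamma>(2)] w] .
      have "zero_arrow B (Ide B (FO Z w))" using null_functor_iff[OF \<gamma>(2)] Z w by blast
      then have "null_object B (FO Z w)"
        using B.null_objectI[OF Zw] B.zero_arrow_iff[OF B.Ide_Hom[OF Zw]] by simp
      moreover have "\<tau> w = \<chi> w \<cdot>\<^bsub>B\<^esub> \<gamma> w" using e \<gamma>(1) \<chi>(1) w by simp
      ultimately show "zero_arrow B (\<tau> w)"
        unfolding zero_arrow_def
        using B.HomD[OF natural_transformation_Hom[OF \<tau> w]] natural_transformation_Hom[OF \<gamma>(3) w]
          natural_transformation_Hom[OF \<chi>(2) w] by metis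
    qed }
  assume z: "\<forall>w \<in> Obj N. zero_arrow B (\<tau> w)"
  obtain Z where Z: "null_object (Fct N B) Z" using null_functor_ex by blast
  then have Zo: "Z \<in> Fct_Obj N B" unfolding null_object_def initial_object_def by simp
  note ZF = Fct_ObjD[OF Zo]
  have "\<tau> w = zer (FO Z w) (FO G w) \<cdot>\<^bsub>B\<^esub> zer (FO F w) (FO Z w)" if w: "w \<in> Obj N" for w
    using B.Comp_zer_right[OF B.zer_Hom[OF functor_Obj[OF ZF w] functor_Obj[OF GF w]] functor_Obj[OF FF w]]
      B.zero_arrow_iff[OF natural_transformation_Hom[OF \<tau> w]] z w by simp
  then have e: "(F, G, \<tau>) = (Z, G, \<lambda>w \<in> Obj N. zer (FO Z w) (FO G w)) \<cdot>\<^bsub>Fct N B\<^esub> (F, Z, \<lambda>w \<in> Obj N. zer (FO F w) (FO Z w))"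
    using ext by (auto simp: fun_eq_iff extensional_def)
  show "zero_arrow (Fct N B) (F, G, \<tau>)"
    unfolding zero_arrow_def Fct_simps(2,3) using e f Z zero_Fct_Hom[OF F Zo] zero_Fct_Hom[OF Zo G] by blast
qed

text \<open>The idempotent of \<open>F(x \<oplus> y)\<close> complementary to its retract
  \<open>F(y)\<close>. Its image is the value at \<open>y\<close> of the cokernel of
  \<open>F -> F(x \<oplus> -)\<close>.\<close>

definition red :: "'o \<Rightarrow> ('o, 'a, 'p, 'b) functr \<Rightarrow> 'o \<Rightarrow> 'b" where
  "red x F y = sub (Ide B (FO F (x \<oplus> y))) (FA F (inc x y) \<cdot>\<^bsub>B\<^esub> FA F (pr x y))"

text \<open>Unfolded \<open>k\<close> times: \<open>\<theta>\<close> at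
  \<open>x1 \<oplus> ... \<oplus> xk \<oplus> w\<close>, precomposed with one factor
  \<open>red\<close> for each \<open>xi\<close>, is zero for all \<open>xi\<close> and
  \<open>w\<close> in \<open>S\<close>. An arbitrary \<open>\<theta>\<close> in place of the
  identity lets the recursion store the factors collected so far, and \<open>S\<close> allows
  testing on some of the objects only.\<close>

primrec vanishes :: "'o set \<Rightarrow> nat \<Rightarrow> ('o, 'a, 'p, 'b) functr \<Rightarrow> ('o \<Rightarrow> 'b) \<Rightarrow> bool" where
  "vanishes S 0 F \<theta> \<longleftrightarrow> (\<forall>w \<in> S. zero_arrow B (\<theta> w))"
| "vanishes S (Suc k) F \<theta> \<longleftrightarrow>
     (\<forall>x \<in> S. vanishes S k (shift N x F) (\<lambda>y. \<theta> (x \<oplus> y) \<cdot>\<^bsub>B\<^esub> red x F y))"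

context
  fixes F :: "('o, 'a, 'p, 'b) functr" and x :: 'o
  assumes F: "is_functor N B F" and x: "x \<in> Obj N"
begin

lemma F_inc: "y \<in> Obj N \<Longrightarrow> FA F (inc x y) \<in> Hom B (FO F y) (FO F (x \<oplus> y))"
  and F_pr: "y \<in> Obj N \<Longrightarrow> FA F (pr x y) \<in> Hom B (FO F (x \<oplus> y)) (FO F y)"
  and F_sum: "y \<in> Obj N \<Longrightarrow> FO F (x \<oplus> y) \<in> Obj B"
  using functor_Hom[OF F inc_Hom] functor_Hom[OF F pr_Hom] functor_Obj[OF F SumO_Obj] x by auto

lemma F_inc_pr: "y \<in> Obj N \<Longrightarrow> FA F (inc x y) \<cdot>\<^bsub>B\<^esub> FA F (pr x y) \<in> Hom B (FO F (x \<oplus> y)) (FO F (x \<oplus> y))"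
  by (rule B.Comp_Hom[OF F_pr F_inc])

lemma red_Hom: "y \<in> Obj N \<Longrightarrow> red x F y \<in> Hom B (FO F (x \<oplus> y)) (FO F (x \<oplus> y))"
  unfolding red_def by (rule B.sub_Hom[OF B.Ide_Hom[OF F_sum] F_inc_pr])

lemma Comp_red: "y \<in> Obj N \<Longrightarrow> h \<in> Hom B (FO F (x \<oplus> y)) z \<Longrightarrow>
    h \<cdot>\<^bsub>B\<^esub> red x F y = sub h ((h \<cdot>\<^bsub>B\<^esub> FA F (inc x y)) \<cdot>\<^bsub>B\<^esub> FA F (pr x y))"
  unfolding red_def
  by (simp add: B.Comp_sub_right[OF B.Ide_Hom[OF F_sum] F_inc_pr] B.Comp_Ide_right
      B.Comp_assoc[OF F_pr F_inc])

lemma red_Comp: "y \<in> Obj N \<Longrightarrow> h \<in> Hom B z (FO F (x \<oplus> y)) \<Longrightarrow>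
    red x F y \<cdot>\<^bsub>B\<^esub> h = sub h (FA F (inc x y) \<cdot>\<^bsub>B\<^esub> (FA F (pr x y) \<cdot>\<^bsub>B\<^esub> h))"
  unfolding red_def
  by (simp add: B.Comp_sub_left[OF _ B.Ide_Hom[OF F_sum] F_inc_pr] B.Comp_Ide_left
      B.Comp_assoc[OF _ F_pr F_inc])

lemma F_pr_inc: "y \<in> Obj N \<Longrightarrow> FA F (pr x y) \<cdot>\<^bsub>B\<^esub> FA F (inc x y) = Ide B (FO F y)"
  using functor_Comp[OF F inc_Hom pr_Hom] pr_inc functor_Ide[OF F] x by metis

lemma red_inc: "y \<in> Obj N \<Longrightarrow> red x F y \<cdot>\<^bsub>B\<^esub> FA F (inc x y) = zer (FO F y) (FO F (x \<oplus> y))"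
  by (simp add: red_Comp[OF _ F_inc] F_pr_inc B.Comp_Ide_right[OF F_inc] B.sub_self[OF F_inc])

text \<open>The term subtracted from \<open>h\<close> factors through the restriction of
  \<open>h\<close> to the included summand. This gives both the idempotence of \<open>red\<close>
  and, later, the universal property of its image as a cokernel.\<close>

lemma Comp_red_of_zero:
  assumes y: "y \<in> Obj N" and h: "h \<in> Hom B (FO F (x \<oplus> y)) z"
    and 0: "zero_arrow B (h \<cdot>\<^bsub>B\<^esub> FA F (inc x y))"
  shows "h \<cdot>\<^bsub>B\<^esub> red x F y = h"
proof -
  have "h \<cdot>\<^bsub>B\<^esub> FA F (inc x y) = zer (FO F y) z"
    using 0 B.zero_arrow_iff[OF B.Comp_Hom[OF F_inc[OF y] h]] by simp
  then show ?thesis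
    using B.Comp_zer_left[OF F_pr[OF y] B.HomD(5)[OF h]] B.sub_zer[OF h] by (simp add: Comp_red[OF y h])
qed

lemma red_idem: "y \<in> Obj N \<Longrightarrow> red x F y \<cdot>\<^bsub>B\<^esub> red x F y = red x F y"
  using Comp_red_of_zero[OF _ red_Hom] B.zero_arrow_iff B.Comp_Hom[OF F_inc red_Hom] red_inc by metis

lemma red_natural: "natural_transformation N B (shift N x F) (shift N x F) (red x F)"
proof (rule natural_transformationI)
  show "red x F a \<in> Hom B (FO (shift N x F) a) (FO (shift N x F) a)" if "a \<in> Obj N" for a
    using red_Hom[OF that] that by simp
  fix f a b assume f: "f \<in> Hom N a b"
  note o = HomD[OF f] and xf = shift_Hom[OF x f]
  note Fxf = functor_Hom[OF F xf] and Ff = functor_Hom[OF F f]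
  have "(FA F (Ide N x \<uplus> f) \<cdot>\<^bsub>B\<^esub> FA F (inc x a)) \<cdot>\<^bsub>B\<^esub> FA F (pr x a)
      = (FA F (inc x b) \<cdot>\<^bsub>B\<^esub> FA F f) \<cdot>\<^bsub>B\<^esub> FA F (pr x a)"
    using functor_Comp[OF F inc_Hom xf] functor_Comp[OF F f inc_Hom] inc_nat[OF x f] o x by simp
  also have "\<dots> = FA F (inc x b) \<cdot>\<^bsub>B\<^esub> (FA F f \<cdot>\<^bsub>B\<^esub> FA F (pr x a))"
    using B.Comp_assoc[OF F_pr Ff F_inc] o by simp
  also have "FA F f \<cdot>\<^bsub>B\<^esub> FA F (pr x a) = FA F (pr x b) \<cdot>\<^bsub>B\<^esub> FA F (Ide N x \<uplus> f)"
    using functor_Comp[OF F pr_Hom f] functor_Comp[OF F xf pr_Hom] pr_nat[OF x f] o x by simp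
  finally show "FA (shift N x F) f \<cdot>\<^bsub>B\<^esub> red x F a = red x F b \<cdot>\<^bsub>B\<^esub> FA (shift N x F) f"
    using f o by (simp add: Comp_red[OF _ Fxf] red_Comp[OF _ Fxf])
qed

lemma shift_arrow_Hom:
  assumes "F \<in> Fct_Obj N B"
  shows "shift_arrow N x F \<in> Hom (Fct N B) F (shift N x F)"
proof -
  have "natural_transformation N B F (shift N x F) (\<lambda>y \<in> Obj N. FA F (inc x y))"
  proof (rule natural_transformationI)
    show "(\<lambda>y \<in> Obj N. FA F (inc x y)) a \<in> Hom B (FO F a) (FO (shift N x F) a)" if "a \<in> Obj N" for a
      using F_inc[OF that] that by simp
    fix f a b assume f: "f \<in> Hom N a b"
    show "FA (shift N x F) f \<cdot>\<^bsub>B\<^esub> (\<lambda>y \<in> Obj N. FA F (inc x y)) a = (\<lambda>y \<in> Obj N. FA F (inc x y)) b \<cdot>\<^bsub>B\<^esub> FA F f"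
      using functor_Comp[OF F inc_Hom shift_Hom[OF x f]] functor_Comp[OF F f inc_Hom] inc_nat[OF x f] HomD[OF f] x f
      by simp
  qed
  then show ?thesis
    using assms shift_Fct_Obj[OF x F] by (simp add: shift_arrow_def Fct_Hom)
qed

end

text \<open>Naturality in the functor, whereas \<open>red_natural\<close> is naturality in the
  object: \<open>q\<close> commutes with the images of \<open>inc\<close> and \<open>pr\<close>,
  hence with their composite.\<close>

lemma red_natural_in_functor:
  assumes F: "is_functor N B F" and D: "is_functor N B D" and q: "natural_transformation N B F D q"
    and x: "x \<in> Obj N" and y: "y \<in> Obj N"
  shows "q (x \<oplus> y) \<cdot>\<^bsub>B\<^esub> red x F y = red x D y \<cdot>\<^bsub>B\<^esub> q (x \<oplus> y)"
proof -
  note qH = natural_transformation_Hom[OF q] and qn = natural_transformation_nat[OF q]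
  note xy = SumO_Obj[OF x y]
  have "(q (x \<oplus> y) \<cdot>\<^bsub>B\<^esub> FA F (inc x y)) \<cdot>\<^bsub>B\<^esub> FA F (pr x y)
    = FA D (inc x y) \<cdot>\<^bsub>B\<^esub> (q y \<cdot>\<^bsub>B\<^esub> FA F (pr x y))"
    using qn[OF inc_Hom[OF x y]] B.Comp_assoc[OF F_pr[OF F x y] qH[OF y] F_inc[OF D x y]] by simp
  also have "q y \<cdot>\<^bsub>B\<^esub> FA F (pr x y) = FA D (pr x y) \<cdot>\<^bsub>B\<^esub> q (x \<oplus> y)"
    using qn[OF pr_Hom[OF x y]] by simp
  finally show ?thesis
    by (simp add: Comp_red[OF F x y qH[OF xy]] red_Comp[OF D x y qH[OF xy]])
qed

section \<open>Stability of vanishing under composition with families of arrows\<close>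

lemma vanishes_cong:
  assumes "S \<subseteq> Obj N" "\<And>y. y \<in> Obj N \<Longrightarrow> \<theta> y = \<theta>' y"
  shows "vanishes S k F \<theta> = vanishes S k F \<theta>'"
  using assms
proof (induction k arbitrary: F \<theta> \<theta>')
  case 0
  then have "\<theta> w = \<theta>' w" if "w \<in> S" for w using that by blast
  then show ?case by simp
next
  case (Suc k)
  have "vanishes S k (shift N x F) (\<lambda>y. \<theta> (x \<oplus> y) \<cdot>\<^bsub>B\<^esub> red x F y)
      = vanishes S k (shift N x F) (\<lambda>y. \<theta>' (x \<oplus> y) \<cdot>\<^bsub>B\<^esub> red x F y)" if "x \<in> S" for x
    by (rule Suc.IH[OF Suc.prems(1)]) (use Suc.prems that SumO_Obj in auto)
  then show ?case by simp
qed

text \<open>All factors \<open>red\<close> stand to the right of \<open>\<theta>\<close>, so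
  whatever is composed on the left is carried along untouched. Accordingly \<open>\<rho>\<close> is
  an arbitrary family of arrows, with targets \<open>H y\<close> that need not form a
  functor.\<close>

lemma vanishes_Comp_left:
  assumes "S \<subseteq> Obj N" and "is_functor N B F"
    and "\<And>y. y \<in> Obj N \<Longrightarrow> \<theta> y \<in> Hom B (FO F y) (G y)"
    and "\<And>y. y \<in> Obj N \<Longrightarrow> \<rho> y \<in> Hom B (G y) (H y)"
    and "vanishes S k F \<theta>"
  shows "vanishes S k F (\<lambda>y. \<rho> y \<cdot>\<^bsub>B\<^esub> \<theta> y)"
  using assms
proof (induction k arbitrary: F \<theta> G \<rho> H)
  case 0
  have "zero_arrow B (\<rho> y \<cdot>\<^bsub>B\<^esub> \<theta> y)" if "y \<in> S" for y
  proof -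
    have y: "y \<in> Obj N" using 0 that by auto
    have "\<theta> y = zer (FO F y) (G y)"
      using 0(5) that B.zero_arrow_iff[OF 0(3)[OF y]] by simp
    then have "\<rho> y \<cdot>\<^bsub>B\<^esub> \<theta> y = zer (FO F y) (H y)"
      using B.Comp_zer_right[OF 0(4)[OF y] functor_Obj[OF 0(2) y]] by simp
    then show ?thesis using B.zero_arrow_iff[OF B.Comp_Hom[OF 0(3)[OF y] 0(4)[OF y]]] by simp
  qed
  then show ?case by simp
next
  case (Suc k)
  have "vanishes S k (shift N x F) (\<lambda>y. (\<rho> (x \<oplus> y) \<cdot>\<^bsub>B\<^esub> \<theta> (x \<oplus> y)) \<cdot>\<^bsub>B\<^esub> red x F y)" if xS: "x \<in> S" for x
  proof -
    have x: "x \<in> Obj N" using xS Suc.prems(1) by auto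
    note red = red_Hom[OF Suc.prems(2) x]
    have "vanishes S k (shift N x F) (\<lambda>y. \<rho> (x \<oplus> y) \<cdot>\<^bsub>B\<^esub> (\<theta> (x \<oplus> y) \<cdot>\<^bsub>B\<^esub> red x F y))"
    proof (rule Suc.IH[OF Suc.prems(1) shift_functor[OF x Suc.prems(2)]])
      show "\<theta> (x \<oplus> y) \<cdot>\<^bsub>B\<^esub> red x F y \<in> Hom B (FO (shift N x F) y) (G (x \<oplus> y))" if "y \<in> Obj N" for y
        using B.Comp_Hom[OF red Suc.prems(3)] that SumO_Obj[OF x that] by simp
      show "\<rho> (x \<oplus> y) \<in> Hom B (G (x \<oplus> y)) (H (x \<oplus> y))" if "y \<in> Obj N" for y
        using Suc.prems(4) SumO_Obj[OF x that] .
    qed (use Suc.prems(5) xS in simp)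
    then show ?thesis
      by (rule vanishes_cong[THEN iffD1, rotated 2])
        (use Suc.prems(1) B.Comp_assoc[OF red Suc.prems(3) Suc.prems(4)] SumO_Obj[OF x] in auto)
  qed
  then show ?case by simp
qed

text \<open>Here \<open>q\<close> has to pass each factor \<open>red\<close>, exchanging the factor
  of \<open>D\<close> for that of \<open>F\<close>; this is why it is required to be
  natural.\<close>

lemma vanishes_Comp_right:
  assumes "S \<subseteq> Obj N" and "is_functor N B F" and "is_functor N B D"
    and "natural_transformation N B F D q"
    and "\<And>y. y \<in> Obj N \<Longrightarrow> \<theta> y \<in> Hom B (FO D y) (G y)"
    and "vanishes S k D \<theta>"
  shows "vanishes S k F (\<lambda>y. \<theta> y \<cdot>\<^bsub>B\<^esub> q y)"
  using assms
proof (induction k arbitrary: F D q \<theta> G)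
  case 0
  have "zero_arrow B (\<theta> y \<cdot>\<^bsub>B\<^esub> q y)" if "y \<in> S" for y
  proof -
    have y: "y \<in> Obj N" using 0 that by auto
    note q = natural_transformation_Hom[OF 0(4) y]
    have "\<theta> y = zer (FO D y) (G y)"
      using 0(6) that B.zero_arrow_iff[OF 0(5)[OF y]] by simp
    then show ?thesis
      using B.zero_arrow_iff[OF B.Comp_Hom[OF q 0(5)[OF y]]]
        B.Comp_zer_left[OF q] B.HomD(5)[OF 0(5)[OF y]] by simp
  qed
  then show ?case by simp
next
  case (Suc k)
  have "vanishes S k (shift N x F) (\<lambda>y. (\<theta> (x \<oplus> y) \<cdot>\<^bsub>B\<^esub> q (x \<oplus> y)) \<cdot>\<^bsub>B\<^esub> red x F y)" if xS: "x \<in> S" for x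
  proof -
    have x: "x \<in> Obj N" using xS Suc.prems(1) by auto
    note redF = red_Hom[OF Suc.prems(2) x] and redD = red_Hom[OF Suc.prems(3) x]
    note q = natural_transformation_Hom[OF Suc.prems(4)]
    have "vanishes S k (shift N x F) (\<lambda>y. (\<theta> (x \<oplus> y) \<cdot>\<^bsub>B\<^esub> red x D y) \<cdot>\<^bsub>B\<^esub> q (x \<oplus> y))"
    proof (rule Suc.IH[OF Suc.prems(1) shift_functor[OF x Suc.prems(2)] shift_functor[OF x Suc.prems(3)]
          shift_natural_transformation[OF x Suc.prems(4)]])
      show "\<theta> (x \<oplus> y) \<cdot>\<^bsub>B\<^esub> red x D y \<in> Hom B (FO (shift N x D) y) (G (x \<oplus> y))" if "y \<in> Obj N" for y
        using B.Comp_Hom[OF redD Suc.prems(5)] that SumO_Obj[OF x that] by simp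
    qed (use Suc.prems(6) xS in simp)
    moreover have "(\<theta> (x \<oplus> y) \<cdot>\<^bsub>B\<^esub> red x D y) \<cdot>\<^bsub>B\<^esub> q (x \<oplus> y) = (\<theta> (x \<oplus> y) \<cdot>\<^bsub>B\<^esub> q (x \<oplus> y)) \<cdot>\<^bsub>B\<^esub> red x F y"
      if y: "y \<in> Obj N" for y
      using B.Comp_assoc[OF q redD Suc.prems(5)] B.Comp_assoc[OF redF q Suc.prems(5)] y SumO_Obj[OF x y]
        red_natural_in_functor[OF Suc.prems(2-4) x y] by simp
    ultimately show ?thesis
      by (rule vanishes_cong[OF Suc.prems(1), THEN iffD1, rotated])
  qed
  then show ?case by simp
qed

end

section \<open>Polynomial functors and vanishing of cross effects\<close>

lemma (in category) cokernel_factor: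
  assumes "is_cokernel C f q" "f \<in> Hom C a b" "q \<in> Hom C b c" "h \<in> Hom C b d" "zero_arrow C (h \<cdot> f)"
  shows "\<exists>!w. w \<in> Hom C c d \<and> w \<cdot> q = h"
proof -
  have "\<forall>h \<in> Arr C. Dom C h = Cod C f \<and> zero_arrow C (h \<cdot> f) \<longrightarrow>
        (\<exists>!w. w \<in> Hom C (Cod C q) (Cod C h) \<and> w \<cdot> q = h)"
    using assms(1) unfolding is_cokernel_def by blast
  from this[rule_format, OF HomD(1)[OF assms(4)]] show ?thesis
    using assms(5) HomD(3)[OF assms(2)] HomD(3)[OF assms(3)] HomD(2,3)[OF assms(4)] by simp
qed

text \<open>Splittings chosen object by object assemble into a functor that sends \<open>f\<close>
  to \<open>q \<cdot> F f \<cdot> k\<close>. Naturality of \<open>e\<close> makes \<open>k\<close>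
  and \<open>q\<close> natural, and from this the new assignment respects composition.\<close>

lemma natural_idempotent_splits:
  assumes B: "difference_category B zer sub"
    and F: "is_functor C B F" and e: "natural_transformation C B F F e"
    and idem: "\<And>y. y \<in> Obj C \<Longrightarrow> e y \<cdot>\<^bsub>B\<^esub> e y = e y"
  obtains D k q where "D \<in> Fct_Obj C B" "natural_transformation C B D F k"
    "natural_transformation C B F D q" "\<And>y. y \<in> Obj C \<Longrightarrow> k y \<cdot>\<^bsub>B\<^esub> q y = e y"
    "\<And>y. y \<in> Obj C \<Longrightarrow> q y \<cdot>\<^bsub>B\<^esub> k y = Ide B (FO D y)"
    "k \<in> extensional (Obj C)" "q \<in> extensional (Obj C)"
proof -
  interpret B: difference_category B zer sub by (rule B)
  interpret C: category C using functor_categories[OF F] by simp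
  have "\<exists>d k q. k \<in> Hom B d (FO F y) \<and> q \<in> Hom B (FO F y) d \<and> k \<cdot>\<^bsub>B\<^esub> q = e y \<and> q \<cdot>\<^bsub>B\<^esub> k = Ide B d"
    if "y \<in> Obj C" for y
    using B.idempotent_splits[OF natural_transformation_Hom[OF e that] idem[OF that]] by blast
  then obtain d k q where k: "\<And>y. y \<in> Obj C \<Longrightarrow> k y \<in> Hom B (d y) (FO F y)"
    and q: "\<And>y. y \<in> Obj C \<Longrightarrow> q y \<in> Hom B (FO F y) (d y)"
    and kq: "\<And>y. y \<in> Obj C \<Longrightarrow> k y \<cdot>\<^bsub>B\<^esub> q y = e y"
    and qk: "\<And>y. y \<in> Obj C \<Longrightarrow> q y \<cdot>\<^bsub>B\<^esub> k y = Ide B (d y)"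
    by metis
  have d: "d y \<in> Obj B" if "y \<in> Obj C" for y using B.HomD[OF k[OF that]] by simp
  define D where "D = \<lparr>FO = (\<lambda>y \<in> Obj C. d y),
    FA = (\<lambda>f \<in> Arr C. q (Cod C f) \<cdot>\<^bsub>B\<^esub> (FA F f \<cdot>\<^bsub>B\<^esub> k (Dom C f)))\<rparr>"
  have DO: "FO D y = d y" if "y \<in> Obj C" for y using that by (simp add: D_def)
  have DA: "FA D f = q b \<cdot>\<^bsub>B\<^esub> (FA F f \<cdot>\<^bsub>B\<^esub> k a)" if "f \<in> Hom C a b" for f a b
    using C.HomD[OF that] by (simp add: D_def)
  have DH: "FA D f \<in> Hom B (d a) (d b)" if f: "f \<in> Hom C a b" for f a b
    unfolding DA[OF f]
    by (rule B.Comp_Hom[OF B.Comp_Hom[OF k functor_Hom[OF F f]] q]) (use C.HomD[OF f] in auto)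
  have Fk: "FA F f \<cdot>\<^bsub>B\<^esub> k a = k b \<cdot>\<^bsub>B\<^esub> FA D f" if f: "f \<in> Hom C a b" for f a b
  proof -
    have a: "a \<in> Obj C" and b: "b \<in> Obj C" using C.HomD[OF f] by auto
    note Ff = functor_Hom[OF F f] and eH = natural_transformation_Hom[OF e]
    have "k b \<cdot>\<^bsub>B\<^esub> FA D f = e b \<cdot>\<^bsub>B\<^esub> (FA F f \<cdot>\<^bsub>B\<^esub> k a)"
      using B.Comp_assoc[OF B.Comp_Hom[OF k[OF a] Ff] q[OF b] k[OF b]] by (simp add: DA[OF f] kq[OF b])
    also have "\<dots> = (FA F f \<cdot>\<^bsub>B\<^esub> e a) \<cdot>\<^bsub>B\<^esub> k a"
      using B.Comp_assoc[OF k[OF a] Ff eH[OF b]] natural_transformation_nat[OF e f] by simp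
    also have "\<dots> = FA F f \<cdot>\<^bsub>B\<^esub> (e a \<cdot>\<^bsub>B\<^esub> k a)" using B.Comp_assoc[OF k[OF a] eH[OF a] Ff] .
    also have "e a \<cdot>\<^bsub>B\<^esub> k a = k a"
      using B.Comp_assoc[OF k[OF a] q[OF a] k[OF a]] B.Comp_Ide_right[OF k[OF a]]
      by (simp add: kq[OF a] qk[OF a])
    finally show ?thesis by simp
  qed
  have qF: "q b \<cdot>\<^bsub>B\<^esub> FA F f = FA D f \<cdot>\<^bsub>B\<^esub> q a" if f: "f \<in> Hom C a b" for f a b
  proof -
    have a: "a \<in> Obj C" and b: "b \<in> Obj C" using C.HomD[OF f] by auto
    note Ff = functor_Hom[OF F f] and eH = natural_transformation_Hom[OF e]
    have "FA D f \<cdot>\<^bsub>B\<^esub> q a = q b \<cdot>\<^bsub>B\<^esub> (FA F f \<cdot>\<^bsub>B\<^esub> e a)"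
      using B.Comp_assoc[OF q[OF a] B.Comp_Hom[OF k[OF a] Ff] q[OF b]] B.Comp_assoc[OF q[OF a] k[OF a] Ff]
      by (simp add: DA[OF f] kq[OF a])
    also have "\<dots> = (q b \<cdot>\<^bsub>B\<^esub> e b) \<cdot>\<^bsub>B\<^esub> FA F f"
      using B.Comp_assoc[OF Ff eH[OF b] q[OF b]] natural_transformation_nat[OF e f] by simp
    also have "q b \<cdot>\<^bsub>B\<^esub> e b = q b"
      using B.Comp_assoc[OF q[OF b] k[OF b] q[OF b]] B.Comp_Ide_left[OF q[OF b]]
      by (simp add: kq[OF b] qk[OF b])
    finally show ?thesis by simp
  qed
  have DF: "is_functor C B D"
  proof (rule is_functorI)
    fix a assume a: "a \<in> Obj C"
    show "FO D a \<in> Obj B" using d a DO by simp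
    show "FA D (Ide C a) = Ide B (FO D a)"
      by (simp add: DA[OF C.Ide_Hom[OF a]] functor_Ide[OF F a] B.Comp_Ide_left[OF k[OF a]] qk a DO)
  next
    fix f a b assume f: "f \<in> Hom C a b"
    have a: "a \<in> Obj C" and b: "b \<in> Obj C" using C.HomD[OF f] by auto
    show "FA D f \<in> Hom B (FO D a) (FO D b)" using DH[OF f] DO a b by simp
    fix g c assume g: "g \<in> Hom C b c"
    have c: "c \<in> Obj C" using C.HomD[OF g] by auto
    have "FA D (g \<cdot>\<^bsub>C\<^esub> f) = q c \<cdot>\<^bsub>B\<^esub> (FA F g \<cdot>\<^bsub>B\<^esub> (FA F f \<cdot>\<^bsub>B\<^esub> k a))"
      by (simp add: DA[OF C.Comp_Hom[OF f g]] functor_Comp[OF F f g]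
          B.Comp_assoc[OF k[OF a] functor_Hom[OF F f] functor_Hom[OF F g]])
    also have "\<dots> = q c \<cdot>\<^bsub>B\<^esub> ((FA F g \<cdot>\<^bsub>B\<^esub> k b) \<cdot>\<^bsub>B\<^esub> FA D f)"
      by (simp add: Fk[OF f] B.Comp_assoc[OF DH[OF f] k[OF b] functor_Hom[OF F g]])
    also have "\<dots> = FA D g \<cdot>\<^bsub>B\<^esub> FA D f"
      by (simp add: DA[OF g] B.Comp_assoc[OF DH[OF f] B.Comp_Hom[OF k[OF b] functor_Hom[OF F g]] q[OF c]])
    finally show "FA D (g \<cdot>\<^bsub>C\<^esub> f) = FA D g \<cdot>\<^bsub>B\<^esub> FA D f" .
  qed (fact C.category_axioms B.category_axioms)+
  show ?thesis
  proof (rule that[of D "restrict k (Obj C)" "restrict q (Obj C)"])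
    show "D \<in> Fct_Obj C B" using DF by (simp add: Fct_Obj_def D_def)
    show "natural_transformation C B D F (restrict k (Obj C))"
      by (rule natural_transformationI) (use k DO Fk C.HomD in auto)
    show "natural_transformation C B F D (restrict q (Obj C))"
      by (rule natural_transformationI) (use q DO qF C.HomD in \<open>auto simp: eq_commute\<close>)
  qed (use kq qk DO in auto)
qed

context shift_functors begin

text \<open>Since \<open>red\<close> kills the inclusion \<open>F -> F(x \<oplus> -)\<close>, it
  factors as \<open>r \<cdot> \<kappa>\<close> through any cokernel \<open>\<kappa>\<close>.
  Vanishing for the identity of the cokernel object is pulled back along \<open>\<kappa>\<close> and
  then pushed forward along \<open>r\<close>.\<close>

lemma vanishes_of_polynomial_cokernel:
  assumes F: "F \<in> Fct_Obj N B" and x: "x \<in> Obj N"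
    and q: "is_cokernel (Fct N B) (shift_arrow N x F) q"
    and van: "\<And>D. D = Cod (Fct N B) q \<Longrightarrow> D \<in> Fct_Obj N B \<Longrightarrow> vanishes (Obj N) k D (\<lambda>y. Ide B (FO D y))"
  shows "vanishes (Obj N) k (shift N x F) (\<lambda>y. Ide B (FO F (x \<oplus> y)) \<cdot>\<^bsub>B\<^esub> red x F y)"
proof -
  note FF = Fct_ObjD[OF F]
  note sF = shift_functor[OF x FF] and sFo = shift_Fct_Obj[OF x FF]
  interpret Fct: category "Fct N B" by (rule Fct_category[OF category_axioms B.category_axioms])
  note sa = shift_arrow_Hom[OF FF x F]
  have qH: "q \<in> Hom (Fct N B) (shift N x F) (Cod (Fct N B) q)"
    using q Fct.HomD[OF sa] unfolding is_cokernel_def by (auto simp: Hom_def)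
  then obtain D \<kappa> where qe: "q = (shift N x F, D, \<kappa>)" and D: "D \<in> Fct_Obj N B"
    and \<kappa>: "natural_transformation N B (shift N x F) D \<kappa>"
    by (metis Fct_HomE)
  note DF = Fct_ObjD[OF D]
  define \<rho> where "\<rho> = restrict (red x F) (Obj N)"
  have \<rho>n: "natural_transformation N B (shift N x F) (shift N x F) \<rho>"
    unfolding \<rho>_def by (rule natural_transformation_cong[OF category_axioms _ red_natural[OF FF x]]) simp
  have \<rho>H: "(shift N x F, shift N x F, \<rho>) \<in> Hom (Fct N B) (shift N x F) (shift N x F)"
    using sFo \<rho>n by (simp add: Fct_Hom \<rho>_def)
  have "zero_arrow (Fct N B) ((shift N x F, shift N x F, \<rho>) \<cdot>\<^bsub>Fct N B\<^esub> shift_arrow N x F)"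
  proof -
    have "(shift N x F, shift N x F, \<rho>) \<cdot>\<^bsub>Fct N B\<^esub> shift_arrow N x F
      = (F, shift N x F, \<lambda>y \<in> Obj N. zer (FO F y) (FO F (x \<oplus> y)))"
      by (auto simp: shift_arrow_def \<rho>_def fun_eq_iff red_inc[OF FF x])
    moreover have "(shift N x F, shift N x F, \<rho>) \<cdot>\<^bsub>Fct N B\<^esub> shift_arrow N x F \<in> Arr (Fct N B)"
      using Fct.HomD[OF Fct.Comp_Hom[OF sa \<rho>H]] by simp
    ultimately show ?thesis
      using B.zero_arrow_iff[OF B.zer_Hom[OF functor_Obj[OF FF] F_sum[OF FF x]]]
      by (simp add: zero_Fct_arrow_iff)
  qed
  then obtain w where w: "w \<in> Hom (Fct N B) D (shift N x F)"
    and wq: "w \<cdot>\<^bsub>Fct N B\<^esub> q = (shift N x F, shift N x F, \<rho>)"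
    using Fct.cokernel_factor[OF q sa _ \<rho>H, of D] qH qe by (metis Fct_simps(3))
  from w obtain r where we: "w = (D, shift N x F, r)" and r: "natural_transformation N B D (shift N x F) r"
    by (rule Fct_HomE)
  have r\<kappa>: "r y \<cdot>\<^bsub>B\<^esub> \<kappa> y = red x F y" if "y \<in> Obj N" for y
  proof -
    have "\<rho> = (\<lambda>y \<in> Obj N. r y \<cdot>\<^bsub>B\<^esub> \<kappa> y)" using wq by (simp add: we qe)
    from fun_cong[OF this, of y] show ?thesis using that by (simp add: \<rho>_def)
  qed
  note \<kappa>H = natural_transformation_Hom[OF \<kappa>] and rH = natural_transformation_Hom[OF r]
  have 1: "vanishes (Obj N) k D (\<lambda>y. Ide B (FO D y))" using van D qe by simp
  have 2: "vanishes (Obj N) k (shift N x F) (\<lambda>y. Ide B (FO D y) \<cdot>\<^bsub>B\<^esub> \<kappa> y)"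
    by (rule vanishes_Comp_right[OF _ sF DF \<kappa> _ 1]) (auto intro: B.Ide_Hom functor_Obj[OF DF])
  have 3: "vanishes (Obj N) k (shift N x F) (\<lambda>y. r y \<cdot>\<^bsub>B\<^esub> (Ide B (FO D y) \<cdot>\<^bsub>B\<^esub> \<kappa> y))"
    by (rule vanishes_Comp_left[OF _ sF B.Comp_Hom[OF \<kappa>H B.Ide_Hom[OF functor_Obj[OF DF]]] rH 2]) auto
  show ?thesis
    by (rule vanishes_cong[THEN iffD1, OF _ _ 3])
      (use B.Comp_Ide_left[OF \<kappa>H] B.Comp_Ide_left[OF red_Hom[OF FF x]] r\<kappa> in auto)
qed

text \<open>Splitting the natural idempotent \<open>red\<close> as \<open>j \<cdot> q\<close>
  exhibits \<open>q\<close> as a cokernel: a transformation that vanishes on \<open>F\<close> is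
  unchanged by \<open>red\<close>, hence factors through \<open>q\<close>. The identity of the
  cokernel object equals \<open>q \<cdot> red \<cdot> j\<close>, which transfers the vanishing to
  it.\<close>

lemma cokernel_of_vanishes:
  assumes F: "F \<in> Fct_Obj N B" and x: "x \<in> Obj N"
    and van: "vanishes (Obj N) k (shift N x F) (\<lambda>y. Ide B (FO F (x \<oplus> y)) \<cdot>\<^bsub>B\<^esub> red x F y)"
  shows "\<exists>q. is_cokernel (Fct N B) (shift_arrow N x F) q \<and> Cod (Fct N B) q \<in> Fct_Obj N B \<and>
     vanishes (Obj N) k (Cod (Fct N B) q) (\<lambda>y. Ide B (FO (Cod (Fct N B) q) y))"
proof -
  note FF = Fct_ObjD[OF F]
  note sF = shift_functor[OF x FF] and sFo = shift_Fct_Obj[OF x FF]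
  interpret Fct: category "Fct N B" by (rule Fct_category[OF category_axioms B.category_axioms])
  note sa = shift_arrow_Hom[OF FF x F]
  obtain D j q where D: "D \<in> Fct_Obj N B" and j: "natural_transformation N B D (shift N x F) j"
    and q: "natural_transformation N B (shift N x F) D q"
    and jq: "\<And>y. y \<in> Obj N \<Longrightarrow> j y \<cdot>\<^bsub>B\<^esub> q y = red x F y"
    and qj: "\<And>y. y \<in> Obj N \<Longrightarrow> q y \<cdot>\<^bsub>B\<^esub> j y = Ide B (FO D y)"
    and ext: "j \<in> extensional (Obj N)" "q \<in> extensional (Obj N)"
    using natural_idempotent_splits[OF B.difference_category_axioms sF red_natural[OF FF x] red_idem[OF FF x]]
    by blast
  note DF = Fct_ObjD[OF D]
  note qH = natural_transformation_Hom[OF q] and jH = natural_transformation_Hom[OF j]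
  have qA: "(shift N x F, D, q) \<in> Hom (Fct N B) (shift N x F) D" using sFo D q ext by (simp add: Fct_Hom)
  have jA: "(D, shift N x F, j) \<in> Hom (Fct N B) D (shift N x F)" using sFo D j ext by (simp add: Fct_Hom)
  have qinc: "q y \<cdot>\<^bsub>B\<^esub> FA F (inc x y) = zer (FO F y) (FO D y)" if y: "y \<in> Obj N" for y
  proof -
    have qHy: "q y \<in> Hom B (FO F (x \<oplus> y)) (FO D y)" and jHy: "j y \<in> Hom B (FO D y) (FO F (x \<oplus> y))"
      using qH[OF y] jH[OF y] y by auto
    have "q y = q y \<cdot>\<^bsub>B\<^esub> red x F y"
      using B.Comp_assoc[OF qHy jHy qHy] B.Comp_Ide_left[OF qHy] jq[OF y] qj[OF y] by simp
    then have "q y \<cdot>\<^bsub>B\<^esub> FA F (inc x y) = q y \<cdot>\<^bsub>B\<^esub> (red x F y \<cdot>\<^bsub>B\<^esub> FA F (inc x y))"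
      using B.Comp_assoc[OF F_inc[OF FF x y] red_Hom[OF FF x y] qHy] by simp
    also have "\<dots> = zer (FO F y) (FO D y)"
      using red_inc[OF FF x y] B.Comp_zer_right[OF qHy functor_Obj[OF FF y]] by simp
    finally show ?thesis .
  qed
  have z: "zero_arrow (Fct N B) ((shift N x F, D, q) \<cdot>\<^bsub>Fct N B\<^esub> shift_arrow N x F)"
  proof -
    have "(shift N x F, D, q) \<cdot>\<^bsub>Fct N B\<^esub> shift_arrow N x F = (F, D, \<lambda>y \<in> Obj N. zer (FO F y) (FO D y))"
      by (auto simp: shift_arrow_def fun_eq_iff qinc)
    moreover have "(shift N x F, D, q) \<cdot>\<^bsub>Fct N B\<^esub> shift_arrow N x F \<in> Arr (Fct N B)"
      using Fct.HomD[OF Fct.Comp_Hom[OF sa qA]] by simp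
    ultimately show ?thesis
      using B.zero_arrow_iff[OF B.zer_Hom[OF functor_Obj[OF FF] functor_Obj[OF DF]]]
      by (simp add: zero_Fct_arrow_iff)
  qed
  have univ: "\<exists>!w. w \<in> Hom (Fct N B) D H \<and> w \<cdot>\<^bsub>Fct N B\<^esub> (shift N x F, D, q) = h"
    if h: "h \<in> Hom (Fct N B) (shift N x F) H" and hz: "zero_arrow (Fct N B) (h \<cdot>\<^bsub>Fct N B\<^esub> shift_arrow N x F)" for h H
  proof -
    obtain \<chi> where he: "h = (shift N x F, H, \<chi>)" and H: "H \<in> Fct_Obj N B"
      and \<chi>: "natural_transformation N B (shift N x F) H \<chi>" and \<chi>e: "\<chi> \<in> extensional (Obj N)"
      using h by (rule Fct_HomE)
    have "h \<cdot>\<^bsub>Fct N B\<^esub> shift_arrow N x F \<in> Arr (Fct N B)" using Fct.HomD[OF Fct.Comp_Hom[OF sa h]] by simp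
    then have hz': "zero_arrow B (\<chi> y \<cdot>\<^bsub>B\<^esub> FA F (inc x y))" if "y \<in> Obj N" for y
      using hz that by (simp add: he shift_arrow_def zero_Fct_arrow_iff)
    have \<chi>red: "\<chi> y \<cdot>\<^bsub>B\<^esub> red x F y = \<chi> y" if y: "y \<in> Obj N" for y
      using Comp_red_of_zero[OF FF x y _ hz'[OF y]] natural_transformation_Hom[OF \<chi> y] y by simp
    have idD: "(shift N x F, D, q) \<cdot>\<^bsub>Fct N B\<^esub> (D, shift N x F, j) = Ide (Fct N B) D"
      by (auto simp: fun_eq_iff qj)
    have hjq: "(h \<cdot>\<^bsub>Fct N B\<^esub> (D, shift N x F, j)) \<cdot>\<^bsub>Fct N B\<^esub> (shift N x F, D, q) = h"
    proof -
      have "(h \<cdot>\<^bsub>Fct N B\<^esub> (D, shift N x F, j)) \<cdot>\<^bsub>Fct N B\<^esub> (shift N x F, D, q)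
        = h \<cdot>\<^bsub>Fct N B\<^esub> ((D, shift N x F, j) \<cdot>\<^bsub>Fct N B\<^esub> (shift N x F, D, q))"
        by (rule Fct.Comp_assoc[OF qA jA h])
      also have "\<dots> = h" using \<chi>e by (auto simp: he fun_eq_iff jq \<chi>red extensional_def)
      finally show ?thesis .
    qed
    \<comment> \<open>The section \<open>j\<close> of \<open>q\<close> makes the factorisation
      unique.\<close>
    have "w = h \<cdot>\<^bsub>Fct N B\<^esub> (D, shift N x F, j)"
      if w: "w \<in> Hom (Fct N B) D H" "w \<cdot>\<^bsub>Fct N B\<^esub> (shift N x F, D, q) = h" for w
      using Fct.Comp_assoc[OF jA qA w(1)] w(2) idD Fct.Comp_Ide_right[OF w(1)] by simp
    then show ?thesis using hjq Fct.Comp_Hom[OF jA h] by blast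
  qed
  have cok: "is_cokernel (Fct N B) (shift_arrow N x F) (shift N x F, D, q)"
    unfolding is_cokernel_def using z univ Fct.HomD[OF sa] Fct.HomD[OF qA] by (auto simp: Hom_def)
  have IH: "Ide B (FO F (x \<oplus> y)) \<cdot>\<^bsub>B\<^esub> red x F y = red x F y" if "y \<in> Obj N" for y
    by (rule B.Comp_Ide_left[OF red_Hom[OF FF x that]])
  have v1: "vanishes (Obj N) k (shift N x F) (red x F)"
    by (rule vanishes_cong[THEN iffD1, OF _ _ van]) (use IH in auto)
  have v2: "vanishes (Obj N) k D (\<lambda>y. red x F y \<cdot>\<^bsub>B\<^esub> j y)"
    by (rule vanishes_Comp_right[OF _ DF sF j natural_transformation_Hom[OF red_natural[OF FF x]] v1]) auto
  have v3: "vanishes (Obj N) k D (\<lambda>y. q y \<cdot>\<^bsub>B\<^esub> (red x F y \<cdot>\<^bsub>B\<^esub> j y))"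
    by (rule vanishes_Comp_left[OF _ DF B.Comp_Hom[OF jH natural_transformation_Hom[OF red_natural[OF FF x]]] qH v2]) auto
  have "q y \<cdot>\<^bsub>B\<^esub> (red x F y \<cdot>\<^bsub>B\<^esub> j y) = Ide B (FO D y)" if y: "y \<in> Obj N" for y
  proof -
    have "red x F y \<cdot>\<^bsub>B\<^esub> j y = j y"
      using B.Comp_assoc[OF jH[OF y] qH[OF y] jH[OF y]] B.Comp_Ide_right[OF jH[OF y]]
      by (simp add: jq[OF y] qj[OF y])
    then show ?thesis using qj[OF y] by simp
  qed
  then have "vanishes (Obj N) k D (\<lambda>y. Ide B (FO D y))"
    by (intro vanishes_cong[THEN iffD1, OF _ _ v3]) auto
  then show ?thesis using cok D by (intro exI[of _ "(shift N x F, D, q)"]) simp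
qed

text \<open>The index is shifted because null functors, of degree -1, are tested without any factor
  \<open>red\<close>; each further degree adds one factor. The two directions of the inductive step
  use different cokernels: an arbitrary one supplied by the definition, and the one obtained by
  splitting \<open>red\<close>.\<close>

theorem polynomial_iff_vanishes:
  assumes "F \<in> Fct_Obj N B"
  shows "polynomial N B (int k - 1) F \<longleftrightarrow> vanishes (Obj N) k F (\<lambda>y. Ide B (FO F y))"
  using assms
proof (induction k arbitrary: F)
  case 0
  have "polynomial N B (- 1) F \<longleftrightarrow> null_object (Fct N B) F"
    by (subst polynomial.simps) auto
  then show ?case using null_functor_iff[OF 0] by simp
next
  case (Suc k)
  have "polynomial N B (int k) F \<longleftrightarrow> (\<forall>x \<in> Obj N. \<exists>q. is_cokernel (Fct N B) (shift_arrow N x F) q \<and>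
        polynomial N B (int k - 1) (Cod (Fct N B) q))"
    using Suc.prems by (subst polynomial.simps) auto
  also have "\<dots> \<longleftrightarrow> vanishes (Obj N) (Suc k) F (\<lambda>y. Ide B (FO F y))"
  proof
    assume h: "\<forall>x \<in> Obj N. \<exists>q. is_cokernel (Fct N B) (shift_arrow N x F) q \<and>
        polynomial N B (int k - 1) (Cod (Fct N B) q)"
    show "vanishes (Obj N) (Suc k) F (\<lambda>y. Ide B (FO F y))"
      unfolding vanishes.simps
    proof
      fix x assume x: "x \<in> Obj N"
      obtain q where "is_cokernel (Fct N B) (shift_arrow N x F) q"
        "polynomial N B (int k - 1) (Cod (Fct N B) q)" using h x by blast
      then show "vanishes (Obj N) k (shift N x F) (\<lambda>y. Ide B (FO F (x \<oplus> y)) \<cdot>\<^bsub>B\<^esub> red x F y)"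
        using vanishes_of_polynomial_cokernel[OF Suc.prems x] Suc.IH by blast
    qed
  next
    assume "vanishes (Obj N) (Suc k) F (\<lambda>y. Ide B (FO F y))"
    then have "\<exists>q. is_cokernel (Fct N B) (shift_arrow N x F) q \<and> Cod (Fct N B) q \<in> Fct_Obj N B \<and>
        vanishes (Obj N) k (Cod (Fct N B) q) (\<lambda>y. Ide B (FO (Cod (Fct N B) q) y))" if "x \<in> Obj N" for x
      using cokernel_of_vanishes[OF Suc.prems that] that by simp
    then show "\<forall>x \<in> Obj N. \<exists>q. is_cokernel (Fct N B) (shift_arrow N x F) q \<and>
        polynomial N B (int k - 1) (Cod (Fct N B) q)"
      using Suc.IH by blast
  qed
  finally show ?case by simp
qed

end

section \<open>The category \<open>tilde M\<close>\<close>

text \<open>Operations on classes are \<open>the_elem\<close> of the set of values on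
  representatives. Well-definedness thus amounts to independence of the representatives, with the
  witnesses keeping the set nonempty.\<close>

lemma Collect_constant:
  assumes c: "\<And>u g t f. P u g \<Longrightarrow> Q t f \<Longrightarrow> F u g t f = c" and w: "P u0 g0" "Q t0 f0"
  shows "{F u g t f | u g t f. P u g \<and> Q t f} = {c}"
proof -
  have "c \<in> {F u g t f | u g t f. P u g \<and> Q t f}"
    using c[OF w] w by (intro CollectI exI[of _ u0] exI[of _ g0] exI[of _ t0] exI[of _ f0]) simp
  then show ?thesis using c by blast
qed

lemma colim_class_self: "p \<in> colim_class C X act p"
  by (simp add: colim_class_def)

text \<open>Compatibility with the generating steps propagates along the zigzags that make up a
  class. The well-definedness arguments rest on this, so the generated equivalence relation never
  has to be described explicitly.\<close>

lemma colim_class_invariant: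
  assumes step: "\<And>s t x h. \<lbrakk>s \<in> Obj C; t \<in> Obj C; h \<in> Hom C s t; x \<in> X s\<rbrakk> \<Longrightarrow> Q (s, x) = Q (t, act h x)"
    and "p' \<in> colim_class C X act p"
  shows "Q p' = Q p"
proof -
  have "(p, p') \<in> (colim_rel C X act \<union> (colim_rel C X act)\<inverse>)\<^sup>*"
    using assms(2) by (simp add: colim_class_def)
  then show ?thesis
    by (induction rule: rtrancl_induct) (auto simp: colim_rel_def step)
qed

lemma colim_class_step:
  assumes "s \<in> Obj C" "t \<in> Obj C" "h \<in> Hom C s t" "x \<in> X s"
  shows "colim_class C X act (s, x) = colim_class C X act (t, act h x)"
proof -
  let ?R = "colim_rel C X act \<union> (colim_rel C X act)\<inverse>"
  have "((s, x), (t, act h x)) \<in> ?R" "((t, act h x), (s, x)) \<in> ?R"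
    using assms by (auto simp: colim_rel_def)
  then show ?thesis
    unfolding colim_class_def by (auto intro: converse_rtrancl_into_rtrancl)
qed

context strict_symmetric_monoidal begin

lemma HomA: "f \<in> Hom M a b \<Longrightarrow> f \<in> Arr M"
  by (rule HomD(1))

lemma SumA_Ide_right_Comp:
  assumes "f \<in> Hom M a b" "g \<in> Hom M b c" "x \<in> Obj M"
  shows "(g \<cdot> f) \<uplus> Ide M x = (g \<uplus> Ide M x) \<cdot> (f \<uplus> Ide M x)"
  using SumA_Comp[OF assms(1,2) Ide_Hom[OF assms(3)] Ide_Hom[OF assms(3)]]
    Comp_Ide_left[OF Ide_Hom[OF assms(3)]] by simp

lemma SumA_Ide_left_Comp:
  assumes "f \<in> Hom M a b" "g \<in> Hom M b c" "x \<in> Obj M"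
  shows "Ide M x \<uplus> (g \<cdot> f) = (Ide M x \<uplus> g) \<cdot> (Ide M x \<uplus> f)"
  using SumA_Comp[OF Ide_Hom[OF assms(3)] Ide_Hom[OF assms(3)] assms(1,2)]
    Comp_Ide_left[OF Ide_Hom[OF assms(3)]] by simp

lemma slide:
  assumes f: "f \<in> Hom M a b" and g: "g \<in> Hom M c d"
  shows "(f \<uplus> Ide M d) \<cdot> (Ide M a \<uplus> g) = f \<uplus> g"
    and "(Ide M b \<uplus> g) \<cdot> (f \<uplus> Ide M c) = f \<uplus> g"
proof -
  have o: "a \<in> Obj M" "b \<in> Obj M" "c \<in> Obj M" "d \<in> Obj M" using HomD[OF f] HomD[OF g] by auto
  show "(f \<uplus> Ide M d) \<cdot> (Ide M a \<uplus> g) = f \<uplus> g"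
    using SumA_Comp[OF Ide_Hom[OF o(1)] f g Ide_Hom[OF o(4)]] Comp_Ide_left[OF g] Comp_Ide_right[OF f] by simp
  show "(Ide M b \<uplus> g) \<cdot> (f \<uplus> Ide M c) = f \<uplus> g"
    using SumA_Comp[OF f Ide_Hom[OF o(2)] Ide_Hom[OF o(3)] g] Comp_Ide_left[OF f] Comp_Ide_right[OF g] by simp
qed

lemma SumA_Ide_Ide: "x \<in> Obj M \<Longrightarrow> y \<in> Obj M \<Longrightarrow> f \<in> Arr M \<Longrightarrow>
    Ide M (x \<oplus> y) \<uplus> f = Ide M x \<uplus> (Ide M y \<uplus> f)"
  using SumA_assoc[of "Ide M x" "Ide M y" f] HomA[OF Ide_Hom] by (simp add: SumA_Ide)

lemma SumA_Ide_Ide_right: "x \<in> Obj M \<Longrightarrow> y \<in> Obj M \<Longrightarrow> f \<in> Arr M \<Longrightarrow>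
    f \<uplus> Ide M (x \<oplus> y) = (f \<uplus> Ide M x) \<uplus> Ide M y"
  using SumA_assoc[of f "Ide M x" "Ide M y"] HomA[OF Ide_Hom] by (simp add: SumA_Ide)

lemma Sym_Unit_left: "x \<in> Obj M \<Longrightarrow> Sym M (Unit M) x = Ide M x"
  using Sym_involutive[of "Unit M" x] Sym_Unit[of x] Unit_closed SumO_Unit_left[of x] SumO_Unit_right[of x]
    Comp_Ide_left Sym_Hom[of "Unit M" x] by metis

text \<open>The axiom decomposes a symmetry with a sum in the first place. Inverting all arrows in
  its instance for \<open>y\<close>, \<open>z\<close>, \<open>x\<close> yields the version with the
  sum in the second place.\<close>

lemma Sym_hexagon':
  assumes x: "x \<in> Obj M" and y: "y \<in> Obj M" and z: "z \<in> Obj M"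
  shows "Sym M x (y \<oplus> z) = (Ide M y \<uplus> Sym M x z) \<cdot> (Sym M x y \<uplus> Ide M z)"
proof -
  define A1 A2 R1 R2 where "A1 = Sym M y x \<uplus> Ide M z" and "A2 = Ide M y \<uplus> Sym M z x"
    and "R1 = Ide M y \<uplus> Sym M x z" and "R2 = Sym M x y \<uplus> Ide M z"
  have A1: "A1 \<in> Hom M (y \<oplus> x \<oplus> z) (x \<oplus> y \<oplus> z)" and A2: "A2 \<in> Hom M (y \<oplus> z \<oplus> x) (y \<oplus> x \<oplus> z)"
    and R1: "R1 \<in> Hom M (y \<oplus> x \<oplus> z) (y \<oplus> z \<oplus> x)" and R2: "R2 \<in> Hom M (x \<oplus> y \<oplus> z) (y \<oplus> x \<oplus> z)"
    unfolding A1_def A2_def R1_def R2_def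
    using SumA_Hom[OF Sym_Hom[OF y x] Ide_Hom[OF z]] SumA_Hom[OF Ide_Hom[OF y] Sym_Hom[OF z x]]
      SumA_Hom[OF Ide_Hom[OF y] Sym_Hom[OF x z]] SumA_Hom[OF Sym_Hom[OF x y] Ide_Hom[OF z]]
    by (simp_all add: SumO_assoc x y z)
  have "A2 \<cdot> R1 = Ide M (y \<oplus> x \<oplus> z)"
    unfolding A2_def R1_def
    using SumA_Ide_left_Comp[OF Sym_Hom[OF x z] Sym_Hom[OF z x] y] Sym_involutive[OF x z]
    by (simp add: SumA_Ide x y z SumO_closed)
  moreover have "A1 \<cdot> R2 = Ide M (x \<oplus> y \<oplus> z)"
    unfolding A1_def R2_def
    using SumA_Ide_right_Comp[OF Sym_Hom[OF x y] Sym_Hom[OF y x] z] Sym_involutive[OF x y]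
    by (simp add: SumA_Ide x y z SumO_closed SumO_assoc)
  ultimately have "(A1 \<cdot> A2) \<cdot> (R1 \<cdot> R2) = Ide M (x \<oplus> y \<oplus> z)"
    using Comp_assoc[OF Comp_Hom[OF R2 R1] A2 A1] Comp_assoc[OF R2 R1 A2] Comp_Ide_left[OF R2] by simp
  moreover have "Sym M (y \<oplus> z) x = A1 \<cdot> A2"
    unfolding A1_def A2_def by (rule Sym_hexagon[OF y z x])
  moreover have "Sym M x (y \<oplus> z) \<cdot> Sym M (y \<oplus> z) x = Ide M (y \<oplus> z \<oplus> x)"
    using Sym_involutive[of "y \<oplus> z" x] x y z by (simp add: SumO_closed SumO_assoc)
  moreover have S: "Sym M x (y \<oplus> z) \<in> Hom M (x \<oplus> y \<oplus> z) (y \<oplus> z \<oplus> x)"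
    using Sym_Hom[of x "y \<oplus> z"] x y z by (simp add: SumO_closed SumO_assoc)
  ultimately have "Sym M x (y \<oplus> z) = R1 \<cdot> R2"
    using Comp_assoc[OF Comp_Hom[OF R2 R1] Comp_Hom[OF A2 A1] S] Comp_Ide_left[OF Comp_Hom[OF R2 R1]]
      Comp_Ide_right[OF S] by simp
  then show ?thesis by (simp add: R1_def R2_def)
qed

section \<open>Arrows of \<open>tilde M\<close> and their representatives\<close>

definition tcl :: "'o \<Rightarrow> 'o \<Rightarrow> 'o \<times> 'a \<Rightarrow> ('o \<times> 'a) set" where
  "tcl a b p = colim_class M (\<lambda>t. Hom M a (b \<oplus> t)) (\<lambda>h f. (Ide M b \<uplus> h) \<cdot> f) p"

lemma tclass_tcl: "tclass M a b t f = (a, b, tcl a b (t, f))"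
  by (simp add: tclass_def tcl_def)

lemma act_Hom: "\<lbrakk>b \<in> Obj M; f \<in> Hom M a (b \<oplus> t); h \<in> Hom M t t'\<rbrakk> \<Longrightarrow> (Ide M b \<uplus> h) \<cdot> f \<in> Hom M a (b \<oplus> t')"
  using Comp_Hom[OF _ SumA_Hom[OF Ide_Hom]] by blast

lemma tclass_step:
  assumes "f \<in> Hom M a (b \<oplus> t)" "h \<in> Hom M t t'"
  shows "tclass M a b t f = tclass M a b t' ((Ide M b \<uplus> h) \<cdot> f)"
  unfolding tclass_def using HomD[OF assms(2)] assms
  by (simp add: colim_class_step[where X = "\<lambda>t. Hom M a (b \<oplus> t)" and act = "\<lambda>h f. (Ide M b \<uplus> h) \<cdot> f"])

lemma tcl_invariant:
  assumes "\<And>s t x h. \<lbrakk>s \<in> Obj M; t \<in> Obj M; h \<in> Hom M s t; x \<in> Hom M a (b \<oplus> s)\<rbrakk> \<Longrightarrow>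
      Q s x = Q t ((Ide M b \<uplus> h) \<cdot> x)"
    and "(t', f') \<in> tcl a b (t, f)"
  shows "Q t' f' = Q t f"
  using colim_class_invariant[of M "\<lambda>t. Hom M a (b \<oplus> t)" "\<lambda>p. Q (fst p) (snd p)", OF _ assms(2)[unfolded tcl_def]]
    assms(1) by simp

text \<open>Classes are formed for arbitrary pairs, so their members are not well-typed by
  definition. Being well-typed is itself a truth-valued function compatible with the generating
  steps, hence constant on the class.\<close>

lemma tcl_Hom:
  assumes "b \<in> Obj M" "t \<in> Obj M" "f \<in> Hom M a (b \<oplus> t)" "(t', f') \<in> tcl a b (t, f)"
  shows "t' \<in> Obj M" "f' \<in> Hom M a (b \<oplus> t')"
proof -
  have "(t' \<in> Obj M \<and> f' \<in> Hom M a (b \<oplus> t')) = (t \<in> Obj M \<and> f \<in> Hom M a (b \<oplus> t))"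
    by (rule tcl_invariant[OF _ assms(4)]) (use act_Hom[OF assms(1)] in auto)
  then show "t' \<in> Obj M" "f' \<in> Hom M a (b \<oplus> t')" using assms by auto
qed

lemma tcl_self: "(t, f) \<in> tcl a b (t, f)"
  by (simp add: tcl_def colim_class_self)

lemma tilde_simps [simp]:
  "Obj (tilde M) = Obj M"
  "Dom (tilde M) (a, b, c) = a"
  "Cod (tilde M) (a, b, c) = b"
  "Ide (tilde M) a = tclass M a a (Unit M) (Ide M a)"
  "Comp (tilde M) = tComp M"
  "SumO (tilde M) = SumO M"
  "SumA (tilde M) = tSum M"
  "Unit (tilde M) = Unit M"
  by (simp_all add: tilde_def)

lemma tilde_Hom_iff:
  "F \<in> Hom (tilde M) a b \<longleftrightarrow> a \<in> Obj M \<and> b \<in> Obj M \<and>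
     (\<exists>t \<in> Obj M. \<exists>f \<in> Hom M a (b \<oplus> t). F = tclass M a b t f)"
proof -
  have "Arr (tilde M) = (\<Union>a \<in> Obj M. \<Union>b \<in> Obj M. tHom M a b)" by (simp add: tilde_def)
  moreover have "F \<in> tHom M a b \<longleftrightarrow> (\<exists>t \<in> Obj M. \<exists>f \<in> Hom M a (b \<oplus> t). F = tclass M a b t f)" for a b
    by (auto simp: tHom_def colim_set_def tclass_def)
  ultimately have "F \<in> Arr (tilde M) \<longleftrightarrow>
      (\<exists>a \<in> Obj M. \<exists>b \<in> Obj M. \<exists>t \<in> Obj M. \<exists>f \<in> Hom M a (b \<oplus> t). F = tclass M a b t f)"
    by simp
  then show ?thesis unfolding Hom_def[of "tilde M"]
    by (cases F) (simp add: tclass_tcl, blast)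
qed

lemma tilde_HomE:
  assumes "F \<in> Hom (tilde M) a b"
  obtains t f where "a \<in> Obj M" "b \<in> Obj M" "t \<in> Obj M" "f \<in> Hom M a (b \<oplus> t)" "F = tclass M a b t f"
  using assms tilde_Hom_iff by blast

lemma tclass_Hom: "\<lbrakk>b \<in> Obj M; t \<in> Obj M; f \<in> Hom M a (b \<oplus> t)\<rbrakk> \<Longrightarrow> tclass M a b t f \<in> Hom (tilde M) a b"
  unfolding tilde_Hom_iff using HomD by blast

lemma tcomp_Hom:
  assumes "c \<in> Obj M" "u \<in> Obj M" "t \<in> Obj M" "g \<in> Hom M b (c \<oplus> u)" "f \<in> Hom M a (b \<oplus> t)"
  shows "(g \<uplus> Ide M t) \<cdot> f \<in> Hom M a (c \<oplus> (u \<oplus> t))"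
  using Comp_Hom[OF assms(5) SumA_Hom[OF assms(4) Ide_Hom[OF assms(3)]]] assms by (simp add: SumO_assoc)

text \<open>Changing the representative of either arrow changes the composite only by an arrow
  acting on the discarded object \<open>u \<oplus> t\<close>. For the inner arrow this uses the
  interchange law, which carries \<open>h\<close> across \<open>g\<close>.\<close>

lemma tComp_tclass:
  assumes b: "b \<in> Obj M" and c: "c \<in> Obj M" and u: "u \<in> Obj M" and t: "t \<in> Obj M"
    and g: "g \<in> Hom M b (c \<oplus> u)" and f: "f \<in> Hom M a (b \<oplus> t)"
  shows "tComp M (tclass M b c u g) (tclass M a b t f) = tclass M a c (u \<oplus> t) ((g \<uplus> Ide M t) \<cdot> f)"
proof -
  have 1: "tclass M a c (u \<oplus> s) ((g \<uplus> Ide M s) \<cdot> x) = tclass M a c (u \<oplus> s') ((g \<uplus> Ide M s') \<cdot> ((Ide M b \<uplus> h) \<cdot> x))"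
    if "s \<in> Obj M" "s' \<in> Obj M" "h \<in> Hom M s s'" "x \<in> Hom M a (b \<oplus> s)" "u \<in> Obj M" "g \<in> Hom M b (c \<oplus> u)"
    for s s' x h u g
  proof -
    have uh: "Ide M u \<uplus> h \<in> Hom M (u \<oplus> s) (u \<oplus> s')" using SumA_Hom[OF Ide_Hom[OF that(5)] that(3)] .
    note gs = SumA_Hom[OF that(6) Ide_Hom[OF that(1)]] and gs' = SumA_Hom[OF that(6) Ide_Hom[OF that(2)]]
      and bh = SumA_Hom[OF Ide_Hom[OF b] that(3)]
    have cuh: "Ide M c \<uplus> (Ide M u \<uplus> h) \<in> Hom M ((c \<oplus> u) \<oplus> s) ((c \<oplus> u) \<oplus> s')"
      using SumA_Hom[OF Ide_Hom[OF c] uh] by (simp add: SumO_assoc c that)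
    have "(Ide M c \<uplus> (Ide M u \<uplus> h)) \<cdot> ((g \<uplus> Ide M s) \<cdot> x) = ((Ide M (c \<oplus> u) \<uplus> h) \<cdot> (g \<uplus> Ide M s)) \<cdot> x"
      using Comp_assoc[OF that(4) gs cuh] by (simp add: SumA_Ide_Ide c that HomA[OF that(3)])
    also have "\<dots> = ((g \<uplus> Ide M s') \<cdot> (Ide M b \<uplus> h)) \<cdot> x" by (simp add: slide[OF that(6) that(3)])
    also have "\<dots> = (g \<uplus> Ide M s') \<cdot> ((Ide M b \<uplus> h) \<cdot> x)" by (rule Comp_assoc[OF that(4) bh gs'])
    finally show ?thesis using tclass_step[OF tcomp_Hom[OF c that(5,1,6,4)] uh] by simp
  qed
  have 2: "tclass M a c (s \<oplus> t) ((g \<uplus> Ide M t) \<cdot> f) = tclass M a c (s' \<oplus> t) ((((Ide M c \<uplus> h) \<cdot> g) \<uplus> Ide M t) \<cdot> f)"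
    if "s \<in> Obj M" "s' \<in> Obj M" "h \<in> Hom M s s'" "g \<in> Hom M b (c \<oplus> s)" "t \<in> Obj M" "f \<in> Hom M a (b \<oplus> t)" for s s' h g t f
  proof -
    have ht: "h \<uplus> Ide M t \<in> Hom M (s \<oplus> t) (s' \<oplus> t)" using SumA_Hom[OF that(3) Ide_Hom[OF that(5)]] .
    note gt = SumA_Hom[OF that(4) Ide_Hom[OF that(5)]] and ch = SumA_Hom[OF Ide_Hom[OF c] that(3)]
    have "(Ide M c \<uplus> (h \<uplus> Ide M t)) \<cdot> ((g \<uplus> Ide M t) \<cdot> f) = (((Ide M c \<uplus> h) \<uplus> Ide M t) \<cdot> (g \<uplus> Ide M t)) \<cdot> f"
      using Comp_assoc[OF that(6) gt SumA_Hom[OF ch Ide_Hom[OF that(5)]]]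
      by (simp add: SumA_assoc HomA[OF Ide_Hom] HomA[OF that(3)] c that)
    also have "\<dots> = (((Ide M c \<uplus> h) \<cdot> g) \<uplus> Ide M t) \<cdot> f"
      by (simp add: SumA_Ide_right_Comp[OF that(4) ch that(5)])
    finally show ?thesis using tclass_step[OF tcomp_Hom[OF c that(1) that(5) that(4) that(6)] ht] by simp
  qed
  have "{tclass M a c (u' \<oplus> t') ((g' \<uplus> Ide M t') \<cdot> f') | u' g' t' f'. (u', g') \<in> tcl b c (u, g) \<and> (t', f') \<in> tcl a b (t, f)}
      = {tclass M a c (u \<oplus> t) ((g \<uplus> Ide M t) \<cdot> f)}" (is "?S = _")
  proof -
    have "tclass M a c (u' \<oplus> t') ((g' \<uplus> Ide M t') \<cdot> f') = tclass M a c (u \<oplus> t) ((g \<uplus> Ide M t) \<cdot> f)"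
      if g': "(u', g') \<in> tcl b c (u, g)" and f': "(t', f') \<in> tcl a b (t, f)" for u' g' t' f'
    proof -
      have "tclass M a c (u' \<oplus> t') ((g' \<uplus> Ide M t') \<cdot> f') = tclass M a c (u' \<oplus> t) ((g' \<uplus> Ide M t) \<cdot> f)"
        by (rule tcl_invariant[OF 1 f']) (use tcl_Hom[OF c u g g'] in auto)
      also have "\<dots> = tclass M a c (u \<oplus> t) ((g \<uplus> Ide M t) \<cdot> f)"
        by (rule tcl_invariant[OF 2 g']) (use t f in auto)
      finally show ?thesis .
    qed
    then show ?thesis
      by (rule Collect_constant[where P = "\<lambda>u' g'. (u', g') \<in> tcl b c (u, g)"
            and Q = "\<lambda>t' f'. (t', f') \<in> tcl a b (t, f)", OF _ tcl_self tcl_self])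
  qed
  then show ?thesis by (simp add: tComp_def tclass_tcl)
qed

text \<open>As \<open>M\<close> is strict, the discarded objects on the two sides of each law are
  equal, and the laws are checked on representatives in \<open>M\<close> without any identification
  in the colimit.\<close>

lemma tilde_category: "category (tilde M)"
proof (unfold_locales, goal_cases)
  case (1 f) then show ?case by (auto simp: tilde_def tHom_def)
next
  case (2 f) then show ?case by (auto simp: tilde_def tHom_def)
next
  case (3 a) then show ?case using tclass_Hom[of a "Unit M" "Ide M a" a] Ide_Hom[of a] Unit_closed
    by (simp add: SumO_Unit_right)
next
  case (4 f a b g c)
  from 4(1) show ?case
  proof (rule tilde_HomE)
    fix t f' assume f: "a \<in> Obj M" "b \<in> Obj M" "t \<in> Obj M" "f' \<in> Hom M a (b \<oplus> t)" "f = tclass M a b t f'"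
    from 4(2) show ?thesis
    proof (rule tilde_HomE)
      fix u g' assume g: "c \<in> Obj M" "u \<in> Obj M" "g' \<in> Hom M b (c \<oplus> u)" "g = tclass M b c u g'"
      show ?thesis
        using f g tclass_Hom[OF _ SumO_closed tcomp_Hom] by (simp add: tComp_tclass)
    qed
  qed
next
  case (5 f a b)
  then show ?case
  proof (rule tilde_HomE)
    fix t f' assume f: "a \<in> Obj M" "b \<in> Obj M" "t \<in> Obj M" "f' \<in> Hom M a (b \<oplus> t)" "f = tclass M a b t f'"
    then show ?thesis
      using tComp_tclass[OF f(1,2,3) Unit_closed f(4), of "Ide M a" a] Ide_Hom[OF f(1)]
      by (simp add: SumO_Unit_right SumA_Unit_right HomA[OF f(4)] Comp_Ide_right)
  qed
next
  case (6 f a b)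
  then show ?case
  proof (rule tilde_HomE)
    fix t f' assume f: "a \<in> Obj M" "b \<in> Obj M" "t \<in> Obj M" "f' \<in> Hom M a (b \<oplus> t)" "f = tclass M a b t f'"
    then show ?thesis
      using tComp_tclass[OF f(2,2) Unit_closed f(3) _ f(4), of "Ide M b"] Ide_Hom[OF f(2)]
      by (simp add: SumO_Unit_right SumO_Unit_left SumA_Ide Comp_Ide_left)
  qed
next
  case (7 f a b g c h d)
  from 7(1) show ?case
  proof (rule tilde_HomE)
    fix t f' assume f: "a \<in> Obj M" "b \<in> Obj M" "t \<in> Obj M" "f' \<in> Hom M a (b \<oplus> t)" "f = tclass M a b t f'"
    from 7(2) show ?thesis
    proof (rule tilde_HomE)
      fix u g' assume g: "c \<in> Obj M" "u \<in> Obj M" "g' \<in> Hom M b (c \<oplus> u)" "g = tclass M b c u g'"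
      from 7(3) show ?thesis
      proof (rule tilde_HomE)
        fix v h' assume h: "d \<in> Obj M" "v \<in> Obj M" "h' \<in> Hom M c (d \<oplus> v)" "h = tclass M c d v h'"
        have hu: "h' \<uplus> Ide M u \<in> Hom M (c \<oplus> u) ((d \<oplus> v) \<oplus> u)" using SumA_Hom[OF h(3) Ide_Hom[OF g(2)]] .
        have "(h' \<uplus> Ide M (u \<oplus> t)) \<cdot> ((g' \<uplus> Ide M t) \<cdot> f') = ((h' \<uplus> Ide M (u \<oplus> t)) \<cdot> (g' \<uplus> Ide M t)) \<cdot> f'"
          using Comp_assoc[OF f(4) SumA_Hom[OF g(3) Ide_Hom[OF f(3)]], of "h' \<uplus> Ide M (u \<oplus> t)" "(d \<oplus> v) \<oplus> (u \<oplus> t)"]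
            SumA_Hom[OF h(3) Ide_Hom[OF SumO_closed[OF g(2) f(3)]]] f g h by (simp add: SumO_assoc SumO_closed)
        also have "(h' \<uplus> Ide M (u \<oplus> t)) \<cdot> (g' \<uplus> Ide M t) = ((h' \<uplus> Ide M u) \<cdot> g') \<uplus> Ide M t"
          using SumA_Ide_right_Comp[OF g(3) hu f(3)] by (simp add: SumA_Ide_Ide_right[OF g(2) f(3) HomA[OF h(3)]])
        finally have "(h' \<uplus> Ide M (u \<oplus> t)) \<cdot> ((g' \<uplus> Ide M t) \<cdot> f') = (((h' \<uplus> Ide M u) \<cdot> g') \<uplus> Ide M t) \<cdot> f'" .
        then show ?thesis
          using f g h tComp_tclass tcomp_Hom by (simp add: SumO_closed SumO_assoc)
      qed
    qed
  qed
qed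

text \<open>An arrow \<open>h\<close> acting on a discarded object has to be carried across the
  symmetry in the middle. Naturality of the symmetry does this for the first argument, the
  interchange law for the second.\<close>

lemma tSum_tclass:
  assumes a: "a \<in> Obj M" and b: "b \<in> Obj M" and t: "t \<in> Obj M" and f: "f \<in> Hom M a (b \<oplus> t)"
    and a': "a' \<in> Obj M" and b': "b' \<in> Obj M" and t': "t' \<in> Obj M" and f': "f' \<in> Hom M a' (b' \<oplus> t')"
  shows "tSum M (tclass M a b t f) (tclass M a' b' t' f')
    = tclass M (a \<oplus> a') (b \<oplus> b') (t \<oplus> t') ((Ide M b \<uplus> Sym M t b' \<uplus> Ide M t') \<cdot> (f \<uplus> f'))"
proof -
  define s where "s t f t' f' = (Ide M b \<uplus> Sym M t b' \<uplus> Ide M t') \<cdot> (f \<uplus> f')" for t f t' f'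
  have mid: "Ide M b \<uplus> Sym M t b' \<uplus> Ide M t' \<in> Hom M ((b \<oplus> t) \<oplus> (b' \<oplus> t')) ((b \<oplus> b') \<oplus> (t \<oplus> t'))"
    if "t \<in> Obj M" "t' \<in> Obj M" for t t'
    using SumA_Hom[OF Ide_Hom[OF b] SumA_Hom[OF Sym_Hom[OF that(1) b'] Ide_Hom[OF that(2)]]] that b b'
    by (simp add: SumO_assoc SumO_closed)
  have sH: "s t f t' f' \<in> Hom M (a \<oplus> a') ((b \<oplus> b') \<oplus> (t \<oplus> t'))"
    if "t \<in> Obj M" "t' \<in> Obj M" "f \<in> Hom M a (b \<oplus> t)" "f' \<in> Hom M a' (b' \<oplus> t')" for t f t' f'
    unfolding s_def by (rule Comp_Hom[OF SumA_Hom[OF that(3,4)] mid[OF that(1,2)]])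
  have 1: "tclass M (a \<oplus> a') (b \<oplus> b') (t \<oplus> t') (s t f t' f')
      = tclass M (a \<oplus> a') (b \<oplus> b') (u \<oplus> t') (s u ((Ide M b \<uplus> h) \<cdot> f) t' f')"
    if t: "t \<in> Obj M" and u: "u \<in> Obj M" and h: "h \<in> Hom M t u" and f: "f \<in> Hom M a (b \<oplus> t)"
      and t': "t' \<in> Obj M" and f': "f' \<in> Hom M a' (b' \<oplus> t')" for t u h f t' f'
  proof -
    have ht: "h \<uplus> Ide M t' \<in> Hom M (t \<oplus> t') (u \<oplus> t')" using SumA_Hom[OF h Ide_Hom[OF t']] .
    note arr = HomA[OF h] HomA[OF Ide_Hom] HomA[OF Sym_Hom]
    have hb: "h \<uplus> Ide M b' \<in> Hom M (t \<oplus> b') (u \<oplus> b')" and bh: "Ide M b' \<uplus> h \<in> Hom M (b' \<oplus> t) (b' \<oplus> u)"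
      using SumA_Hom[OF h Ide_Hom[OF b']] SumA_Hom[OF Ide_Hom[OF b'] h] by auto
    have X: "Ide M b \<uplus> (h \<uplus> Ide M b') \<uplus> Ide M t' = (Ide M b \<uplus> h) \<uplus> Ide M (b' \<oplus> t')"
      using b b' t' arr HomA[OF SumA_Hom[OF Ide_Hom[OF b'] Ide_Hom[OF t']]]
      by (simp add: SumA_assoc flip: SumA_Ide)
    have Y: "Ide M b \<uplus> (Ide M b' \<uplus> h) \<uplus> Ide M t' = Ide M (b \<oplus> b') \<uplus> (h \<uplus> Ide M t')"
      using b b' t' arr HomA[OF ht] by (simp add: SumA_assoc SumA_Ide_Ide)
    have "s u ((Ide M b \<uplus> h) \<cdot> f) t' f'
        = (Ide M b \<uplus> Sym M u b' \<uplus> Ide M t') \<cdot> (((Ide M b \<uplus> h) \<uplus> Ide M (b' \<oplus> t')) \<cdot> (f \<uplus> f'))"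
      unfolding s_def
      using SumA_Comp[OF f SumA_Hom[OF Ide_Hom[OF b] h] f' Ide_Hom[OF SumO_closed[OF b' t']]] Comp_Ide_left[OF f']
      by simp
    also have "\<dots> = ((Ide M b \<uplus> Sym M u b' \<uplus> Ide M t') \<cdot> (Ide M b \<uplus> (h \<uplus> Ide M b') \<uplus> Ide M t')) \<cdot> (f \<uplus> f')"
      unfolding X
      using Comp_assoc[OF SumA_Hom[OF f f'] SumA_Hom[OF SumA_Hom[OF Ide_Hom[OF b] h] Ide_Hom[OF SumO_closed[OF b' t']]] mid[OF u t']]
      by simp
    also have "(Ide M b \<uplus> Sym M u b' \<uplus> Ide M t') \<cdot> (Ide M b \<uplus> (h \<uplus> Ide M b') \<uplus> Ide M t')
        = Ide M b \<uplus> ((Sym M u b' \<cdot> (h \<uplus> Ide M b')) \<uplus> Ide M t')"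
      using SumA_Ide_left_Comp[OF SumA_Hom[OF hb Ide_Hom[OF t']] SumA_Hom[OF Sym_Hom[OF u b'] Ide_Hom[OF t']] b]
        SumA_Ide_right_Comp[OF hb Sym_Hom[OF u b'] t'] by simp
    also have "Sym M u b' \<cdot> (h \<uplus> Ide M b') = (Ide M b' \<uplus> h) \<cdot> Sym M t b'"
      by (rule Sym_natural[OF h Ide_Hom[OF b']])
    also have "Ide M b \<uplus> (((Ide M b' \<uplus> h) \<cdot> Sym M t b') \<uplus> Ide M t')
        = (Ide M b \<uplus> (Ide M b' \<uplus> h) \<uplus> Ide M t') \<cdot> (Ide M b \<uplus> Sym M t b' \<uplus> Ide M t')"
      using SumA_Ide_left_Comp[OF SumA_Hom[OF Sym_Hom[OF t b'] Ide_Hom[OF t']] SumA_Hom[OF bh Ide_Hom[OF t']] b]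
        SumA_Ide_right_Comp[OF Sym_Hom[OF t b'] bh t'] by simp
    also have "\<dots> \<cdot> (f \<uplus> f') = (Ide M (b \<oplus> b') \<uplus> (h \<uplus> Ide M t')) \<cdot> s t f t' f'"
      unfolding Y s_def
      by (rule Comp_assoc[OF SumA_Hom[OF f f'] mid[OF t t'] SumA_Hom[OF Ide_Hom[OF SumO_closed[OF b b']] ht]])
    finally show ?thesis using tclass_step[OF sH[OF t t' f f'] ht] by simp
  qed
  have 2: "tclass M (a \<oplus> a') (b \<oplus> b') (t \<oplus> t') (s t f t' f')
      = tclass M (a \<oplus> a') (b \<oplus> b') (t \<oplus> u') (s t f u' ((Ide M b' \<uplus> h) \<cdot> f'))"
    if t': "t' \<in> Obj M" and u': "u' \<in> Obj M" and h: "h \<in> Hom M t' u'" and f': "f' \<in> Hom M a' (b' \<oplus> t')"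
      and t: "t \<in> Obj M" and f: "f \<in> Hom M a (b \<oplus> t)" for t' u' h f' t f
  proof -
    have th: "Ide M t \<uplus> h \<in> Hom M (t \<oplus> t') (t \<oplus> u')" using SumA_Hom[OF Ide_Hom[OF t] h] .
    note arr = HomA[OF h] HomA[OF Ide_Hom] HomA[OF Sym_Hom]
    have b'h: "Ide M b' \<uplus> h \<in> Hom M (b' \<oplus> t') (b' \<oplus> u')" using SumA_Hom[OF Ide_Hom[OF b'] h] .
    have X: "Ide M (b \<oplus> t) \<uplus> (Ide M b' \<uplus> h) = Ide M b \<uplus> (Ide M (t \<oplus> b') \<uplus> h)"
      using b b' t arr HomA[OF b'h] by (simp add: SumA_Ide_Ide)
    have Y: "Ide M b \<uplus> (Ide M (b' \<oplus> t) \<uplus> h) = Ide M (b \<oplus> b') \<uplus> (Ide M t \<uplus> h)"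
      using b b' t arr HomA[OF th] by (simp add: SumA_Ide_Ide)
    have "s t f u' ((Ide M b' \<uplus> h) \<cdot> f')
        = (Ide M b \<uplus> Sym M t b' \<uplus> Ide M u') \<cdot> ((Ide M (b \<oplus> t) \<uplus> (Ide M b' \<uplus> h)) \<cdot> (f \<uplus> f'))"
      unfolding s_def
      using SumA_Comp[OF f Ide_Hom[OF SumO_closed[OF b t]] f' b'h] Comp_Ide_left[OF f] by simp
    also have "\<dots> = ((Ide M b \<uplus> Sym M t b' \<uplus> Ide M u') \<cdot> (Ide M b \<uplus> (Ide M (t \<oplus> b') \<uplus> h))) \<cdot> (f \<uplus> f')"
      using Comp_assoc[OF SumA_Hom[OF f f'] SumA_Hom[OF Ide_Hom[OF SumO_closed[OF b t]] b'h] mid[OF t u']]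
      unfolding X by simp
    also have "(Ide M b \<uplus> Sym M t b' \<uplus> Ide M u') \<cdot> (Ide M b \<uplus> (Ide M (t \<oplus> b') \<uplus> h))
       = Ide M b \<uplus> (Sym M t b' \<uplus> h)"
      using SumA_Ide_left_Comp[OF SumA_Hom[OF Ide_Hom[OF SumO_closed[OF t b']] h] SumA_Hom[OF Sym_Hom[OF t b'] Ide_Hom[OF u']] b]
        slide(1)[OF Sym_Hom[OF t b'] h] by simp
    also have "\<dots> = (Ide M b \<uplus> (Ide M (b' \<oplus> t) \<uplus> h)) \<cdot> (Ide M b \<uplus> Sym M t b' \<uplus> Ide M t')"
      using SumA_Ide_left_Comp[OF SumA_Hom[OF Sym_Hom[OF t b'] Ide_Hom[OF t']] SumA_Hom[OF Ide_Hom[OF SumO_closed[OF b' t]] h] b]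
        slide(2)[OF Sym_Hom[OF t b'] h] by simp
    also have "\<dots> \<cdot> (f \<uplus> f') = (Ide M (b \<oplus> b') \<uplus> (Ide M t \<uplus> h)) \<cdot> s t f t' f'"
      unfolding Y s_def
      by (rule Comp_assoc[OF SumA_Hom[OF f f'] mid[OF t t'] SumA_Hom[OF Ide_Hom[OF SumO_closed[OF b b']] th]])
    finally show ?thesis using tclass_step[OF sH[OF t t' f f'] th] by simp
  qed
  have "{tclass M (a \<oplus> a') (b \<oplus> b') (u \<oplus> u') (s u g u' g') | u g u' g'. (u, g) \<in> tcl a b (t, f) \<and> (u', g') \<in> tcl a' b' (t', f')}
      = {tclass M (a \<oplus> a') (b \<oplus> b') (t \<oplus> t') (s t f t' f')}"
  proof -
    have "tclass M (a \<oplus> a') (b \<oplus> b') (u \<oplus> u') (s u g u' g') = tclass M (a \<oplus> a') (b \<oplus> b') (t \<oplus> t') (s t f t' f')"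
      if g: "(u, g) \<in> tcl a b (t, f)" and g': "(u', g') \<in> tcl a' b' (t', f')" for u g u' g'
    proof -
      have "tclass M (a \<oplus> a') (b \<oplus> b') (u \<oplus> u') (s u g u' g') = tclass M (a \<oplus> a') (b \<oplus> b') (t \<oplus> u') (s t f u' g')"
        by (rule tcl_invariant[OF 1 g]) (use tcl_Hom[OF b' t' f' g'] in auto)
      also have "\<dots> = tclass M (a \<oplus> a') (b \<oplus> b') (t \<oplus> t') (s t f t' f')"
        by (rule tcl_invariant[OF 2 g']) (use t f in auto)
      finally show ?thesis .
    qed
    then show ?thesis
      by (rule Collect_constant[where P = "\<lambda>u g. (u, g) \<in> tcl a b (t, f)"
            and Q = "\<lambda>u' g'. (u', g') \<in> tcl a' b' (t', f')", OF _ tcl_self tcl_self])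
  qed
  then show ?thesis by (simp add: tSum_def tclass_tcl s_def)
qed

section \<open>The image of \<open>M\<close> in \<open>tilde M\<close>, and shifts\<close>

abbreviation eta :: "'a \<Rightarrow> ('o, 'a) tarrow" where
  "eta f \<equiv> tclass M (Dom M f) (Cod M f) (Unit M) f"

lemma eta_Hom: "f \<in> Hom M a b \<Longrightarrow> eta f \<in> Hom (tilde M) a b"
  using tclass_Hom[OF _ Unit_closed] HomD[of f a b] by (simp add: SumO_Unit_right)

lemma eta_Comp_tclass:
  assumes "b \<in> Obj M" "t \<in> Obj M" "g \<in> Hom M b c" "f \<in> Hom M a (b \<oplus> t)"
  shows "tComp M (eta g) (tclass M a b t f) = tclass M a c t ((g \<uplus> Ide M t) \<cdot> f)"
  using tComp_tclass[OF assms(1) HomD(5)[OF assms(3)] Unit_closed assms(2) _ assms(4), of g] assms HomD[OF assms(3)]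
  by (simp add: SumO_Unit_right SumO_Unit_left)

lemma tclass_Comp_eta:
  assumes "c \<in> Obj M" "u \<in> Obj M" "g \<in> Hom M b (c \<oplus> u)" "f \<in> Hom M a b"
  shows "tComp M (tclass M b c u g) (eta f) = tclass M a c u (g \<cdot> f)"
  using tComp_tclass[OF HomD(5)[OF assms(4)] assms(1,2) Unit_closed assms(3), of f a] assms HomD[OF assms(4)]
  by (simp add: SumO_Unit_right SumA_Unit_right HomA[OF assms(3)])

text \<open>The symmetry in the definition of the sum is here the one between the unit and
  \<open>b\<close>, that is, an identity; the discarded object \<open>t\<close> stays the
  same.\<close>

lemma tSum_Ide_tclass:
  assumes x: "x \<in> Obj M" and "b \<in> Obj M" "t \<in> Obj M" and f: "f \<in> Hom M a (b \<oplus> t)"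
  shows "tSum M (tclass M x x (Unit M) (Ide M x)) (tclass M a b t f) = tclass M (x \<oplus> a) (x \<oplus> b) t (Ide M x \<uplus> f)"
  using tSum_tclass[OF x x Unit_closed _ HomD(4)[OF f] assms(2-4), of "Ide M x"] assms Ide_Hom[OF x]
    Comp_Ide_left[OF SumA_Hom[OF Ide_Hom[OF x] f]]
  by (simp add: SumO_Unit_right SumO_Unit_left Sym_Unit_left SumA_Ide SumO_closed)

lemma tSum_eta:
  assumes f: "f \<in> Hom M a b" and g: "g \<in> Hom M c d"
  shows "tSum M (eta f) (eta g) = tclass M (a \<oplus> c) (b \<oplus> d) (Unit M) (f \<uplus> g)"
  using tSum_tclass[of a b "Unit M" f c d "Unit M" g] HomD[OF f] HomD[OF g] f g Unit_closed
    Comp_Ide_left[OF SumA_Hom[OF f g]]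
  by (simp add: SumO_Unit_right Sym_Unit_left SumA_Ide)

lemma tilde_shift_Hom:
  assumes x: "x \<in> Obj M" and f: "f \<in> Hom (tilde M) a b"
  shows "tSum M (tclass M x x (Unit M) (Ide M x)) f \<in> Hom (tilde M) (x \<oplus> a) (x \<oplus> b)"
  using f
proof (rule tilde_HomE)
  fix t f' assume f: "a \<in> Obj M" "b \<in> Obj M" "t \<in> Obj M" "f' \<in> Hom M a (b \<oplus> t)" "f = tclass M a b t f'"
  show ?thesis
    using tclass_Hom[of "x \<oplus> b" t "Ide M x \<uplus> f'" "x \<oplus> a"] SumA_Hom[OF Ide_Hom[OF x] f(4)] f x
    by (simp add: tSum_Ide_tclass SumO_closed SumO_assoc)
qed

end

section \<open>Monoidal functors and retracts\<close>

context Mon_ini begin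

lemma from_Unit_Hom: "x \<in> Obj M \<Longrightarrow> from_Unit M x \<in> Hom M (Unit M) x"
  unfolding from_Unit_def by (rule theI') (use Unit_initial in \<open>simp add: initial_object_def\<close>)

lemma from_Unit_eq: "f \<in> Hom M (Unit M) x \<Longrightarrow> f = from_Unit M x"
  using Unit_initial from_Unit_Hom[of x] HomD(5)[of f "Unit M" x] unfolding initial_object_def by blast

lemma from_Unit_Ide_Hom:
  "x \<in> Obj M \<Longrightarrow> y \<in> Obj M \<Longrightarrow> from_Unit M x \<uplus> Ide M y \<in> Hom M y (x \<oplus> y)"
  using SumA_Hom[OF from_Unit_Hom Ide_Hom] by (simp add: SumO_Unit_left)

lemma Comp_from_Unit: "f \<in> Hom M x y \<Longrightarrow> f \<cdot> from_Unit M x = from_Unit M y"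
  using from_Unit_eq Comp_Hom[OF from_Unit_Hom] HomD(4) by metis

lemma from_Unit_Ide_nat:
  assumes x: "x \<in> Obj M" and f: "f \<in> Hom M a b"
  shows "(Ide M x \<uplus> f) \<cdot> (from_Unit M x \<uplus> Ide M a) = (from_Unit M x \<uplus> Ide M b) \<cdot> f"
  using slide[OF from_Unit_Hom[OF x] f] by (simp add: SumA_Unit_left HomA[OF f])

text \<open>An arrow of \<open>M\<close> from the unit to \<open>x \<oplus> t\<close> is unique, so
  it arises from the arrow to \<open>x\<close> by letting \<open>0 -> t\<close> act on the discarded
  object, and it represents the same class.\<close>

lemma from_Unit_tilde:
  assumes x: "x \<in> Obj M"
  shows "from_Unit (tilde M) x = tclass M (Unit M) x (Unit M) (from_Unit M x)"
proof -
  have fH: "from_Unit M x \<in> Hom M (Unit M) (x \<oplus> Unit M)" using from_Unit_Hom[OF x] by (simp add: SumO_Unit_right x)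
  have "F = tclass M (Unit M) x (Unit M) (from_Unit M x)" if F: "F \<in> Hom (tilde M) (Unit M) x" for F
    using F
  proof (rule tilde_HomE)
    fix t f assume f: "t \<in> Obj M" "f \<in> Hom M (Unit M) (x \<oplus> t)" "F = tclass M (Unit M) x t f"
    have "f = (Ide M x \<uplus> from_Unit M t) \<cdot> from_Unit M x"
      using from_Unit_eq[OF f(2)] from_Unit_eq[OF act_Hom[OF x fH from_Unit_Hom[OF f(1)]]] by simp
    then show ?thesis using tclass_step[OF fH from_Unit_Hom[OF f(1)]] f(3) by simp
  qed
  moreover have "tclass M (Unit M) x (Unit M) (from_Unit M x) \<in> Hom (tilde M) (Unit M) x"
    using tclass_Hom[OF x Unit_closed fH] .
  ultimately show ?thesis unfolding from_Unit_def[of "tilde M"] tilde_simps by (rule the_equality[rotated])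
qed

lemma tilde_inc:
  assumes x: "x \<in> Obj M" and y: "y \<in> Obj M"
  shows "tSum M (from_Unit (tilde M) x) (tclass M y y (Unit M) (Ide M y))
    = tclass M y (x \<oplus> y) (Unit M) (from_Unit M x \<uplus> Ide M y)"
  using tSum_eta[OF from_Unit_Hom[OF x] Ide_Hom[OF y]]
  by (simp add: from_Unit_tilde[OF x] HomD[OF from_Unit_Hom[OF x]] HomD[OF Ide_Hom[OF y]] SumO_Unit_left y)

text \<open>The retraction \<open>x \<oplus> y -> y\<close> is represented by the symmetry, which
  moves \<open>x\<close> to the place where it is discarded.\<close>

lemma tilde_shift_category:
  "shift_category (tilde M) (\<lambda>x y. tclass M (x \<oplus> y) y x (Sym M x y))"
proof -
  interpret T: category "tilde M" by (rule tilde_category)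
  show ?thesis
  proof (unfold_locales, unfold tilde_simps, goal_cases)
    case (1 x y) then show ?case by (rule SumO_closed)
  next
    case (2 x f a b) then show ?case by (rule tilde_shift_Hom)
  next
    case (3 x y)
    then show ?case
      using tSum_eta[OF Ide_Hom[OF 3(1)] Ide_Hom[OF 3(2)]] by (simp add: HomD[OF Ide_Hom] SumA_Ide)
  next
    case (4 x f a b g c)
    note x = 4(1)
    from 4(2) show ?case
    proof (rule tilde_HomE)
      fix t f' assume f: "a \<in> Obj M" "b \<in> Obj M" "t \<in> Obj M" "f' \<in> Hom M a (b \<oplus> t)" "f = tclass M a b t f'"
      from 4(3) show ?thesis
      proof (rule tilde_HomE)
        fix u g' assume g: "c \<in> Obj M" "u \<in> Obj M" "g' \<in> Hom M b (c \<oplus> u)" "g = tclass M b c u g'"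
        have xf: "Ide M x \<uplus> f' \<in> Hom M (x \<oplus> a) ((x \<oplus> b) \<oplus> t)" and xg: "Ide M x \<uplus> g' \<in> Hom M (x \<oplus> b) ((x \<oplus> c) \<oplus> u)"
          using SumA_Hom[OF Ide_Hom[OF x] f(4)] SumA_Hom[OF Ide_Hom[OF x] g(3)] x f g by (simp_all add: SumO_assoc)
        have "Ide M x \<uplus> ((g' \<uplus> Ide M t) \<cdot> f') = ((Ide M x \<uplus> g') \<uplus> Ide M t) \<cdot> (Ide M x \<uplus> f')"
          using SumA_Ide_left_Comp[OF f(4) SumA_Hom[OF g(3) Ide_Hom[OF f(3)]] x]
          by (simp add: SumA_assoc HomA[OF Ide_Hom] x f HomA[OF g(3)])
        then show ?thesis
          using tComp_tclass[OF SumO_closed[OF x f(2)] SumO_closed[OF x g(1)] g(2) f(3) xg xf]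
          by (simp add: f(5) g(4) tComp_tclass[OF f(2) g(1) g(2) f(3) g(3) f(4)]
              tSum_Ide_tclass[OF x g(1) SumO_closed[OF g(2) f(3)] tcomp_Hom[OF g(1,2) f(3) g(3) f(4)]]
              tSum_Ide_tclass[OF x f(2,3,4)] tSum_Ide_tclass[OF x g(1,2,3)])
      qed
    qed
  next
    case (5 x y)
    then show ?case
      using tclass_Hom[OF SumO_closed[OF 5] Unit_closed, of "from_Unit M x \<uplus> Ide M y" y] from_Unit_Ide_Hom[OF 5]
      by (simp add: tilde_inc SumO_Unit_right SumO_closed)
  next
    case (6 x f a b)
    from 6(2) show ?case
    proof (rule tilde_HomE)
      fix t f' assume f: "a \<in> Obj M" "b \<in> Obj M" "t \<in> Obj M" "f' \<in> Hom M a (b \<oplus> t)" "f = tclass M a b t f'"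
      note x = 6(1)
      have xf: "Ide M x \<uplus> f' \<in> Hom M (x \<oplus> a) ((x \<oplus> b) \<oplus> t)"
        using SumA_Hom[OF Ide_Hom[OF x] f(4)] x f by (simp add: SumO_assoc)
      have e: "from_Unit M x \<uplus> Ide M (b \<oplus> t) = (from_Unit M x \<uplus> Ide M b) \<uplus> Ide M t"
        using SumA_Ide_Ide_right f HomA[OF from_Unit_Hom[OF x]] by simp
      show ?thesis
        using tclass_Comp_eta[OF SumO_closed[OF x f(2)] f(3) xf from_Unit_Ide_Hom[OF x f(1)]]
          eta_Comp_tclass[OF f(2,3) from_Unit_Ide_Hom[OF x f(2)] f(4)] from_Unit_Ide_nat[OF x f(4)]
        by (simp add: f(5) tSum_Ide_tclass[OF x f(2,3,4)] tilde_inc x f(1,2) e HomD[OF from_Unit_Ide_Hom])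
    qed
  next
    case (7 x y)
    then show ?case using tclass_Hom[OF 7(2,1) Sym_Hom] by simp
  next
    case (8 x f a b)
    from 8(2) show ?case
    proof (rule tilde_HomE)
      fix t f' assume f: "a \<in> Obj M" "b \<in> Obj M" "t \<in> Obj M" "f' \<in> Hom M a (b \<oplus> t)" "f = tclass M a b t f'"
      note x = 8(1)
      have xf: "Ide M x \<uplus> f' \<in> Hom M (x \<oplus> a) ((x \<oplus> b) \<oplus> t)"
        using SumA_Hom[OF Ide_Hom[OF x] f(4)] x f by (simp add: SumO_assoc)
      note S1 = SumA_Hom[OF Sym_Hom[OF x f(2)] Ide_Hom[OF f(3)]] and S2 = SumA_Hom[OF Ide_Hom[OF f(2)] Sym_Hom[OF x f(3)]]
      have H: "(Sym M x b \<uplus> Ide M t) \<cdot> (Ide M x \<uplus> f') \<in> Hom M (x \<oplus> a) (b \<oplus> (x \<oplus> t))"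
        using Comp_Hom[OF xf S1] x f by (simp add: SumO_assoc)
      \<comment> \<open>Naturality of the retraction uses an identification in the colimit: the two
        composites discard \<open>x \<oplus> t\<close> and \<open>t \<oplus> x\<close>, and by the
        hexagon the symmetry between these objects carries one representative to the other.\<close>
      have "(Ide M b \<uplus> Sym M x t) \<cdot> ((Sym M x b \<uplus> Ide M t) \<cdot> (Ide M x \<uplus> f')) = Sym M x (b \<oplus> t) \<cdot> (Ide M x \<uplus> f')"
        using Comp_assoc[OF xf S1, of "Ide M b \<uplus> Sym M x t"] S2 Sym_hexagon'[OF x f(2,3)] x f by (simp add: SumO_assoc)
      also have "\<dots> = (f' \<uplus> Ide M x) \<cdot> Sym M x a" by (rule Sym_natural[OF Ide_Hom[OF x] f(4)])
      finally have "tclass M (x \<oplus> a) b (x \<oplus> t) ((Sym M x b \<uplus> Ide M t) \<cdot> (Ide M x \<uplus> f'))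
          = tclass M (x \<oplus> a) b (t \<oplus> x) ((f' \<uplus> Ide M x) \<cdot> Sym M x a)"
        using tclass_step[OF H Sym_Hom[OF x f(3)]] by simp
      then show ?thesis
        using tComp_tclass[OF SumO_closed[OF x f(2)] f(2) x f(3) Sym_Hom[OF x f(2)] xf]
          tComp_tclass[OF f(1,2,3) x f(4) Sym_Hom[OF x f(1)]]
        by (simp add: f(5) tSum_Ide_tclass[OF x f(2,3,4)])
    qed
  next
    case (9 x y)
    note x = 9(1) and y = 9(2)
    have IH: "Ide M y \<in> Hom M y (y \<oplus> Unit M)" using Ide_Hom[OF y] by (simp add: SumO_Unit_right y)
    \<comment> \<open>The composite of inclusion and retraction is represented by the canonical
      arrow \<open>y -> y \<oplus> x\<close>, which the arrow \<open>0 -> x\<close> produces from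
      the identity.\<close>
    have "Sym M x y \<cdot> (from_Unit M x \<uplus> Ide M y) = (Ide M y \<uplus> from_Unit M x) \<cdot> Ide M y"
      using Sym_natural[OF from_Unit_Hom[OF x] Ide_Hom[OF y]] by (simp add: Sym_Unit_left y)
    then have "tclass M y y x (Sym M x y \<cdot> (from_Unit M x \<uplus> Ide M y)) = tclass M y y (Unit M) (Ide M y)"
      using tclass_step[OF IH from_Unit_Hom[OF x]] by simp
    then show ?case
      using tclass_Comp_eta[OF y x Sym_Hom[OF x y] from_Unit_Ide_Hom[OF x y]]
      by (simp add: tilde_inc x y HomD[OF from_Unit_Ide_Hom])
  qed
qed

end

section \<open>Projections from a sum when the unit is null\<close>

sublocale Mon_nul \<subseteq> Mon_ini
  using Unit_null by unfold_locales (simp add: null_object_def)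

context Mon_nul begin

lemma to_Unit_Hom: "x \<in> Obj M \<Longrightarrow> to_Unit M x \<in> Hom M x (Unit M)"
  unfolding to_Unit_def
  by (rule theI') (use Unit_null in \<open>simp add: null_object_def terminal_object_def\<close>)

lemma to_Unit_eq: "f \<in> Hom M x (Unit M) \<Longrightarrow> f = to_Unit M x"
  using Unit_null to_Unit_Hom[of x] HomD(4)[of f x "Unit M"]
  unfolding null_object_def terminal_object_def by blast

lemma to_Unit_Comp: "f \<in> Hom M x y \<Longrightarrow> to_Unit M y \<cdot> f = to_Unit M x"
  using to_Unit_eq Comp_Hom[OF _ to_Unit_Hom] HomD(5) by metis

lemma proj1_Hom: "x \<in> Obj M \<Longrightarrow> y \<in> Obj M \<Longrightarrow> proj1 M x y \<in> Hom M (x \<oplus> y) x"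
  unfolding proj1_def using SumA_Hom[OF Ide_Hom to_Unit_Hom] by (simp add: SumO_Unit_right)

lemma proj2_Hom: "x \<in> Obj M \<Longrightarrow> y \<in> Obj M \<Longrightarrow> proj2 M x y \<in> Hom M (x \<oplus> y) y"
  unfolding proj2_def using SumA_Hom[OF to_Unit_Hom Ide_Hom] by (simp add: SumO_Unit_left)

lemma proj1_nat:
  assumes f: "f \<in> Hom M a b" and g: "g \<in> Hom M c d"
  shows "proj1 M b d \<cdot> (f \<uplus> g) = f \<cdot> proj1 M a c"
proof -
  have o: "a \<in> Obj M" "b \<in> Obj M" "c \<in> Obj M" "d \<in> Obj M" using HomD[OF f] HomD[OF g] by auto
  have "proj1 M b d \<cdot> (f \<uplus> g) = f \<uplus> to_Unit M c"
    unfolding proj1_def using SumA_Comp[OF f Ide_Hom[OF o(2)] g to_Unit_Hom[OF o(4)]]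
    by (simp add: Comp_Ide_left[OF f] to_Unit_Comp[OF g])
  also have "\<dots> = f \<cdot> proj1 M a c"
    unfolding proj1_def using slide(1)[OF f to_Unit_Hom[OF o(3)]] by (simp add: SumA_Unit_right HomA[OF f])
  finally show ?thesis .
qed

lemma proj2_nat:
  assumes f: "f \<in> Hom M a b" and g: "g \<in> Hom M c d"
  shows "proj2 M b d \<cdot> (f \<uplus> g) = g \<cdot> proj2 M a c"
proof -
  have o: "a \<in> Obj M" "b \<in> Obj M" "c \<in> Obj M" "d \<in> Obj M" using HomD[OF f] HomD[OF g] by auto
  have "proj2 M b d \<cdot> (f \<uplus> g) = to_Unit M a \<uplus> g"
    unfolding proj2_def using SumA_Comp[OF f to_Unit_Hom[OF o(2)] g Ide_Hom[OF o(4)]]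
    by (simp add: Comp_Ide_left[OF g] to_Unit_Comp[OF f])
  also have "\<dots> = g \<cdot> proj2 M a c"
    unfolding proj2_def using slide(2)[OF to_Unit_Hom[OF o(1)] g] by (simp add: SumA_Unit_left HomA[OF g])
  finally show ?thesis .
qed

lemma proj1_Sym: "x \<in> Obj M \<Longrightarrow> y \<in> Obj M \<Longrightarrow> proj1 M y x \<cdot> Sym M x y = proj2 M x y"
  unfolding proj1_def proj2_def
  using Sym_natural[OF to_Unit_Hom Ide_Hom, of x y] Comp_Ide_left[OF proj2_Hom[of x y]]
  by (simp add: Sym_Unit_left proj2_def)

lemma proj2_Sym: "x \<in> Obj M \<Longrightarrow> y \<in> Obj M \<Longrightarrow> proj2 M y x \<cdot> Sym M x y = proj1 M x y"
  unfolding proj1_def proj2_def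
  using Sym_natural[OF Ide_Hom to_Unit_Hom, of x y] Comp_Ide_left[OF proj1_Hom[of x y]]
  by (simp add: Sym_Unit proj1_def)

lemma proj1_assoc: "x \<in> Obj M \<Longrightarrow> y \<in> Obj M \<Longrightarrow> z \<in> Obj M \<Longrightarrow> proj1 M (x \<oplus> y) z = Ide M x \<uplus> proj1 M y z"
  unfolding proj1_def using SumA_Ide_Ide HomA[OF to_Unit_Hom] by simp

lemma proj1_proj1:
  assumes "x \<in> Obj M" "y \<in> Obj M" "z \<in> Obj M"
  shows "proj1 M x y \<cdot> proj1 M (x \<oplus> y) z = proj1 M x (y \<oplus> z)"
proof -
  have "proj1 M x y \<cdot> (Ide M x \<uplus> proj1 M y z) = Ide M x \<uplus> (to_Unit M y \<cdot> proj1 M y z)"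
    unfolding proj1_def[of M x y]
    using SumA_Ide_left_Comp[OF proj1_Hom[OF assms(2,3)] to_Unit_Hom[OF assms(2)] assms(1)] by simp
  also have "to_Unit M y \<cdot> proj1 M y z = to_Unit M (y \<oplus> z)"
    using to_Unit_Comp[OF proj1_Hom[OF assms(2,3)]] .
  finally show ?thesis by (simp add: proj1_assoc assms proj1_def[of M x "y \<oplus> z"])
qed

lemma nul_shift_category: "shift_category M (proj2 M)"
proof (unfold_locales, goal_cases)
  case (2 x f a b) then show ?case using SumA_Hom Ide_Hom by blast
next
  case (4 x f a b g c) then show ?case using SumA_Ide_left_Comp by blast
next
  case (8 x f a b) then show ?case using proj2_nat Ide_Hom by blast
next
  case (9 x y)
  have "to_Unit M x \<cdot> from_Unit M x = Ide M (Unit M)"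
    using to_Unit_eq[OF Comp_Hom[OF from_Unit_Hom[OF 9(1)] to_Unit_Hom[OF 9(1)]]] to_Unit_eq[OF Ide_Hom[OF Unit_closed]]
    by simp
  then show ?case
    using SumA_Comp[OF from_Unit_Hom[OF 9(1)] to_Unit_Hom[OF 9(1)] Ide_Hom[OF 9(2)] Ide_Hom[OF 9(2)]]
    by (simp add: proj2_def Comp_Ide_left[OF Ide_Hom[OF 9(2)]] SumA_Unit_left HomA[OF Ide_Hom[OF 9(2)]])
qed (simp_all add: SumO_closed SumA_Ide from_Unit_Ide_Hom from_Unit_Ide_nat proj2_Hom)

end

section \<open>Vanishing along functors that preserve shifts\<close>

locale shift_morphism =
  N: shift_functors N pr B zer sub + N': shift_functors N' pr' B zer sub
  for N :: "('o, 'a, 'z) smcat_scheme" and pr and N' :: "('r, 'd, 'w) smcat_scheme" and pr'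
  and B :: "('p, 'b, 'y) cat_scheme" and zer and sub +
  fixes K :: "('o, 'a, 'r, 'd) functr"
  assumes K: "is_functor N N' K"
    and K_SumO: "\<lbrakk>x \<in> Obj N; y \<in> Obj N\<rbrakk> \<Longrightarrow> FO K (x \<oplus>\<^bsub>N\<^esub> y) = FO K x \<oplus>\<^bsub>N'\<^esub> FO K y"
    and K_shift: "\<lbrakk>x \<in> Obj N; f \<in> Hom N a b\<rbrakk> \<Longrightarrow>
      FA K (Ide N x \<uplus>\<^bsub>N\<^esub> f) = Ide N' (FO K x) \<uplus>\<^bsub>N'\<^esub> FA K f"
    and K_inc: "\<lbrakk>x \<in> Obj N; y \<in> Obj N\<rbrakk> \<Longrightarrow> FA K (N.inc x y) = N'.inc (FO K x) (FO K y)"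
    and K_pr: "\<lbrakk>x \<in> Obj N; y \<in> Obj N\<rbrakk> \<Longrightarrow> FA K (pr x y) = pr' (FO K x) (FO K y)"
begin

lemma shift_functor_comp:
  assumes x: "x \<in> Obj N"
  shows "shift N x (functor_comp N F K) = functor_comp N (shift N' (FO K x) F) K"
proof -
  have "FO (shift N x (functor_comp N F K)) = FO (functor_comp N (shift N' (FO K x) F) K)"
    using x by (auto simp: shift_def functor_comp_def fun_eq_iff N.SumO_Obj K_SumO functor_Obj[OF K])
  moreover have "FA (shift N x (functor_comp N F K)) = FA (functor_comp N (shift N' (FO K x) F) K)"
  proof
    fix f show "FA (shift N x (functor_comp N F K)) f = FA (functor_comp N (shift N' (FO K x) F) K) f"
    proof (cases "f \<in> Arr N")
      case True
      then have f: "f \<in> Hom N (Dom N f) (Cod N f)" by (rule N.Hom_DomI)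
      show ?thesis
        using f functor_Hom[OF K f] N.shift_Hom[OF x f] by (simp add: K_shift[OF x f])
    next
      case False then show ?thesis by (simp add: shift_def functor_comp_def)
    qed
  qed
  ultimately show ?thesis by (simp add: functr.equality)
qed

lemma red_functor_comp:
  assumes x: "x \<in> Obj N" and y: "y \<in> Obj N"
  shows "N.red x (functor_comp N F K) y = N'.red (FO K x) F (FO K y)"
  using N.inc_Hom[OF x y] N.pr_Hom[OF x y] N.SumO_Obj[OF x y]
  by (simp add: N.red_def N'.red_def K_SumO K_inc K_pr x y)

text \<open>Sums are preserved strictly, so shifting a composite with \<open>K\<close> equals, and
  is not just isomorphic to, composing a shift with \<open>K\<close>; the recursion therefore runs
  in parallel on both sides. Composites with \<open>K\<close> see only objects in its image, whence
  the new test set.\<close>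

lemma vanishes_functor_comp:
  assumes S: "S \<subseteq> Obj N"
  shows "N.vanishes S k (functor_comp N F K) (\<lambda>y. \<theta> (FO K y)) \<longleftrightarrow> N'.vanishes (FO K ` S) k F \<theta>"
proof (induction k arbitrary: F \<theta>)
  case (Suc k)
  have "N.vanishes S k (shift N x (functor_comp N F K)) (\<lambda>y. \<theta> (FO K (x \<oplus>\<^bsub>N\<^esub> y)) \<cdot>\<^bsub>B\<^esub> N.red x (functor_comp N F K) y)
     \<longleftrightarrow> N'.vanishes (FO K ` S) k (shift N' (FO K x) F) (\<lambda>y. \<theta> (FO K x \<oplus>\<^bsub>N'\<^esub> y) \<cdot>\<^bsub>B\<^esub> N'.red (FO K x) F y)"
    if "x \<in> S" for x
  proof -
    have x: "x \<in> Obj N" using S that by auto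
    show ?thesis
      unfolding shift_functor_comp[OF x] Suc.IH[symmetric]
      by (rule N.vanishes_cong[OF S]) (simp add: K_SumO red_functor_comp x)
  qed
  then show ?case by simp
qed simp

end

section \<open>Testing the vanishing up to retracts\<close>

locale shift_functors_nul = Mon_nul A + B: difference_category B zer sub
  for A :: "('o, 'a, 'z) smcat_scheme" (structure)
  and B :: "('p, 'b, 'y) cat_scheme" and zer and sub

sublocale shift_functors_nul \<subseteq> shift_functors A "proj2 A" B zer sub
  by (intro shift_functors.intro nul_shift_category B.difference_category_axioms)

context shift_functors_nul begin

lemma SumA_Ide_natural:
  assumes F: "is_functor A B F" and s: "s \<in> Hom A x m"
  shows "natural_transformation A B (shift A x F) (shift A m F) (\<lambda>y. FA F (s \<uplus> Ide A y))"
proof (rule natural_transformationI)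
  note o = HomD[OF s]
  show "FA F (s \<uplus> Ide A y) \<in> Hom B (FO (shift A x F) y) (FO (shift A m F) y)" if "y \<in> Obj A" for y
    using functor_Hom[OF F SumA_Hom[OF s Ide_Hom[OF that]]] that by simp
  fix f a b assume f: "f \<in> Hom A a b"
  note p = HomD[OF f]
  show "FA (shift A m F) f \<cdot>\<^bsub>B\<^esub> FA F (s \<uplus> Ide A a) = FA F (s \<uplus> Ide A b) \<cdot>\<^bsub>B\<^esub> FA (shift A x F) f"
    using slide[OF s f] f
      functor_Comp[OF F SumA_Hom[OF s Ide_Hom[OF p(4)]] SumA_Hom[OF Ide_Hom[OF o(5)] f]]
      functor_Comp[OF F SumA_Hom[OF Ide_Hom[OF o(4)] f] SumA_Hom[OF s Ide_Hom[OF p(5)]]]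
    by simp
qed

text \<open>An arrow \<open>s\<close> between the first summands respects the inclusion and the
  projection of the second one, because arrows from and to the unit are unique.\<close>

lemma red_SumA_Ide:
  assumes F: "is_functor A B F" and s: "s \<in> Hom A x m" and y: "y \<in> Obj A"
  shows "red m F y \<cdot>\<^bsub>B\<^esub> FA F (s \<uplus> Ide A y) = FA F (s \<uplus> Ide A y) \<cdot>\<^bsub>B\<^esub> red x F y"
proof -
  note x = HomD(4)[OF s] and m = HomD(5)[OF s]
  note sy = SumA_Hom[OF s Ide_Hom[OF y]]
  note Fs = functor_Hom[OF F sy]
  have "(s \<uplus> Ide A y) \<cdot> inc x y = inc m y"
    using SumA_Comp[OF from_Unit_Hom[OF x] s Ide_Hom[OF y] Ide_Hom[OF y]] Comp_from_Unit[OF s]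
    by (simp add: Comp_Ide_left[OF Ide_Hom[OF y]])
  then have 1: "FA F (s \<uplus> Ide A y) \<cdot>\<^bsub>B\<^esub> FA F (inc x y) = FA F (inc m y)"
    using functor_Comp[OF F inc_Hom[OF x y] sy] by simp
  have "proj2 A m y \<cdot> (s \<uplus> Ide A y) = proj2 A x y"
    using proj2_nat[OF s Ide_Hom[OF y]] Comp_Ide_left[OF proj2_Hom[OF x y]] by simp
  then have 2: "FA F (proj2 A m y) \<cdot>\<^bsub>B\<^esub> FA F (s \<uplus> Ide A y) = FA F (proj2 A x y)"
    using functor_Comp[OF F sy proj2_Hom[OF m y]] by simp
  show ?thesis by (simp add: red_Comp[OF F m y Fs] Comp_red[OF F x y Fs] 1 2)
qed

text \<open>If \<open>x\<close> is a retract of \<open>m\<close>, the family belonging to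
  \<open>x\<close> is the one belonging to \<open>m\<close> composed with
  \<open>F(s \<oplus> y)\<close> on the right and \<open>F'(r \<oplus> y)\<close> on the left; so
  each entry may be taken from \<open>S\<close>. Naturality of \<open>\<theta>\<close> serves to
  exchange \<open>s\<close> with \<open>\<theta>\<close>, at the final object \<open>w\<close> as
  well, and is inherited by the family of the next step.\<close>

lemma vanishes_retracts:
  assumes S: "S \<subseteq> Obj A"
    and retr: "\<And>a. a \<in> Obj A \<Longrightarrow> \<exists>m \<in> S. \<exists>s \<in> Hom A a m. \<exists>r \<in> Hom A m a. r \<cdot> s = Ide A a"
    and "is_functor A B F" "is_functor A B F'" "natural_transformation A B F F' \<theta>"
    and "vanishes S k F \<theta>"
  shows "vanishes (Obj A) k F \<theta>"
  using assms(3-6)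
proof (induction k arbitrary: F F' \<theta>)
  case 0
  have "zero_arrow B (\<theta> a)" if a: "a \<in> Obj A" for a
  proof -
    obtain m s r where m: "m \<in> S" and s: "s \<in> Hom A a m" and r: "r \<in> Hom A m a" and rs: "r \<cdot> s = Ide A a"
      using retr[OF a] by blast
    have mo: "m \<in> Obj A" using m S by auto
    note \<theta>H = natural_transformation_Hom[OF 0(3)]
    have z: "\<theta> m = zer (FO F m) (FO F' m)" using 0(4) m B.zero_arrow_iff[OF \<theta>H[OF mo]] by simp
    have "\<theta> a = (FA F' r \<cdot>\<^bsub>B\<^esub> FA F' s) \<cdot>\<^bsub>B\<^esub> \<theta> a"
      using functor_Comp[OF 0(2) s r] rs functor_Ide[OF 0(2) a] B.Comp_Ide_left[OF \<theta>H[OF a]] by simp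
    also have "\<dots> = FA F' r \<cdot>\<^bsub>B\<^esub> (\<theta> m \<cdot>\<^bsub>B\<^esub> FA F s)"
      using B.Comp_assoc[OF \<theta>H[OF a] functor_Hom[OF 0(2) s] functor_Hom[OF 0(2) r]]
        natural_transformation_nat[OF 0(3) s] by simp
    also have "\<dots> = zer (FO F a) (FO F' a)"
      using B.Comp_zer_left[OF functor_Hom[OF 0(1) s] functor_Obj[OF 0(2) mo]]
        B.Comp_zer_right[OF functor_Hom[OF 0(2) r] functor_Obj[OF 0(1) a]] by (simp add: z)
    finally show ?thesis using B.zero_arrow_iff[OF \<theta>H[OF a]] by simp
  qed
  then show ?case by simp
next
  case (Suc k)
  note F = Suc.prems(1) and F' = Suc.prems(2) and \<theta> = Suc.prems(3)
  have "vanishes (Obj A) k (shift A x F) (\<lambda>y. \<theta> (x \<oplus> y) \<cdot>\<^bsub>B\<^esub> red x F y)" if x: "x \<in> Obj A" for x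
  proof -
    obtain m s r where mS: "m \<in> S" and s: "s \<in> Hom A x m" and r: "r \<in> Hom A m x" and rs: "r \<cdot> s = Ide A x"
      using retr[OF x] by blast
    have m: "m \<in> Obj A" using mS S by auto
    note mF = shift_functor[OF m F] and mF' = shift_functor[OF m F'] and xF = shift_functor[OF x F]
    define \<theta>m where "\<theta>m y = \<theta> (m \<oplus> y) \<cdot>\<^bsub>B\<^esub> red m F y" for y
    have \<theta>m: "natural_transformation A B (shift A m F) (shift A m F') \<theta>m"
      unfolding \<theta>m_def
      by (rule natural_transformation_Comp[OF mF mF mF' red_natural[OF F m] shift_natural_transformation[OF m \<theta>]])
    have "vanishes S k (shift A m F) \<theta>m" unfolding \<theta>m_def using Suc.prems(4) mS by simp
    then have v1: "vanishes (Obj A) k (shift A m F) \<theta>m" by (rule Suc.IH[OF mF mF' \<theta>m])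
    note sn = SumA_Ide_natural[OF F s] and rn = SumA_Ide_natural[OF F' r]
    have v2: "vanishes (Obj A) k (shift A x F) (\<lambda>y. \<theta>m y \<cdot>\<^bsub>B\<^esub> FA F (s \<uplus> Ide A y))"
      by (rule vanishes_Comp_right[OF subset_refl xF mF sn natural_transformation_Hom[OF \<theta>m] v1])
    have v3: "vanishes (Obj A) k (shift A x F) (\<lambda>y. FA F' (r \<uplus> Ide A y) \<cdot>\<^bsub>B\<^esub> (\<theta>m y \<cdot>\<^bsub>B\<^esub> FA F (s \<uplus> Ide A y)))"
      by (rule vanishes_Comp_left[OF subset_refl xF
            B.Comp_Hom[OF natural_transformation_Hom[OF sn] natural_transformation_Hom[OF \<theta>m]]
            natural_transformation_Hom[OF rn] v2])
    have "FA F' (r \<uplus> Ide A y) \<cdot>\<^bsub>B\<^esub> (\<theta>m y \<cdot>\<^bsub>B\<^esub> FA F (s \<uplus> Ide A y)) = \<theta> (x \<oplus> y) \<cdot>\<^bsub>B\<^esub> red x F y"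
      if y: "y \<in> Obj A" for y
    proof -
      note sy = SumA_Hom[OF s Ide_Hom[OF y]] and ry = SumA_Hom[OF r Ide_Hom[OF y]]
      note \<theta>x = natural_transformation_Hom[OF \<theta> SumO_Obj[OF x y]]
        and \<theta>my = natural_transformation_Hom[OF \<theta> SumO_Obj[OF m y]]
      note rx = red_Hom[OF F x y] and rm = red_Hom[OF F m y]
      have "\<theta>m y \<cdot>\<^bsub>B\<^esub> FA F (s \<uplus> Ide A y) = (\<theta> (m \<oplus> y) \<cdot>\<^bsub>B\<^esub> FA F (s \<uplus> Ide A y)) \<cdot>\<^bsub>B\<^esub> red x F y"
        unfolding \<theta>m_def
        using B.Comp_assoc[OF functor_Hom[OF F sy] rm \<theta>my] B.Comp_assoc[OF rx functor_Hom[OF F sy] \<theta>my]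
          red_SumA_Ide[OF F s y] by simp
      also have "\<dots> = FA F' (s \<uplus> Ide A y) \<cdot>\<^bsub>B\<^esub> (\<theta> (x \<oplus> y) \<cdot>\<^bsub>B\<^esub> red x F y)"
        using natural_transformation_nat[OF \<theta> sy] B.Comp_assoc[OF rx \<theta>x functor_Hom[OF F' sy]] by simp
      finally have "FA F' (r \<uplus> Ide A y) \<cdot>\<^bsub>B\<^esub> (\<theta>m y \<cdot>\<^bsub>B\<^esub> FA F (s \<uplus> Ide A y))
          = (FA F' (r \<uplus> Ide A y) \<cdot>\<^bsub>B\<^esub> FA F' (s \<uplus> Ide A y)) \<cdot>\<^bsub>B\<^esub> (\<theta> (x \<oplus> y) \<cdot>\<^bsub>B\<^esub> red x F y)"
        using B.Comp_assoc[OF B.Comp_Hom[OF rx \<theta>x] functor_Hom[OF F' sy] functor_Hom[OF F' ry]] by simp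
      also have "FA F' (r \<uplus> Ide A y) \<cdot>\<^bsub>B\<^esub> FA F' (s \<uplus> Ide A y) = Ide B (FO F' (x \<oplus> y))"
        using functor_Comp[OF F' sy ry] SumA_Ide_right_Comp[OF s r y] rs functor_Ide[OF F' SumO_Obj[OF x y]]
        by (simp add: SumA_Ide x y)
      finally show ?thesis using B.Comp_Ide_left[OF B.Comp_Hom[OF rx \<theta>x]] by simp
    qed
    then show ?thesis by (rule vanishes_cong[THEN iffD1, OF subset_refl _ v3])
  qed
  then show ?case by simp
qed

end

section \<open>Full functors that are surjective up to retracts\<close>

text \<open>Up to splitting idempotents, \<open>D\<close> is then the quotient of \<open>C\<close>
  that identifies parallel arrows with the same image under \<open>K\<close>.\<close>

locale dense_full_functor =
  fixes C :: "('o, 'a, 'z) cat_scheme" and D :: "('p, 'b, 'y) cat_scheme" and K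
  assumes K: "is_functor C D K"
    and full: "\<lbrakk>a \<in> Obj C; b \<in> Obj C; h \<in> Hom D (FO K a) (FO K b)\<rbrakk> \<Longrightarrow> \<exists>f \<in> Hom C a b. FA K f = h"
    and retract: "d \<in> Obj D \<Longrightarrow>
      \<exists>c \<in> Obj C. \<exists>s \<in> Hom D d (FO K c). \<exists>r \<in> Hom D (FO K c) d. r \<cdot>\<^bsub>D\<^esub> s = Ide D d"
begin

sublocale C: category C using functor_categories[OF K] by simp
sublocale D: category D using functor_categories[OF K] by simp

text \<open>The component at \<open>d\<close> is recovered from the one at \<open>K c\<close> as
  \<open>G r \<cdot> \<rho> \<cdot> F s\<close>, where \<open>d\<close> is a retract of
  \<open>K c\<close> with section \<open>s\<close> and retraction \<open>r\<close>.\<close>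

lemma natural_transformation_eq:
  assumes F: "is_functor D B F" and G: "is_functor D B G"
    and \<sigma>: "natural_transformation D B F G \<sigma>" and \<sigma>': "natural_transformation D B F G \<sigma>'"
    and eq: "\<And>c. c \<in> Obj C \<Longrightarrow> \<sigma> (FO K c) = \<sigma>' (FO K c)" and d: "d \<in> Obj D"
  shows "\<sigma> d = \<sigma>' d"
proof -
  interpret B: category B using functor_categories[OF F] by simp
  obtain c s r where c: "c \<in> Obj C" and s: "s \<in> Hom D d (FO K c)" and r: "r \<in> Hom D (FO K c) d"
    and rs: "r \<cdot>\<^bsub>D\<^esub> s = Ide D d"
    using retract[OF d] by blast
  have "\<rho> d = FA G r \<cdot>\<^bsub>B\<^esub> (\<rho> (FO K c) \<cdot>\<^bsub>B\<^esub> FA F s)" if \<rho>: "natural_transformation D B F G \<rho>" for \<rho>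
  proof -
    have "\<rho> d = (FA G r \<cdot>\<^bsub>B\<^esub> FA G s) \<cdot>\<^bsub>B\<^esub> \<rho> d"
      using functor_Comp[OF G s r] rs functor_Ide[OF G d] B.Comp_Ide_left[OF natural_transformation_Hom[OF \<rho> d]]
      by simp
    then show ?thesis
      using B.Comp_assoc[OF natural_transformation_Hom[OF \<rho> d] functor_Hom[OF G s] functor_Hom[OF G r]]
        natural_transformation_nat[OF \<rho> s] by simp
  qed
  from this[OF \<sigma>] this[OF \<sigma>'] show ?thesis using eq[OF c] by simp
qed

text \<open>The only possible component at \<open>d\<close> is
  \<open>G r \<cdot> \<tau> \<cdot> F s\<close>. By fullness \<open>\<tau>\<close> is natural for
  all arrows between image objects, in particular for \<open>s b \<cdot> f \<cdot> r a\<close>,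
  which gives naturality for \<open>f\<close>; at image objects the formula returns
  \<open>\<tau>\<close>.\<close>

lemma natural_transformation_extends:
  assumes F: "is_functor D B F" and G: "is_functor D B G"
    and \<tau>: "natural_transformation C B (functor_comp C F K) (functor_comp C G K) \<tau>"
  obtains \<sigma> where "natural_transformation D B F G \<sigma>" "\<And>c. c \<in> Obj C \<Longrightarrow> \<sigma> (FO K c) = \<tau> c"
proof -
  interpret B: category B using functor_categories[OF F] by simp
  obtain c s r where c: "\<And>d. d \<in> Obj D \<Longrightarrow> c d \<in> Obj C"
    and s: "\<And>d. d \<in> Obj D \<Longrightarrow> s d \<in> Hom D d (FO K (c d))"
    and r: "\<And>d. d \<in> Obj D \<Longrightarrow> r d \<in> Hom D (FO K (c d)) d"
    and rs: "\<And>d. d \<in> Obj D \<Longrightarrow> r d \<cdot>\<^bsub>D\<^esub> s d = Ide D d"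
    using retract by metis
  have \<tau>H: "\<tau> a \<in> Hom B (FO F (FO K a)) (FO G (FO K a))" if "a \<in> Obj C" for a
    using natural_transformation_Hom[OF \<tau> that] that by simp
  have \<tau>n: "FA G h \<cdot>\<^bsub>B\<^esub> \<tau> a = \<tau> b \<cdot>\<^bsub>B\<^esub> FA F h"
    if a: "a \<in> Obj C" and b: "b \<in> Obj C" and h: "h \<in> Hom D (FO K a) (FO K b)" for a b h
  proof -
    obtain l where l: "l \<in> Hom C a b" "FA K l = h" using full[OF a b h] by blast
    show ?thesis using natural_transformation_nat[OF \<tau> l(1)] l by simp
  qed
  define \<sigma> where "\<sigma> d = FA G (r d) \<cdot>\<^bsub>B\<^esub> (\<tau> (c d) \<cdot>\<^bsub>B\<^esub> FA F (s d))" for d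
  have \<tau>sH: "\<tau> (c d) \<cdot>\<^bsub>B\<^esub> FA F (s d) \<in> Hom B (FO F d) (FO G (FO K (c d)))" if "d \<in> Obj D" for d
    by (rule B.Comp_Hom[OF functor_Hom[OF F s[OF that]] \<tau>H[OF c[OF that]]])
  have \<sigma>H: "\<sigma> d \<in> Hom B (FO F d) (FO G d)" if "d \<in> Obj D" for d
    unfolding \<sigma>_def by (rule B.Comp_Hom[OF \<tau>sH[OF that] functor_Hom[OF G r[OF that]]])
  have "natural_transformation D B F G \<sigma>"
  proof (rule natural_transformationI[OF \<sigma>H])
    fix f a b assume f: "f \<in> Hom D a b"
    have a: "a \<in> Obj D" and b: "b \<in> Obj D" using D.HomD[OF f] by auto
    define h where "h = s b \<cdot>\<^bsub>D\<^esub> (f \<cdot>\<^bsub>D\<^esub> r a)"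
    have fr: "f \<cdot>\<^bsub>D\<^esub> r a \<in> Hom D (FO K (c a)) b" using D.Comp_Hom[OF r[OF a] f] .
    have h: "h \<in> Hom D (FO K (c a)) (FO K (c b))" unfolding h_def by (rule D.Comp_Hom[OF fr s[OF b]])
    have rh: "r b \<cdot>\<^bsub>D\<^esub> h = f \<cdot>\<^bsub>D\<^esub> r a"
      using D.Comp_assoc[OF fr s[OF b] r[OF b]] D.Comp_Ide_left[OF fr] by (simp add: h_def rs[OF b])
    have hs: "h \<cdot>\<^bsub>D\<^esub> s a = s b \<cdot>\<^bsub>D\<^esub> f"
      using D.Comp_assoc[OF s[OF a] fr s[OF b]] D.Comp_assoc[OF s[OF a] r[OF a] f] D.Comp_Ide_right[OF f]
      by (simp add: h_def rs[OF a])
    have "FA G f \<cdot>\<^bsub>B\<^esub> \<sigma> a = FA G (f \<cdot>\<^bsub>D\<^esub> r a) \<cdot>\<^bsub>B\<^esub> (\<tau> (c a) \<cdot>\<^bsub>B\<^esub> FA F (s a))"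
      unfolding \<sigma>_def using B.Comp_assoc[OF \<tau>sH[OF a] functor_Hom[OF G r[OF a]] functor_Hom[OF G f]]
        functor_Comp[OF G r[OF a] f] by simp
    also have "\<dots> = FA G (r b) \<cdot>\<^bsub>B\<^esub> ((FA G h \<cdot>\<^bsub>B\<^esub> \<tau> (c a)) \<cdot>\<^bsub>B\<^esub> FA F (s a))"
      using B.Comp_assoc[OF \<tau>sH[OF a] functor_Hom[OF G h] functor_Hom[OF G r[OF b]]]
        functor_Comp[OF G h r[OF b]] rh B.Comp_assoc[OF functor_Hom[OF F s[OF a]] \<tau>H[OF c[OF a]] functor_Hom[OF G h]]
      by simp
    also have "\<dots> = FA G (r b) \<cdot>\<^bsub>B\<^esub> (\<tau> (c b) \<cdot>\<^bsub>B\<^esub> FA F (s b \<cdot>\<^bsub>D\<^esub> f))"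
      using \<tau>n[OF c[OF a] c[OF b] h] B.Comp_assoc[OF functor_Hom[OF F s[OF a]] functor_Hom[OF F h] \<tau>H[OF c[OF b]]]
        functor_Comp[OF F s[OF a] h] hs by simp
    also have "\<dots> = \<sigma> b \<cdot>\<^bsub>B\<^esub> FA F f"
      unfolding \<sigma>_def
      using B.Comp_assoc[OF functor_Hom[OF F f] \<tau>sH[OF b] functor_Hom[OF G r[OF b]]]
        B.Comp_assoc[OF functor_Hom[OF F f] functor_Hom[OF F s[OF b]] \<tau>H[OF c[OF b]]] functor_Comp[OF F f s[OF b]]
      by simp
    finally show "FA G f \<cdot>\<^bsub>B\<^esub> \<sigma> a = \<sigma> b \<cdot>\<^bsub>B\<^esub> FA F f" .
  qed
  moreover have "\<sigma> (FO K a) = \<tau> a" if a: "a \<in> Obj C" for a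
  proof -
    have Ka: "FO K a \<in> Obj D" using functor_Obj[OF K a] .
    have "\<sigma> (FO K a) = FA G (r (FO K a)) \<cdot>\<^bsub>B\<^esub> (FA G (s (FO K a)) \<cdot>\<^bsub>B\<^esub> \<tau> a)"
      unfolding \<sigma>_def using \<tau>n[OF a c[OF Ka] s[OF Ka]] by simp
    also have "\<dots> = \<tau> a"
      using B.Comp_assoc[OF \<tau>H[OF a] functor_Hom[OF G s[OF Ka]] functor_Hom[OF G r[OF Ka]]]
        functor_Comp[OF G s[OF Ka] r[OF Ka]] rs[OF Ka] functor_Ide[OF G Ka] B.Comp_Ide_left[OF \<tau>H[OF a]] by simp
    finally show ?thesis .
  qed
  ultimately show ?thesis by (rule that)
qed

text \<open>The value at \<open>d\<close> has to be a retract of \<open>G (c d)\<close>. The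
  idempotent \<open>s d \<cdot> r d\<close> of \<open>D\<close> lifts to an arrow \<open>p d\<close>
  of \<open>C\<close> that need not be idempotent; but \<open>G\<close> does not distinguish it from
  its square, so \<open>G (p d)\<close> is idempotent and its splitting is the value sought.\<close>

lemma functor_extends:
  assumes B: "difference_category B zer sub" and G: "is_functor C B G"
    and inv: "\<And>a b f g. f \<in> Hom C a b \<Longrightarrow> g \<in> Hom C a b \<Longrightarrow> FA K f = FA K g \<Longrightarrow> FA G f = FA G g"
  obtains F \<tau> \<tau>' where "F \<in> Fct_Obj D B"
    "natural_transformation C B (functor_comp C F K) G \<tau>"
    "\<And>c. c \<in> Obj C \<Longrightarrow> \<tau>' c \<in> Hom B (FO G c) (FO F (FO K c))"
    "\<And>c. c \<in> Obj C \<Longrightarrow> \<tau>' c \<cdot>\<^bsub>B\<^esub> \<tau> c = Ide B (FO F (FO K c))"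
    "\<And>c. c \<in> Obj C \<Longrightarrow> \<tau> c \<cdot>\<^bsub>B\<^esub> \<tau>' c = Ide B (FO G c)"
proof -
  interpret B: difference_category B zer sub by (rule B)
  obtain c s r where c: "\<And>d. d \<in> Obj D \<Longrightarrow> c d \<in> Obj C"
    and s: "\<And>d. d \<in> Obj D \<Longrightarrow> s d \<in> Hom D d (FO K (c d))"
    and r: "\<And>d. d \<in> Obj D \<Longrightarrow> r d \<in> Hom D (FO K (c d)) d"
    and rs: "\<And>d. d \<in> Obj D \<Longrightarrow> r d \<cdot>\<^bsub>D\<^esub> s d = Ide D d"
    using retract by metis
  have rsh: "r d \<cdot>\<^bsub>D\<^esub> (s d \<cdot>\<^bsub>D\<^esub> h) = h" if "h \<in> Hom D z d" for h z d
    using D.HomD[OF that] D.Comp_assoc[OF that s r] D.Comp_Ide_left[OF that] rs by simp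
  define l where "l a b h = (SOME f. f \<in> Hom C a b \<and> FA K f = h)" for a b h
  have l: "l a b h \<in> Hom C a b" "FA K (l a b h) = h"
    if "a \<in> Obj C" "b \<in> Obj C" "h \<in> Hom D (FO K a) (FO K b)" for a b h
    using someI_ex[of "\<lambda>f. f \<in> Hom C a b \<and> FA K f = h"] full[OF that] unfolding l_def by auto
  \<comment> \<open>Any two lifts of the conjugated arrow \<open>s b \<cdot> f \<cdot> r a\<close>
    have the same image under \<open>G\<close>, so the choice made here is harmless.\<close>
  define L where "L a b f = l (c a) (c b) (s b \<cdot>\<^bsub>D\<^esub> (f \<cdot>\<^bsub>D\<^esub> r a))" for a b f
  have srH: "s b \<cdot>\<^bsub>D\<^esub> (f \<cdot>\<^bsub>D\<^esub> r a) \<in> Hom D (FO K (c a)) (FO K (c b))" if "f \<in> Hom D a b" for a b f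
    using D.HomD[OF that] by (intro D.Comp_Hom[OF D.Comp_Hom[OF r that] s]) auto
  have L: "L a b f \<in> Hom C (c a) (c b)" "FA K (L a b f) = s b \<cdot>\<^bsub>D\<^esub> (f \<cdot>\<^bsub>D\<^esub> r a)" if "f \<in> Hom D a b" for a b f
    unfolding L_def using l[OF c c srH[OF that]] D.HomD[OF that] by auto
  define p where "p d = L d d (Ide D d)" for d
  have p: "p d \<in> Hom C (c d) (c d)" "FA K (p d) = s d \<cdot>\<^bsub>D\<^esub> r d" if "d \<in> Obj D" for d
    unfolding p_def using L[OF D.Ide_Hom[OF that]] D.Comp_Ide_left[OF r[OF that]] by simp_all
  have sp: "FA K (p d) \<cdot>\<^bsub>D\<^esub> (s d \<cdot>\<^bsub>D\<^esub> h) = s d \<cdot>\<^bsub>D\<^esub> h" if "h \<in> Hom D z d" for h z d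
    using D.HomD[OF that] D.Comp_assoc[OF D.Comp_Hom[OF that s] r s] p rsh[OF that] by simp
  note GH = functor_Hom[OF G] and GC = functor_Comp[OF G] and KC = functor_Comp[OF K]
  have Gpp: "FA G (p d) \<cdot>\<^bsub>B\<^esub> FA G (p d) = FA G (p d)" if d: "d \<in> Obj D" for d
    using GC[OF p(1)[OF d] p(1)[OF d]] KC[OF p(1)[OF d] p(1)[OF d]] sp[OF r[OF d]] p(2)[OF d]
      inv[OF C.Comp_Hom[OF p(1)[OF d] p(1)[OF d]] p(1)[OF d]] by simp
  have "\<exists>y k q. k \<in> Hom B y (FO G (c d)) \<and> q \<in> Hom B (FO G (c d)) y \<and> k \<cdot>\<^bsub>B\<^esub> q = FA G (p d) \<and> q \<cdot>\<^bsub>B\<^esub> k = Ide B y"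
    if d: "d \<in> Obj D" for d
    using B.idempotent_splits[OF GH[OF p(1)[OF d]] Gpp[OF d]] by blast
  then obtain y k q where k: "\<And>d. d \<in> Obj D \<Longrightarrow> k d \<in> Hom B (y d) (FO G (c d))"
    and q: "\<And>d. d \<in> Obj D \<Longrightarrow> q d \<in> Hom B (FO G (c d)) (y d)"
    and kq: "\<And>d. d \<in> Obj D \<Longrightarrow> k d \<cdot>\<^bsub>B\<^esub> q d = FA G (p d)"
    and qk: "\<And>d. d \<in> Obj D \<Longrightarrow> q d \<cdot>\<^bsub>B\<^esub> k d = Ide B (y d)"
    by metis
  have pk: "FA G (p d) \<cdot>\<^bsub>B\<^esub> k d = k d" if d: "d \<in> Obj D" for d
    using B.Comp_assoc[OF k[OF d] q[OF d] k[OF d]] kq[OF d] qk[OF d] B.Comp_Ide_right[OF k[OF d]] by simp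
  define F where "F = \<lparr>FO = (\<lambda>d \<in> Obj D. y d),
    FA = (\<lambda>f \<in> Arr D. q (Cod D f) \<cdot>\<^bsub>B\<^esub> (FA G (L (Dom D f) (Cod D f) f) \<cdot>\<^bsub>B\<^esub> k (Dom D f)))\<rparr>"
  have FOF: "FO F d = y d" if "d \<in> Obj D" for d using that by (simp add: F_def)
  have FAF: "FA F f = q b \<cdot>\<^bsub>B\<^esub> (FA G (L a b f) \<cdot>\<^bsub>B\<^esub> k a)" if "f \<in> Hom D a b" for f a b
    using D.HomD[OF that] by (simp add: F_def)
  have FAH: "FA F f \<in> Hom B (y a) (y b)" if "f \<in> Hom D a b" for f a b
    unfolding FAF[OF that]
    using D.HomD[OF that] by (intro B.Comp_Hom[OF B.Comp_Hom[OF k GH[OF L(1)[OF that]]] q]) auto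
  have FF: "is_functor D B F"
  proof (rule is_functorI)
    fix a assume a: "a \<in> Obj D"
    show "FO F a \<in> Obj B" using B.HomD[OF k[OF a]] FOF[OF a] by simp
    show "FA F (Ide D a) = Ide B (FO F a)"
      using FAF[OF D.Ide_Hom[OF a]] pk[OF a] qk[OF a] FOF[OF a] by (simp add: p_def)
  next
    fix f a b assume f: "f \<in> Hom D a b"
    have a: "a \<in> Obj D" and b: "b \<in> Obj D" using D.HomD[OF f] by auto
    show "FA F f \<in> Hom B (FO F a) (FO F b)" using FAH[OF f] FOF a b by simp
    fix g d assume g: "g \<in> Hom D b d"
    have d: "d \<in> Obj D" using D.HomD[OF g] by auto
    note gf = D.Comp_Hom[OF f g]
    note H1 = GH[OF L(1)[OF f]] and H2 = GH[OF L(1)[OF g]]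
    note pL = C.Comp_Hom[OF L(1)[OF f] p(1)[OF b]]
    \<comment> \<open>Composing the two values produces \<open>k b \<cdot> q b = G (p b)\<close> in
      the middle. Under \<open>K\<close> this extra factor is absorbed by the section
      \<open>s b\<close>, so that \<open>G\<close> cannot see it either.\<close>
    have "FA K (L b d g \<cdot>\<^bsub>C\<^esub> (p b \<cdot>\<^bsub>C\<^esub> L a b f)) = (s d \<cdot>\<^bsub>D\<^esub> (g \<cdot>\<^bsub>D\<^esub> r b)) \<cdot>\<^bsub>D\<^esub> (s b \<cdot>\<^bsub>D\<^esub> (f \<cdot>\<^bsub>D\<^esub> r a))"
      using KC[OF pL L(1)[OF g]] KC[OF L(1)[OF f] p(1)[OF b]] L(2)[OF f] L(2)[OF g] sp[OF D.Comp_Hom[OF r[OF a] f]]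
      by simp
    also have "\<dots> = s d \<cdot>\<^bsub>D\<^esub> (g \<cdot>\<^bsub>D\<^esub> (f \<cdot>\<^bsub>D\<^esub> r a))"
      using D.Comp_assoc[OF srH[OF f] D.Comp_Hom[OF r[OF b] g] s[OF d]] D.Comp_assoc[OF srH[OF f] r[OF b] g]
        rsh[OF D.Comp_Hom[OF r[OF a] f]] by simp
    also have "\<dots> = FA K (L a d (g \<cdot>\<^bsub>D\<^esub> f))" using L(2)[OF gf] D.Comp_assoc[OF r[OF a] f g] by simp
    finally have e: "FA G (L b d g \<cdot>\<^bsub>C\<^esub> (p b \<cdot>\<^bsub>C\<^esub> L a b f)) = FA G (L a d (g \<cdot>\<^bsub>D\<^esub> f))"
      by (rule inv[OF C.Comp_Hom[OF pL L(1)[OF g]] L(1)[OF gf]])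
    have "FA F g \<cdot>\<^bsub>B\<^esub> FA F f = q d \<cdot>\<^bsub>B\<^esub> ((FA G (L b d g) \<cdot>\<^bsub>B\<^esub> k b) \<cdot>\<^bsub>B\<^esub> (q b \<cdot>\<^bsub>B\<^esub> (FA G (L a b f) \<cdot>\<^bsub>B\<^esub> k a)))"
      using B.Comp_assoc[OF FAH[OF f] B.Comp_Hom[OF k[OF b] H2] q[OF d]] by (simp add: FAF[OF f] FAF[OF g])
    also have "(FA G (L b d g) \<cdot>\<^bsub>B\<^esub> k b) \<cdot>\<^bsub>B\<^esub> (q b \<cdot>\<^bsub>B\<^esub> (FA G (L a b f) \<cdot>\<^bsub>B\<^esub> k a))
        = FA G (L b d g) \<cdot>\<^bsub>B\<^esub> (FA G (p b) \<cdot>\<^bsub>B\<^esub> (FA G (L a b f) \<cdot>\<^bsub>B\<^esub> k a))"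
      using B.Comp_assoc[OF B.Comp_Hom[OF B.Comp_Hom[OF k[OF a] H1] q[OF b]] k[OF b] H2]
        B.Comp_assoc[OF B.Comp_Hom[OF k[OF a] H1] q[OF b] k[OF b]] kq[OF b] by simp
    also have "\<dots> = FA G (L b d g \<cdot>\<^bsub>C\<^esub> (p b \<cdot>\<^bsub>C\<^esub> L a b f)) \<cdot>\<^bsub>B\<^esub> k a"
      using B.Comp_assoc[OF k[OF a] H1 GH[OF p(1)[OF b]]] GC[OF L(1)[OF f] p(1)[OF b]]
        B.Comp_assoc[OF k[OF a] GH[OF pL] H2] GC[OF pL L(1)[OF g]] by simp
    finally show "FA F (g \<cdot>\<^bsub>D\<^esub> f) = FA F g \<cdot>\<^bsub>B\<^esub> FA F f" by (simp add: FAF[OF gf] e)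
  qed (fact D.category_axioms B.category_axioms)+
  then have F: "F \<in> Fct_Obj D B" by (simp add: Fct_Obj_def F_def)
  note KO = functor_Obj[OF K]
  \<comment> \<open>The new value at \<open>K a\<close> is a summand of \<open>G (c (K a))\<close>,
    not of \<open>G a\<close>. Lifts of the retraction and the section between
    \<open>K (c (K a))\<close> and \<open>K a\<close> provide the comparison; they become mutually
    inverse after passing to the split object.\<close>
  define u where "u a = l (c (FO K a)) a (r (FO K a))" for a
  define v where "v a = l a (c (FO K a)) (s (FO K a))" for a
  have u: "u a \<in> Hom C (c (FO K a)) a" "FA K (u a) = r (FO K a)" if "a \<in> Obj C" for a
    unfolding u_def using l[OF c that r] KO[OF that] by auto
  have v: "v a \<in> Hom C a (c (FO K a))" "FA K (v a) = s (FO K a)" if "a \<in> Obj C" for a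
    unfolding v_def using l[OF that c s] KO[OF that] by auto
  define \<tau> where "\<tau> a = FA G (u a) \<cdot>\<^bsub>B\<^esub> k (FO K a)" for a
  define \<tau>' where "\<tau>' a = q (FO K a) \<cdot>\<^bsub>B\<^esub> FA G (v a)" for a
  have \<tau>H: "\<tau> a \<in> Hom B (y (FO K a)) (FO G a)" if a: "a \<in> Obj C" for a
    unfolding \<tau>_def by (rule B.Comp_Hom[OF k[OF KO[OF a]] GH[OF u(1)[OF a]]])
  have \<tau>'H: "\<tau>' a \<in> Hom B (FO G a) (y (FO K a))" if a: "a \<in> Obj C" for a
    unfolding \<tau>'_def by (rule B.Comp_Hom[OF GH[OF v(1)[OF a]] q[OF KO[OF a]]])
  have \<tau>n: "natural_transformation C B (functor_comp C F K) G \<tau>"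
  proof (rule natural_transformationI)
    show "\<tau> a \<in> Hom B (FO (functor_comp C F K) a) (FO G a)" if a: "a \<in> Obj C" for a
      using \<tau>H[OF a] a KO[OF a] FOF by simp
    fix f a b assume f: "f \<in> Hom C a b"
    have a: "a \<in> Obj C" and b: "b \<in> Obj C" using C.HomD[OF f] by auto
    define d where "d = FO K a"
    define e where "e = FO K b"
    have d: "d \<in> Obj D" and e: "e \<in> Obj D" unfolding d_def e_def using KO a b by auto
    have Kf: "FA K f \<in> Hom D d e" unfolding d_def e_def using functor_Hom[OF K f] .
    note Lf = L(1)[OF Kf]
    have ub: "u b \<in> Hom C (c e) b" "FA K (u b) = r e" unfolding e_def using u[OF b] by auto
    have ua: "u a \<in> Hom C (c d) a" "FA K (u a) = r d" unfolding d_def using u[OF a] by auto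
    note pL = C.Comp_Hom[OF Lf p(1)[OF e]]
    have "FA K (u b \<cdot>\<^bsub>C\<^esub> (p e \<cdot>\<^bsub>C\<^esub> L d e (FA K f))) = r e \<cdot>\<^bsub>D\<^esub> (s e \<cdot>\<^bsub>D\<^esub> (FA K f \<cdot>\<^bsub>D\<^esub> r d))"
      using KC[OF pL ub(1)] KC[OF Lf p(1)[OF e]] L(2)[OF Kf] sp[OF D.Comp_Hom[OF r[OF d] Kf]] ub(2) by simp
    also have "\<dots> = FA K (f \<cdot>\<^bsub>C\<^esub> u a)"
      using rsh[OF D.Comp_Hom[OF r[OF d] Kf]] KC[OF ua(1) f] ua(2) by simp
    finally have ee: "FA G (u b \<cdot>\<^bsub>C\<^esub> (p e \<cdot>\<^bsub>C\<^esub> L d e (FA K f))) = FA G (f \<cdot>\<^bsub>C\<^esub> u a)"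
      by (rule inv[OF C.Comp_Hom[OF pL ub(1)] C.Comp_Hom[OF ua(1) f]])
    note Lk = B.Comp_Hom[OF k[OF d] GH[OF Lf]]
    have "\<tau> b \<cdot>\<^bsub>B\<^esub> FA F (FA K f) = FA G (u b) \<cdot>\<^bsub>B\<^esub> (k e \<cdot>\<^bsub>B\<^esub> (q e \<cdot>\<^bsub>B\<^esub> (FA G (L d e (FA K f)) \<cdot>\<^bsub>B\<^esub> k d)))"
      unfolding \<tau>_def e_def[symmetric] FAF[OF Kf]
      by (rule B.Comp_assoc[OF B.Comp_Hom[OF Lk q[OF e]] k[OF e] GH[OF ub(1)]])
    also have "\<dots> = FA G (u b) \<cdot>\<^bsub>B\<^esub> (FA G (p e) \<cdot>\<^bsub>B\<^esub> (FA G (L d e (FA K f)) \<cdot>\<^bsub>B\<^esub> k d))"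
      using B.Comp_assoc[OF Lk q[OF e] k[OF e]] kq[OF e] by simp
    also have "\<dots> = FA G (u b \<cdot>\<^bsub>C\<^esub> (p e \<cdot>\<^bsub>C\<^esub> L d e (FA K f))) \<cdot>\<^bsub>B\<^esub> k d"
      using B.Comp_assoc[OF k[OF d] GH[OF Lf] GH[OF p(1)[OF e]]] GC[OF Lf p(1)[OF e]]
        B.Comp_assoc[OF k[OF d] GH[OF pL] GH[OF ub(1)]] GC[OF pL ub(1)] by simp
    also have "\<dots> = FA G f \<cdot>\<^bsub>B\<^esub> \<tau> a"
      unfolding \<tau>_def d_def[symmetric] ee
      using GC[OF ua(1) f] B.Comp_assoc[OF k[OF d] GH[OF ua(1)] GH[OF f]] by simp
    finally show "FA G f \<cdot>\<^bsub>B\<^esub> \<tau> a = \<tau> b \<cdot>\<^bsub>B\<^esub> FA (functor_comp C F K) f" using f by simp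
  qed
  have 1: "\<tau>' a \<cdot>\<^bsub>B\<^esub> \<tau> a = Ide B (y (FO K a))" if a: "a \<in> Obj C" for a
  proof -
    note d = KO[OF a]
    have "FA K (v a \<cdot>\<^bsub>C\<^esub> u a) = FA K (p (FO K a))" using KC[OF u(1)[OF a] v(1)[OF a]] u v p a d by simp
    then have e: "FA G (v a \<cdot>\<^bsub>C\<^esub> u a) = FA G (p (FO K a))"
      by (rule inv[OF C.Comp_Hom[OF u(1)[OF a] v(1)[OF a]] p(1)[OF d]])
    have "\<tau>' a \<cdot>\<^bsub>B\<^esub> \<tau> a = q (FO K a) \<cdot>\<^bsub>B\<^esub> (FA G (v a) \<cdot>\<^bsub>B\<^esub> (FA G (u a) \<cdot>\<^bsub>B\<^esub> k (FO K a)))"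
      unfolding \<tau>'_def
      using B.Comp_assoc[OF \<tau>H[OF a] GH[OF v(1)[OF a]] q[OF d]] by (simp add: \<tau>_def)
    also have "FA G (v a) \<cdot>\<^bsub>B\<^esub> (FA G (u a) \<cdot>\<^bsub>B\<^esub> k (FO K a)) = k (FO K a)"
      using B.Comp_assoc[OF k[OF d] GH[OF u(1)[OF a]] GH[OF v(1)[OF a]]] GC[OF u(1)[OF a] v(1)[OF a]] e pk[OF d] by simp
    finally show ?thesis using qk[OF d] by simp
  qed
  have 2: "\<tau> a \<cdot>\<^bsub>B\<^esub> \<tau>' a = Ide B (FO G a)" if a: "a \<in> Obj C" for a
  proof -
    note d = KO[OF a]
    note pv = C.Comp_Hom[OF v(1)[OF a] p(1)[OF d]]
    have "FA K (p (FO K a) \<cdot>\<^bsub>C\<^esub> v a) = s (FO K a)"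
      using KC[OF v(1)[OF a] p(1)[OF d]] v(2)[OF a] sp[OF D.Ide_Hom[OF d]] D.Comp_Ide_right[OF s[OF d]] by simp
    then have "FA K (u a \<cdot>\<^bsub>C\<^esub> (p (FO K a) \<cdot>\<^bsub>C\<^esub> v a)) = FA K (Ide C a)"
      using KC[OF pv u(1)[OF a]] u(2)[OF a] rs[OF d] functor_Ide[OF K a] by simp
    then have e: "FA G (u a \<cdot>\<^bsub>C\<^esub> (p (FO K a) \<cdot>\<^bsub>C\<^esub> v a)) = Ide B (FO G a)"
      using inv[OF C.Comp_Hom[OF pv u(1)[OF a]] C.Ide_Hom[OF a]] functor_Ide[OF G a] by simp
    have "\<tau> a \<cdot>\<^bsub>B\<^esub> \<tau>' a = FA G (u a) \<cdot>\<^bsub>B\<^esub> (k (FO K a) \<cdot>\<^bsub>B\<^esub> (q (FO K a) \<cdot>\<^bsub>B\<^esub> FA G (v a)))"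
      unfolding \<tau>_def using B.Comp_assoc[OF \<tau>'H[OF a] k[OF d] GH[OF u(1)[OF a]]] by (simp add: \<tau>'_def)
    also have "k (FO K a) \<cdot>\<^bsub>B\<^esub> (q (FO K a) \<cdot>\<^bsub>B\<^esub> FA G (v a)) = FA G (p (FO K a) \<cdot>\<^bsub>C\<^esub> v a)"
      using B.Comp_assoc[OF GH[OF v(1)[OF a]] q[OF d] k[OF d]] kq[OF d] GC[OF v(1)[OF a] p(1)[OF d]] by simp
    finally show ?thesis using GC[OF pv u(1)[OF a]] e by simp
  qed
  show ?thesis
    by (rule that[OF F \<tau>n]) (use \<tau>'H 1 2 FOF KO in auto)
qed

end

section \<open>Inclusion and exclusion on a sum of copies of one object\<close>

context shift_category begin

abbreviation power_sum :: "'o \<Rightarrow> 'o \<Rightarrow> nat \<Rightarrow> 'o" where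
  "power_sum t w k \<equiv> ((\<lambda>y. t \<oplus> y) ^^ k) w"

lemma power_sum_Obj: "t \<in> Obj N \<Longrightarrow> w \<in> Obj N \<Longrightarrow> power_sum t w k \<in> Obj N"
  by (induction k) (auto intro: SumO_Obj)

text \<open>
  The idempotents of \<open>t \<oplus> \<dots> \<oplus> t \<oplus> w\<close> that kill at least one of the \<open>k\<close> summands \<open>t\<close>.
\<close>

primrec partial_projections :: "'o \<Rightarrow> 'o \<Rightarrow> nat \<Rightarrow> 'a set" where
  "partial_projections t w 0 = {}"
| "partial_projections t w (Suc k) =
     (let p = inc t (power_sum t w k) \<cdot> pr t (power_sum t w k);
          E = (\<lambda>e. Ide N t \<uplus> e) ` partial_projections t w k
      in insert p (E \<union> (\<lambda>e. p \<cdot> e) ` E))"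

lemma inc_pr_Hom: "x \<in> Obj N \<Longrightarrow> y \<in> Obj N \<Longrightarrow> inc x y \<cdot> pr x y \<in> Hom N (x \<oplus> y) (x \<oplus> y)"
  by (rule Comp_Hom[OF pr_Hom inc_Hom])

lemma partial_projections_Hom:
  assumes t: "t \<in> Obj N" and w: "w \<in> Obj N"
  shows "e \<in> partial_projections t w k \<Longrightarrow> e \<in> Hom N (power_sum t w k) (power_sum t w k)"
proof (induction k arbitrary: e)
  case (Suc k)
  note p = inc_pr_Hom[OF t power_sum_Obj[OF t w, of k]]
  have "Ide N t \<uplus> e' \<in> Hom N (t \<oplus> power_sum t w k) (t \<oplus> power_sum t w k)"
    if "e' \<in> partial_projections t w k" for e'
    using shift_Hom[OF t Suc.IH[OF that]] .
  then show ?case using Suc.prems p Comp_Hom[OF _ p] by (auto simp: Let_def)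
qed simp

end

context shift_functors begin

text \<open>Expanding the vanishing product of factors \<open>1 - F(p)\<close> expresses the term
  without projections, up to signs, by the terms \<open>F(e)\<close>, which are zero by assumption.
  The arrows \<open>d\<close> and \<open>g\<close> on the two sides are built in because only the
  composites with both are assumed to vanish.\<close>

lemma zero_of_partial_projections:
  assumes S: "S \<subseteq> Obj N" and t: "t \<in> S" and w: "w \<in> S"
    and "is_functor N B F" and "\<And>y. y \<in> Obj N \<Longrightarrow> \<theta> y \<in> Hom B (FO F y) (G y)"
    and "vanishes S k F \<theta>"
    and "d \<in> Hom B (G (power_sum t w k)) X" and "g \<in> Hom B P (FO F (power_sum t w k))"
    and "\<And>e. e \<in> partial_projections t w k \<Longrightarrow>
      zero_arrow B ((d \<cdot>\<^bsub>B\<^esub> \<theta> (power_sum t w k)) \<cdot>\<^bsub>B\<^esub> (FA F e \<cdot>\<^bsub>B\<^esub> g))"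
  shows "zero_arrow B ((d \<cdot>\<^bsub>B\<^esub> \<theta> (power_sum t w k)) \<cdot>\<^bsub>B\<^esub> g)"
  using assms(4-9)
proof (induction k arbitrary: F \<theta> G d)
  case 0
  have wo: "w \<in> Obj N" using w S by auto
  note \<theta> = 0(2)[OF wo]
  have d: "d \<in> Hom B (G w) X" and g: "g \<in> Hom B P (FO F w)" using 0 by auto
  have "\<theta> w = zer (FO F w) (G w)" using 0(3) w B.zero_arrow_iff[OF \<theta>] by simp
  then have "(d \<cdot>\<^bsub>B\<^esub> \<theta> w) \<cdot>\<^bsub>B\<^esub> g = zer P X"
    using B.Comp_zer_right[OF d B.HomD(4)[OF \<theta>]] B.Comp_zer_left[OF g B.HomD(5)[OF d]] by simp
  then show ?case using B.zero_arrow_iff[OF B.Comp_Hom[OF g B.Comp_Hom[OF \<theta> d]]] by simp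
next
  case (Suc k)
  have to: "t \<in> Obj N" and wo: "w \<in> Obj N" using t w S by auto
  define Y where "Y = power_sum t w k"
  have Y: "Y \<in> Obj N" unfolding Y_def by (rule power_sum_Obj[OF to wo])
  note F = Suc.prems(1)
  have \<theta>: "\<theta> (t \<oplus> Y) \<in> Hom B (FO F (t \<oplus> Y)) (G (t \<oplus> Y))" using Suc.prems(2) SumO_Obj[OF to Y] .
  have d: "d \<in> Hom B (G (t \<oplus> Y)) X" and g: "g \<in> Hom B P (FO F (t \<oplus> Y))"
    using Suc.prems by (simp_all add: Y_def)
  define h where "h = d \<cdot>\<^bsub>B\<^esub> \<theta> (t \<oplus> Y)"
  have h: "h \<in> Hom B (FO F (t \<oplus> Y)) X" unfolding h_def by (rule B.Comp_Hom[OF \<theta> d])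
  note red = red_Hom[OF F to Y]
  define p where "p = inc t Y \<cdot> pr t Y"
  have pH: "p \<in> Hom N (t \<oplus> Y) (t \<oplus> Y)" unfolding p_def by (rule inc_pr_Hom[OF to Y])
  have Fp: "FA F p = FA F (inc t Y) \<cdot>\<^bsub>B\<^esub> FA F (pr t Y)"
    unfolding p_def by (rule functor_Comp[OF F pr_Hom[OF to Y] inc_Hom[OF to Y]])
  have X: "X \<in> Obj B" using B.HomD[OF h] by simp
  have z: "h \<cdot>\<^bsub>B\<^esub> (FA F e \<cdot>\<^bsub>B\<^esub> g) = zer P X" if "e \<in> partial_projections t w (Suc k)" for e
  proof -
    have "e \<in> Hom N (t \<oplus> Y) (t \<oplus> Y)" using partial_projections_Hom[OF to wo that] by (simp add: Y_def)
    then show ?thesis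
      using Suc.prems(6)[OF that] B.zero_arrow_iff[OF B.Comp_Hom[OF B.Comp_Hom[OF g functor_Hom[OF F]] h]]
      by (simp add: h_def Y_def)
  qed
  \<comment> \<open>The factor \<open>red\<close> is \<open>1 - F(p)\<close>, where \<open>p\<close>
    kills the first summand.\<close>
  have hred: "(h \<cdot>\<^bsub>B\<^esub> red t F Y) \<cdot>\<^bsub>B\<^esub> g' = sub (h \<cdot>\<^bsub>B\<^esub> g') (h \<cdot>\<^bsub>B\<^esub> (FA F p \<cdot>\<^bsub>B\<^esub> g'))"
    if g': "g' \<in> Hom B P (FO F (t \<oplus> Y))" for g'
  proof -
    note pg = B.Comp_Hom[OF g' functor_Hom[OF F pH]]
    have "(h \<cdot>\<^bsub>B\<^esub> red t F Y) \<cdot>\<^bsub>B\<^esub> g' = h \<cdot>\<^bsub>B\<^esub> sub g' (FA F p \<cdot>\<^bsub>B\<^esub> g')"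
      using B.Comp_assoc[OF g' red h] red_Comp[OF F to Y g'] B.Comp_assoc[OF g' F_pr[OF F to Y] F_inc[OF F to Y]]
      by (simp add: Fp)
    then show ?thesis using B.Comp_sub_right[OF g' pg h] by simp
  qed
  \<comment> \<open>The factor of the first summand is absorbed into \<open>\<theta>\<close> before
    the induction hypothesis treats the remaining \<open>k\<close> summands. Each of their partial
    projections \<open>e\<close> then contributes two terms, for \<open>t \<oplus> e\<close> and
    \<open>p \<cdot> (t \<oplus> e)\<close>, both covered by the assumption.\<close>
  have "zero_arrow B ((d \<cdot>\<^bsub>B\<^esub> (\<theta> (t \<oplus> Y) \<cdot>\<^bsub>B\<^esub> red t F Y)) \<cdot>\<^bsub>B\<^esub> g)"
    unfolding Y_def
  proof (rule Suc.IH[where F = "shift N t F" and \<theta> = "\<lambda>y. \<theta> (t \<oplus> y) \<cdot>\<^bsub>B\<^esub> red t F y" and G = "\<lambda>y. G (t \<oplus> y)"])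
    show "is_functor N B (shift N t F)" by (rule shift_functor[OF to F])
    show "\<theta> (t \<oplus> y) \<cdot>\<^bsub>B\<^esub> red t F y \<in> Hom B (FO (shift N t F) y) (G (t \<oplus> y))" if "y \<in> Obj N" for y
      using B.Comp_Hom[OF red_Hom[OF F to that] Suc.prems(2)[OF SumO_Obj[OF to that]]] that by simp
    show "vanishes S k (shift N t F) (\<lambda>y. \<theta> (t \<oplus> y) \<cdot>\<^bsub>B\<^esub> red t F y)" using Suc.prems(3) t by simp
    show "d \<in> Hom B (G (t \<oplus> power_sum t w k)) X" using d by (simp add: Y_def)
    show "g \<in> Hom B P (FO (shift N t F) (power_sum t w k))" using g Y by (simp add: Y_def)
    fix e assume e: "e \<in> partial_projections t w k"
    have eH: "e \<in> Hom N Y Y" using partial_projections_Hom[OF to wo e] by (simp add: Y_def)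
    note te = shift_Hom[OF to eH]
    note teg = B.Comp_Hom[OF g functor_Hom[OF F te]]
    have m: "Ide N t \<uplus> e \<in> partial_projections t w (Suc k)" "p \<cdot> (Ide N t \<uplus> e) \<in> partial_projections t w (Suc k)"
      using e by (auto simp: Let_def p_def Y_def)
    have "FA F p \<cdot>\<^bsub>B\<^esub> (FA F (Ide N t \<uplus> e) \<cdot>\<^bsub>B\<^esub> g) = FA F (p \<cdot> (Ide N t \<uplus> e)) \<cdot>\<^bsub>B\<^esub> g"
      using B.Comp_assoc[OF g functor_Hom[OF F te] functor_Hom[OF F pH]] functor_Comp[OF F te pH] by simp
    then have "(h \<cdot>\<^bsub>B\<^esub> red t F Y) \<cdot>\<^bsub>B\<^esub> (FA F (Ide N t \<uplus> e) \<cdot>\<^bsub>B\<^esub> g) = sub (zer P X) (zer P X)"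
      using hred[OF teg] z[OF m(1)] z[OF m(2)] by simp
    then have "zero_arrow B ((h \<cdot>\<^bsub>B\<^esub> red t F Y) \<cdot>\<^bsub>B\<^esub> (FA F (Ide N t \<uplus> e) \<cdot>\<^bsub>B\<^esub> g))"
      using B.zero_arrow_sub_self[OF B.zer_Hom[OF B.HomD(4)[OF g] X]] by simp
    then show "zero_arrow B ((d \<cdot>\<^bsub>B\<^esub> (\<theta> (t \<oplus> power_sum t w k) \<cdot>\<^bsub>B\<^esub> red t F (power_sum t w k))) \<cdot>\<^bsub>B\<^esub>
        (FA (shift N t F) e \<cdot>\<^bsub>B\<^esub> g))"
      using eH B.Comp_assoc[OF red \<theta> d] by (simp add: h_def Y_def)
  qed
  then have "sub (h \<cdot>\<^bsub>B\<^esub> g) (h \<cdot>\<^bsub>B\<^esub> (FA F p \<cdot>\<^bsub>B\<^esub> g)) = zer P X"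
    using hred[OF g] B.Comp_assoc[OF red \<theta> d] B.zero_arrow_iff[OF B.Comp_Hom[OF g B.Comp_Hom[OF red h]]]
    by (simp add: h_def)
  \<comment> \<open>What remains to be removed is the term of \<open>p\<close> alone, itself a
    partial projection.\<close>
  moreover have "h \<cdot>\<^bsub>B\<^esub> (FA F p \<cdot>\<^bsub>B\<^esub> g) = zer P X" by (rule z) (simp add: Let_def p_def Y_def)
  ultimately have "h \<cdot>\<^bsub>B\<^esub> g = zer P X" using B.sub_zer[OF B.Comp_Hom[OF g h]] by simp
  then show ?case using B.zero_arrow_iff[OF B.Comp_Hom[OF g h]] by (simp add: h_def Y_def)
qed

end

section \<open>The extension of a monoidal functor\<close>

lemma (in Mon_nul) proj2_proj2:
  assumes "x \<in> Obj M" "y \<in> Obj M" "z \<in> Obj M"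
  shows "proj2 M y z \<cdot> proj2 M x (y \<oplus> z) = proj2 M (x \<oplus> y) z"
proof -
  have e: "Ide M (y \<oplus> z) = Ide M y \<uplus> Ide M z" using assms by (simp add: SumA_Ide)
  have "proj2 M x (y \<oplus> z) = (to_Unit M x \<uplus> Ide M y) \<uplus> Ide M z"
    using assms HomA[OF Ide_Hom] HomA[OF to_Unit_Hom] by (simp add: proj2_def e SumA_assoc)
  then have "proj2 M y z \<cdot> proj2 M x (y \<oplus> z) = (to_Unit M y \<cdot> proj2 M x y) \<uplus> (Ide M z \<cdot> Ide M z)"
    using SumA_Comp[OF proj2_Hom[OF assms(1,2)] to_Unit_Hom[OF assms(2)] Ide_Hom[OF assms(3)] Ide_Hom[OF assms(3)]]
    by (simp add: proj2_def)
  then show ?thesis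
    using to_Unit_Comp[OF proj2_Hom[OF assms(1,2)]] Comp_Ide_left[OF Ide_Hom[OF assms(3)]]
    by (simp add: proj2_def[of M "x \<oplus> y"])
qed

lemma (in Mon_nul) proj1_inj1:
  assumes "x \<in> Obj M" "y \<in> Obj M"
  shows "proj1 M x y \<cdot> inj1 M x y = Ide M x"
  using proj1_nat[OF Ide_Hom[OF assms(1)] from_Unit_Hom[OF assms(2)]] to_Unit_eq[OF Ide_Hom[OF Unit_closed]] assms
    Comp_Ide_left[OF proj1_Hom[OF assms(1) Unit_closed]] SumA_Ide[OF assms(1) Unit_closed]
  by (simp add: inj1_def proj1_def SumO_Unit_right)

lemma (in Mon_ini) inj1_Hom: "x \<in> Obj M \<Longrightarrow> y \<in> Obj M \<Longrightarrow> inj1 M x y \<in> Hom M x (x \<oplus> y)"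
  unfolding inj1_def using SumA_Hom[OF Ide_Hom from_Unit_Hom] by (simp add: SumO_Unit_right)

locale monoidal_extension = M: Mon_ini M + A: Mon_nul A
  for M :: "('o, 'a, 'z) smcat_scheme" and A :: "('p, 'b, 'y) smcat_scheme" +
  fixes \<Phi> :: "('o, 'a, 'p, 'b) functr"
  assumes \<Phi>: "strict_symmetric_monoidal_functor M A \<Phi>"
begin

lemma \<Phi>_functor: "is_functor M A \<Phi>"
  and \<Phi>_Unit: "FO \<Phi> (Unit M) = Unit A"
  and \<Phi>_SumO: "x \<in> Obj M \<Longrightarrow> y \<in> Obj M \<Longrightarrow> FO \<Phi> (x \<oplus>\<^bsub>M\<^esub> y) = FO \<Phi> x \<oplus>\<^bsub>A\<^esub> FO \<Phi> y"
  and \<Phi>_SumA: "f \<in> Hom M a b \<Longrightarrow> g \<in> Hom M c d \<Longrightarrow> FA \<Phi> (f \<uplus>\<^bsub>M\<^esub> g) = FA \<Phi> f \<uplus>\<^bsub>A\<^esub> FA \<Phi> g"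
  and \<Phi>_Sym: "x \<in> Obj M \<Longrightarrow> y \<in> Obj M \<Longrightarrow> FA \<Phi> (Sym M x y) = Sym A (FO \<Phi> x) (FO \<Phi> y)"
  using \<Phi> M.HomA unfolding strict_symmetric_monoidal_functor_def by auto

lemmas \<Phi>_Obj = functor_Obj[OF \<Phi>_functor]
  and \<Phi>_Hom = functor_Hom[OF \<Phi>_functor]
  and \<Phi>_Ide = functor_Ide[OF \<Phi>_functor]
  and \<Phi>_Comp = functor_Comp[OF \<Phi>_functor]

lemma \<Phi>_Hom_SumO: "\<lbrakk>f \<in> Hom M a (b \<oplus>\<^bsub>M\<^esub> t); b \<in> Obj M; t \<in> Obj M\<rbrakk> \<Longrightarrow>
    FA \<Phi> f \<in> Hom A (FO \<Phi> a) (FO \<Phi> b \<oplus>\<^bsub>A\<^esub> FO \<Phi> t)"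
  using \<Phi>_Hom[of f a "b \<oplus>\<^bsub>M\<^esub> t"] by (simp add: \<Phi>_SumO)

lemma \<Phi>_from_Unit: "x \<in> Obj M \<Longrightarrow> FA \<Phi> (from_Unit M x) = from_Unit A (FO \<Phi> x)"
  using A.from_Unit_eq \<Phi>_Hom[OF M.from_Unit_Hom] \<Phi>_Unit by simp

abbreviation E :: "('o, ('o, 'a) tarrow, 'p, 'b) functr" where
  "E \<equiv> tilde_extension A \<Phi>"

lemma E_FO [simp]: "FO E = FO \<Phi>"
  by (simp add: tilde_extension_def)

text \<open>An arrow that acts only on the discarded summand is swallowed by the projection, so the
  value is the same for all representatives.\<close>

lemma E_tclass:
  assumes b: "b \<in> Obj M" and t: "t \<in> Obj M" and f: "f \<in> Hom M a (b \<oplus>\<^bsub>M\<^esub> t)"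
  shows "FA E (tclass M a b t f) = proj1 A (FO \<Phi> b) (FO \<Phi> t) \<cdot>\<^bsub>A\<^esub> FA \<Phi> f"
proof -
  have step: "proj1 A (FO \<Phi> b) (FO \<Phi> s) \<cdot>\<^bsub>A\<^esub> FA \<Phi> x
      = proj1 A (FO \<Phi> b) (FO \<Phi> s') \<cdot>\<^bsub>A\<^esub> FA \<Phi> ((Ide M b \<uplus>\<^bsub>M\<^esub> h) \<cdot>\<^bsub>M\<^esub> x)"
    if s: "s \<in> Obj M" and s': "s' \<in> Obj M" and h: "h \<in> Hom M s s'" and x: "x \<in> Hom M a (b \<oplus>\<^bsub>M\<^esub> s)" for s s' h x
  proof -
    note bh = M.SumA_Hom[OF M.Ide_Hom[OF b] h]
    note \<Phi>b = \<Phi>_Obj[OF b]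
    have \<Phi>bh: "FA \<Phi> (Ide M b \<uplus>\<^bsub>M\<^esub> h) = Ide A (FO \<Phi> b) \<uplus>\<^bsub>A\<^esub> FA \<Phi> h"
      using \<Phi>_SumA[OF M.Ide_Hom[OF b] h] \<Phi>_Ide[OF b] by simp
    note H = A.SumA_Hom[OF A.Ide_Hom[OF \<Phi>b] \<Phi>_Hom[OF h]]
    have "proj1 A (FO \<Phi> b) (FO \<Phi> s') \<cdot>\<^bsub>A\<^esub> FA \<Phi> ((Ide M b \<uplus>\<^bsub>M\<^esub> h) \<cdot>\<^bsub>M\<^esub> x)
        = (proj1 A (FO \<Phi> b) (FO \<Phi> s') \<cdot>\<^bsub>A\<^esub> (Ide A (FO \<Phi> b) \<uplus>\<^bsub>A\<^esub> FA \<Phi> h)) \<cdot>\<^bsub>A\<^esub> FA \<Phi> x"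
      using \<Phi>_Comp[OF x bh] \<Phi>bh A.Comp_assoc[OF \<Phi>_Hom_SumO[OF x b s] H A.proj1_Hom[OF \<Phi>b \<Phi>_Obj[OF s']]] by simp
    then show ?thesis
      using A.proj1_nat[OF A.Ide_Hom[OF \<Phi>b] \<Phi>_Hom[OF h]] A.Comp_Ide_left[OF A.proj1_Hom[OF \<Phi>b \<Phi>_Obj[OF s]]] by simp
  qed
  have "{proj1 A (FO \<Phi> b) (FO \<Phi> t') \<cdot>\<^bsub>A\<^esub> FA \<Phi> f' | t' f'. (t', f') \<in> M.tcl a b (t, f)}
      = {proj1 A (FO \<Phi> b) (FO \<Phi> t) \<cdot>\<^bsub>A\<^esub> FA \<Phi> f}" (is "?S = {?c}")
  proof -
    have "x = ?c" if "x \<in> ?S" for x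
      using that M.tcl_invariant[where Q = "\<lambda>t f. proj1 A (FO \<Phi> b) (FO \<Phi> t) \<cdot>\<^bsub>A\<^esub> FA \<Phi> f", OF step] by blast
    moreover have "?c \<in> ?S" using M.tcl_self by blast
    ultimately show ?thesis by blast
  qed
  then show ?thesis by (simp add: tilde_extension_def M.tclass_tcl)
qed

lemma E_eta:
  assumes f: "f \<in> Hom M a b"
  shows "FA E (tclass M a b (Unit M) f) = FA \<Phi> f"
  using E_tclass[OF M.HomD(5)[OF f] M.Unit_closed, of f a] f M.HomD(5)[OF f] A.Comp_Ide_left[OF \<Phi>_Hom[OF f]]
    A.to_Unit_eq[OF A.Ide_Hom[OF A.Unit_closed]] A.SumA_Ide[OF \<Phi>_Obj A.Unit_closed, of b]
  by (simp add: M.SumO_Unit_right \<Phi>_Unit proj1_def A.SumO_Unit_right \<Phi>_Obj)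

text \<open>For composites, projecting away \<open>u \<oplus> t\<close> is done in two steps,
  \<open>t\<close> before \<open>u\<close>. By naturality the first projection passes across
  \<open>g'\<close> and meets the representative of the inner arrow.\<close>

lemma E_functor: "is_functor (tilde M) A E"
proof (rule is_functorI)
  fix f a b assume "f \<in> Hom (tilde M) a b"
  then show "FA E f \<in> Hom A (FO E a) (FO E b)"
  proof (rule M.tilde_HomE)
    fix t f' assume f: "a \<in> Obj M" "b \<in> Obj M" "t \<in> Obj M" "f' \<in> Hom M a (b \<oplus>\<^bsub>M\<^esub> t)" "f = tclass M a b t f'"
    show ?thesis
      using A.Comp_Hom[OF \<Phi>_Hom_SumO[OF f(4,2,3)] A.proj1_Hom[OF \<Phi>_Obj[OF f(2)] \<Phi>_Obj[OF f(3)]]]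
      by (simp add: f(5) E_tclass[OF f(2-4)])
  qed
next
  fix f g a b c assume fH: "f \<in> Hom (tilde M) a b" and gH: "g \<in> Hom (tilde M) b c"
  from fH show "FA E (g \<cdot>\<^bsub>tilde M\<^esub> f) = FA E g \<cdot>\<^bsub>A\<^esub> FA E f"
  proof (rule M.tilde_HomE)
    fix t f' assume f: "a \<in> Obj M" "b \<in> Obj M" "t \<in> Obj M" "f' \<in> Hom M a (b \<oplus>\<^bsub>M\<^esub> t)" "f = tclass M a b t f'"
    from gH show ?thesis
    proof (rule M.tilde_HomE)
      fix u g' assume g: "c \<in> Obj M" "u \<in> Obj M" "g' \<in> Hom M b (c \<oplus>\<^bsub>M\<^esub> u)" "g = tclass M b c u g'"
      note o = \<Phi>_Obj[OF f(2)] \<Phi>_Obj[OF f(3)] \<Phi>_Obj[OF g(1)] \<Phi>_Obj[OF g(2)]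
      note F = \<Phi>_Hom_SumO[OF f(4,2,3)] and G = \<Phi>_Hom_SumO[OF g(3,1,2)]
      note Gt = A.SumA_Hom[OF G A.Ide_Hom[OF o(2)]]
      have e: "FA \<Phi> ((g' \<uplus>\<^bsub>M\<^esub> Ide M t) \<cdot>\<^bsub>M\<^esub> f') = (FA \<Phi> g' \<uplus>\<^bsub>A\<^esub> Ide A (FO \<Phi> t)) \<cdot>\<^bsub>A\<^esub> FA \<Phi> f'"
        using \<Phi>_Comp[OF f(4) M.SumA_Hom[OF g(3) M.Ide_Hom[OF f(3)]]] \<Phi>_SumA[OF g(3) M.Ide_Hom[OF f(3)]]
        by (simp add: \<Phi>_Ide[OF f(3)])
      note p1 = A.proj1_Hom[OF o(3,4)] and p2 = A.proj1_Hom[OF A.SumO_closed[OF o(3,4)] o(2)]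
        and p3 = A.proj1_Hom[OF o(1,2)]
      have "FA E (g \<cdot>\<^bsub>tilde M\<^esub> f) = proj1 A (FO \<Phi> c) (FO \<Phi> u \<oplus>\<^bsub>A\<^esub> FO \<Phi> t) \<cdot>\<^bsub>A\<^esub> FA \<Phi> ((g' \<uplus>\<^bsub>M\<^esub> Ide M t) \<cdot>\<^bsub>M\<^esub> f')"
        using M.tComp_tclass[OF f(2) g(1) g(2) f(3) g(3) f(4)]
          E_tclass[OF g(1) M.SumO_closed[OF g(2) f(3)] M.tcomp_Hom[OF g(1,2) f(3) g(3) f(4)]]
        by (simp add: f(5) g(4) \<Phi>_SumO g(2) f(3))
      also have "\<dots> = proj1 A (FO \<Phi> c) (FO \<Phi> u) \<cdot>\<^bsub>A\<^esub> ((proj1 A (FO \<Phi> c \<oplus>\<^bsub>A\<^esub> FO \<Phi> u) (FO \<Phi> t) \<cdot>\<^bsub>A\<^esub>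
          (FA \<Phi> g' \<uplus>\<^bsub>A\<^esub> Ide A (FO \<Phi> t))) \<cdot>\<^bsub>A\<^esub> FA \<Phi> f')"
        unfolding e using A.proj1_proj1[OF o(3,4,2)] A.Comp_assoc[OF A.Comp_Hom[OF F Gt] p2 p1] A.Comp_assoc[OF F Gt p2]
        by simp
      also have "\<dots> = FA E g \<cdot>\<^bsub>A\<^esub> FA E f"
        using A.proj1_nat[OF G A.Ide_Hom[OF o(2)]] A.Comp_assoc[OF F p3 G] A.Comp_assoc[OF A.Comp_Hom[OF F p3] G p1]
        by (simp add: f(5) g(4) E_tclass[OF f(2-4)] E_tclass[OF g(1-3)])
      finally show ?thesis .
    qed
  qed
next
  fix a assume a: "a \<in> Obj (tilde M)"
  then show "FA E (Ide (tilde M) a) = Ide A (FO E a)"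
    using E_eta[OF M.Ide_Hom, of a] by (simp add: \<Phi>_Ide)
qed (use \<Phi>_Obj M.tilde_category A.category_axioms in auto)

lemma E_shift:
  assumes x: "x \<in> Obj M" and f: "f \<in> Hom (tilde M) a b"
  shows "FA E (tSum M (tclass M x x (Unit M) (Ide M x)) f) = Ide A (FO \<Phi> x) \<uplus>\<^bsub>A\<^esub> FA E f"
  using f
proof (rule M.tilde_HomE)
  fix t f' assume f: "a \<in> Obj M" "b \<in> Obj M" "t \<in> Obj M" "f' \<in> Hom M a (b \<oplus>\<^bsub>M\<^esub> t)" "f = tclass M a b t f'"
  have xf: "Ide M x \<uplus>\<^bsub>M\<^esub> f' \<in> Hom M (x \<oplus>\<^bsub>M\<^esub> a) ((x \<oplus>\<^bsub>M\<^esub> b) \<oplus>\<^bsub>M\<^esub> t)"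
    using M.SumA_Hom[OF M.Ide_Hom[OF x] f(4)] x f by (simp add: M.SumO_assoc)
  note o = \<Phi>_Obj[OF x] \<Phi>_Obj[OF f(2)] \<Phi>_Obj[OF f(3)]
  show ?thesis
    using A.SumA_Ide_left_Comp[OF \<Phi>_Hom_SumO[OF f(4,2,3)] A.proj1_Hom[OF o(2,3)] o(1)] \<Phi>_SumA[OF M.Ide_Hom[OF x] f(4)]
    by (simp add: f(5) M.tSum_Ide_tclass[OF x f(2-4)] E_tclass[OF M.SumO_closed[OF x f(2)] f(3) xf]
        E_tclass[OF f(2-4)] \<Phi>_SumO x f(2) A.proj1_assoc[OF o] \<Phi>_Ide)
qed

lemma E_inc:
  assumes "x \<in> Obj M" "y \<in> Obj M"
  shows "FA E (tSum M (from_Unit (tilde M) x) (tclass M y y (Unit M) (Ide M y)))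
    = from_Unit A (FO \<Phi> x) \<uplus>\<^bsub>A\<^esub> Ide A (FO \<Phi> y)"
  using E_eta[OF M.from_Unit_Ide_Hom[OF assms]] \<Phi>_SumA[OF M.from_Unit_Hom[OF assms(1)] M.Ide_Hom[OF assms(2)]]
  by (simp add: M.tilde_inc assms \<Phi>_from_Unit \<Phi>_Ide)

lemma E_pr:
  assumes "x \<in> Obj M" "y \<in> Obj M"
  shows "FA E (tclass M (x \<oplus>\<^bsub>M\<^esub> y) y x (Sym M x y)) = proj2 A (FO \<Phi> x) (FO \<Phi> y)"
  using E_tclass[OF assms(2,1) M.Sym_Hom[OF assms]] \<Phi>_Sym[OF assms] A.proj1_Sym[OF \<Phi>_Obj \<Phi>_Obj] assms by simp

text \<open>
  Hypothesis 5(b) recovers these arrows from their images under \<open>E\<close>.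
\<close>

definition canonical :: "'b set \<Rightarrow> 'o \<Rightarrow> 'o \<Rightarrow> ('o, 'a) tarrow \<Rightarrow> bool" where
  "canonical C a b c \<longleftrightarrow> (\<exists>t \<in> Obj M. \<exists>f \<in> Hom M a (b \<oplus>\<^bsub>M\<^esub> t).
     c = tclass M a b t f \<and> proj2 A (FO \<Phi> b) (FO \<Phi> t) \<cdot>\<^bsub>A\<^esub> FA \<Phi> f \<in> C)"

end

section \<open>Comparison of \<open>tilde M\<close> and \<open>A\<close> under the
  hypotheses\<close>

locale polynomial_comparison = monoidal_extension M A \<Phi> + B: difference_category B zer sub
  for M :: "('o, 'a) smcat" and A :: "('p, 'b) smcat" and \<Phi> :: "('o, 'a, 'p, 'b) functr"
  and B :: "('q, 'c) cat" and zer sub +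
  fixes C :: "'b set"
  assumes left_factor: "\<lbrakk>f \<in> Hom A p q; g \<in> Hom A q r; g \<cdot>\<^bsub>A\<^esub> f \<in> C\<rbrakk> \<Longrightarrow> f \<in> C"
    and summand: "p \<in> Obj A \<Longrightarrow> \<exists>x \<in> Obj A. \<exists>m \<in> Obj M. isomorphic A (FO \<Phi> m) (p \<oplus>\<^bsub>A\<^esub> x)"
    and complement: "m \<in> Hom M x y \<Longrightarrow>
      \<exists>z \<in> Obj M. \<exists>g \<in> Hom M y (x \<oplus>\<^bsub>M\<^esub> z). g \<cdot>\<^bsub>M\<^esub> m = inj1 M x z"
    and lift: "\<lbrakk>a \<in> Obj M; b \<in> Obj M; f \<in> Hom A (FO \<Phi> a) (FO \<Phi> b)\<rbrakk> \<Longrightarrow>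
      \<exists>t \<in> Obj M. \<exists>\<phi> \<in> Hom M a (b \<oplus>\<^bsub>M\<^esub> t).
        proj1 A (FO \<Phi> b) (FO \<Phi> t) \<cdot>\<^bsub>A\<^esub> FA \<Phi> \<phi> = f \<and> proj2 A (FO \<Phi> b) (FO \<Phi> t) \<cdot>\<^bsub>A\<^esub> FA \<Phi> \<phi> \<in> C"
    and lift_unique: "\<lbrakk>b \<in> Obj M; t \<in> Obj M; t' \<in> Obj M; \<phi> \<in> Hom M a (b \<oplus>\<^bsub>M\<^esub> t); \<phi>' \<in> Hom M a (b \<oplus>\<^bsub>M\<^esub> t');
        proj1 A (FO \<Phi> b) (FO \<Phi> t) \<cdot>\<^bsub>A\<^esub> FA \<Phi> \<phi> = proj1 A (FO \<Phi> b) (FO \<Phi> t') \<cdot>\<^bsub>A\<^esub> FA \<Phi> \<phi>';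
        proj2 A (FO \<Phi> b) (FO \<Phi> t) \<cdot>\<^bsub>A\<^esub> FA \<Phi> \<phi> \<in> C; proj2 A (FO \<Phi> b) (FO \<Phi> t') \<cdot>\<^bsub>A\<^esub> FA \<Phi> \<phi>' \<in> C\<rbrakk> \<Longrightarrow>
      \<exists>u \<in> Obj M. \<exists>\<psi> \<in> Hom M t u. \<exists>\<psi>' \<in> Hom M t' u.
        (Ide M b \<uplus>\<^bsub>M\<^esub> \<psi>) \<cdot>\<^bsub>M\<^esub> \<phi> = (Ide M b \<uplus>\<^bsub>M\<^esub> \<psi>') \<cdot>\<^bsub>M\<^esub> \<phi>'"
begin

text \<open>The arrows \<open>\<psi>\<close> and \<open>\<psi>'\<close> of hypothesis 5(b) act on
  the discarded objects, and a common result of these actions means equality of classes in the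
  colimit.\<close>

lemma canonical_eq:
  assumes "b \<in> Obj M" "canonical C a b c" "canonical C a b c'" "FA E c = FA E c'"
  shows "c = c'"
proof -
  obtain t f where f: "t \<in> Obj M" "f \<in> Hom M a (b \<oplus>\<^bsub>M\<^esub> t)" "c = tclass M a b t f"
    "proj2 A (FO \<Phi> b) (FO \<Phi> t) \<cdot>\<^bsub>A\<^esub> FA \<Phi> f \<in> C"
    using assms(2) unfolding canonical_def by blast
  obtain t' f' where f': "t' \<in> Obj M" "f' \<in> Hom M a (b \<oplus>\<^bsub>M\<^esub> t')" "c' = tclass M a b t' f'"
    "proj2 A (FO \<Phi> b) (FO \<Phi> t') \<cdot>\<^bsub>A\<^esub> FA \<Phi> f' \<in> C"
    using assms(3) unfolding canonical_def by blast
  have "proj1 A (FO \<Phi> b) (FO \<Phi> t) \<cdot>\<^bsub>A\<^esub> FA \<Phi> f = proj1 A (FO \<Phi> b) (FO \<Phi> t') \<cdot>\<^bsub>A\<^esub> FA \<Phi> f'"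
    using assms(4) f f' E_tclass[OF assms(1)] by simp
  from lift_unique[OF assms(1) f(1) f'(1) f(2) f'(2) this f(4) f'(4)]
  obtain u \<psi> \<psi>' where "\<psi> \<in> Hom M t u" "\<psi>' \<in> Hom M t' u"
    "(Ide M b \<uplus>\<^bsub>M\<^esub> \<psi>) \<cdot>\<^bsub>M\<^esub> f = (Ide M b \<uplus>\<^bsub>M\<^esub> \<psi>') \<cdot>\<^bsub>M\<^esub> f'" by blast
  then show ?thesis using M.tclass_step[OF f(2)] M.tclass_step[OF f'(2)] f(3) f'(3) by simp
qed

text \<open>The composite discards \<open>v \<oplus> u\<close>. Projecting its component there
  further to \<open>u\<close> returns the discarded component of \<open>c\<close>, which lies in
  \<open>C\<close>; by hypothesis 1 the component at \<open>v \<oplus> u\<close> lies in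
  \<open>C\<close> as well.\<close>

lemma canonical_Comp:
  assumes b: "b \<in> Obj M" and c: "canonical C a b c" and g: "g \<in> Hom (tilde M) b d"
  shows "canonical C a d (tComp M g c)"
proof -
  obtain u f where f: "u \<in> Obj M" "f \<in> Hom M a (b \<oplus>\<^bsub>M\<^esub> u)" "c = tclass M a b u f"
    "proj2 A (FO \<Phi> b) (FO \<Phi> u) \<cdot>\<^bsub>A\<^esub> FA \<Phi> f \<in> C"
    using c unfolding canonical_def by blast
  from g show ?thesis
  proof (rule M.tilde_HomE)
    fix v g' assume g: "d \<in> Obj M" "v \<in> Obj M" "g' \<in> Hom M b (d \<oplus>\<^bsub>M\<^esub> v)" "g = tclass M b d v g'"
    note o = \<Phi>_Obj[OF b] \<Phi>_Obj[OF f(1)] \<Phi>_Obj[OF g(1)] \<Phi>_Obj[OF g(2)]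
    define k where "k = (g' \<uplus>\<^bsub>M\<^esub> Ide M u) \<cdot>\<^bsub>M\<^esub> f"
    have k: "k \<in> Hom M a (d \<oplus>\<^bsub>M\<^esub> (v \<oplus>\<^bsub>M\<^esub> u))" unfolding k_def by (rule M.tcomp_Hom[OF g(1,2) f(1) g(3) f(2)])
    note F = \<Phi>_Hom_SumO[OF f(2) b f(1)] and G = \<Phi>_Hom_SumO[OF g(3,1,2)]
    note Gu = A.SumA_Hom[OF G A.Ide_Hom[OF o(2)]]
    have ke: "FA \<Phi> k = (FA \<Phi> g' \<uplus>\<^bsub>A\<^esub> Ide A (FO \<Phi> u)) \<cdot>\<^bsub>A\<^esub> FA \<Phi> f"
      unfolding k_def
      using \<Phi>_Comp[OF f(2) M.SumA_Hom[OF g(3) M.Ide_Hom[OF f(1)]]] \<Phi>_SumA[OF g(3) M.Ide_Hom[OF f(1)]]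
      by (simp add: \<Phi>_Ide[OF f(1)])
    have kH: "FA \<Phi> k \<in> Hom A (FO \<Phi> a) (FO \<Phi> d \<oplus>\<^bsub>A\<^esub> (FO \<Phi> v \<oplus>\<^bsub>A\<^esub> FO \<Phi> u))"
      using \<Phi>_Hom_SumO[OF k g(1) M.SumO_closed[OF g(2) f(1)]] by (simp add: \<Phi>_SumO g(2) f(1))
    note p = A.proj2_Hom[OF o(3) A.SumO_closed[OF o(4,2)]] and p' = A.proj2_Hom[OF o(4,2)]
    have "proj2 A (FO \<Phi> v) (FO \<Phi> u) \<cdot>\<^bsub>A\<^esub> (proj2 A (FO \<Phi> d) (FO \<Phi> v \<oplus>\<^bsub>A\<^esub> FO \<Phi> u) \<cdot>\<^bsub>A\<^esub> FA \<Phi> k)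
      = (proj2 A (FO \<Phi> d \<oplus>\<^bsub>A\<^esub> FO \<Phi> v) (FO \<Phi> u) \<cdot>\<^bsub>A\<^esub> (FA \<Phi> g' \<uplus>\<^bsub>A\<^esub> Ide A (FO \<Phi> u))) \<cdot>\<^bsub>A\<^esub> FA \<Phi> f"
      using A.Comp_assoc[OF kH p p'] A.proj2_proj2[OF o(3,4,2)]
        A.Comp_assoc[OF F Gu A.proj2_Hom[OF A.SumO_closed[OF o(3,4)] o(2)]] by (simp add: ke)
    also have "\<dots> = proj2 A (FO \<Phi> b) (FO \<Phi> u) \<cdot>\<^bsub>A\<^esub> FA \<Phi> f"
      using A.proj2_nat[OF G A.Ide_Hom[OF o(2)]] A.Comp_Ide_left[OF A.proj2_Hom[OF o(1,2)]] by simp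
    finally have "proj2 A (FO \<Phi> d) (FO \<Phi> (v \<oplus>\<^bsub>M\<^esub> u)) \<cdot>\<^bsub>A\<^esub> FA \<Phi> k \<in> C"
      using left_factor[OF A.Comp_Hom[OF kH p] p'] f(4) by (simp add: \<Phi>_SumO g(2) f(1))
    moreover have "tComp M g c = tclass M a d (v \<oplus>\<^bsub>M\<^esub> u) k"
      using M.tComp_tclass[OF b g(1,2) f(1) g(3) f(2)] by (simp add: g(4) f(3) k_def)
    ultimately show ?thesis unfolding canonical_def using k M.SumO_closed[OF g(2) f(1)] by blast
  qed
qed

sublocale T: shift_functors "tilde M" "\<lambda>x y. tclass M (x \<oplus>\<^bsub>M\<^esub> y) y x (Sym M x y)" B zer sub
  by (intro shift_functors.intro M.tilde_shift_category B.difference_category_axioms)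

sublocale N: shift_functors_nul A B zer sub
  by (intro shift_functors_nul.intro A.Mon_nul_axioms B.difference_category_axioms)

sublocale shift_morphism "tilde M" "\<lambda>x y. tclass M (x \<oplus>\<^bsub>M\<^esub> y) y x (Sym M x y)" A "proj2 A" B zer sub E
  using E_functor E_shift E_inc E_pr by unfold_locales (simp_all add: \<Phi>_SumO)

lemma A_retract:
  assumes a: "a \<in> Obj A"
  shows "\<exists>m \<in> Obj M. \<exists>s \<in> Hom A a (FO \<Phi> m). \<exists>r \<in> Hom A (FO \<Phi> m) a. r \<cdot>\<^bsub>A\<^esub> s = Ide A a"
proof -
  obtain x m i where x: "x \<in> Obj A" and m: "m \<in> Obj M" and i: "i \<in> Hom A (FO \<Phi> m) (a \<oplus>\<^bsub>A\<^esub> x)" "is_iso A i"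
    using summand[OF a] unfolding isomorphic_def by blast
  obtain j where j: "j \<in> Hom A (a \<oplus>\<^bsub>A\<^esub> x) (FO \<Phi> m)" "i \<cdot>\<^bsub>A\<^esub> j = Ide A (a \<oplus>\<^bsub>A\<^esub> x)"
    using A.is_isoE[OF i(2,1)] by blast
  note p = A.proj1_Hom[OF a x] and n = A.inj1_Hom[OF a x]
  have "(proj1 A a x \<cdot>\<^bsub>A\<^esub> i) \<cdot>\<^bsub>A\<^esub> (j \<cdot>\<^bsub>A\<^esub> inj1 A a x) = proj1 A a x \<cdot>\<^bsub>A\<^esub> ((i \<cdot>\<^bsub>A\<^esub> j) \<cdot>\<^bsub>A\<^esub> inj1 A a x)"
    using A.Comp_assoc[OF A.Comp_Hom[OF n j(1)] i(1) p] A.Comp_assoc[OF n j(1) i(1)] by simp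
  also have "\<dots> = Ide A a" using A.Comp_Ide_left[OF n] j(2) A.proj1_inj1[OF a x] by simp
  finally show ?thesis using m A.Comp_Hom[OF n j(1)] A.Comp_Hom[OF i(1) p] by blast
qed

sublocale dense_full_functor "tilde M" A E
proof
  show "is_functor (tilde M) A E" by (rule E_functor)
  show "\<exists>f \<in> Hom (tilde M) a b. FA E f = h"
    if "a \<in> Obj (tilde M)" "b \<in> Obj (tilde M)" "h \<in> Hom A (FO E a) (FO E b)" for a b h
  proof -
    have a: "a \<in> Obj M" and b: "b \<in> Obj M" and h: "h \<in> Hom A (FO \<Phi> a) (FO \<Phi> b)" using that by auto
    obtain t \<phi> where "t \<in> Obj M" "\<phi> \<in> Hom M a (b \<oplus>\<^bsub>M\<^esub> t)" "proj1 A (FO \<Phi> b) (FO \<Phi> t) \<cdot>\<^bsub>A\<^esub> FA \<Phi> \<phi> = h"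
      using lift[OF a b h] by blast
    then show ?thesis using E_tclass[OF b] M.tclass_Hom[OF b] by blast
  qed
  show "\<exists>c \<in> Obj (tilde M). \<exists>s \<in> Hom A d (FO E c). \<exists>r \<in> Hom A (FO E c) d. r \<cdot>\<^bsub>A\<^esub> s = Ide A d"
    if "d \<in> Obj A" for d
    using A_retract[OF that] by simp
qed

text \<open>This is 5(a) for the identity with the two summands exchanged, so that \<open>t\<close>
  stands on the left as in \<open>power_sum\<close>.\<close>

lemma splitting_arrow:
  assumes a: "a \<in> Obj M"
  obtains t \<sigma> where "t \<in> Obj M" "\<sigma> \<in> Hom M a (t \<oplus>\<^bsub>M\<^esub> a)"
    "proj1 A (FO \<Phi> t) (FO \<Phi> a) \<cdot>\<^bsub>A\<^esub> FA \<Phi> \<sigma> \<in> C"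
    "proj2 A (FO \<Phi> t) (FO \<Phi> a) \<cdot>\<^bsub>A\<^esub> FA \<Phi> \<sigma> = Ide A (FO \<Phi> a)"
proof -
  note \<Phi>a = \<Phi>_Obj[OF a]
  obtain t \<phi> where t: "t \<in> Obj M" and \<phi>: "\<phi> \<in> Hom M a (a \<oplus>\<^bsub>M\<^esub> t)"
    and 1: "proj1 A (FO \<Phi> a) (FO \<Phi> t) \<cdot>\<^bsub>A\<^esub> FA \<Phi> \<phi> = Ide A (FO \<Phi> a)"
    and 2: "proj2 A (FO \<Phi> a) (FO \<Phi> t) \<cdot>\<^bsub>A\<^esub> FA \<Phi> \<phi> \<in> C"
    using lift[OF a a A.Ide_Hom[OF \<Phi>a]] by blast
  note \<Phi>t = \<Phi>_Obj[OF t]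
  note S = M.Sym_Hom[OF a t] and S' = A.Sym_Hom[OF \<Phi>a \<Phi>t] and P = \<Phi>_Hom_SumO[OF \<phi> a t]
  have e: "FA \<Phi> (Sym M a t \<cdot>\<^bsub>M\<^esub> \<phi>) = Sym A (FO \<Phi> a) (FO \<Phi> t) \<cdot>\<^bsub>A\<^esub> FA \<Phi> \<phi>"
    using \<Phi>_Comp[OF \<phi> S] \<Phi>_Sym[OF a t] by simp
  show ?thesis
  proof (rule that[OF t M.Comp_Hom[OF \<phi> S]])
    show "proj1 A (FO \<Phi> t) (FO \<Phi> a) \<cdot>\<^bsub>A\<^esub> FA \<Phi> (Sym M a t \<cdot>\<^bsub>M\<^esub> \<phi>) \<in> C"
      using 2 A.Comp_assoc[OF P S' A.proj1_Hom[OF \<Phi>t \<Phi>a]] A.proj1_Sym[OF \<Phi>a \<Phi>t] by (simp add: e)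
    show "proj2 A (FO \<Phi> t) (FO \<Phi> a) \<cdot>\<^bsub>A\<^esub> FA \<Phi> (Sym M a t \<cdot>\<^bsub>M\<^esub> \<phi>) = Ide A (FO \<Phi> a)"
      using 1 A.Comp_assoc[OF P S' A.proj2_Hom[OF \<Phi>t \<Phi>a]] A.proj2_Sym[OF \<Phi>a \<Phi>t] by (simp add: e)
  qed
qed

text \<open>An arrow \<open>\<alpha>\<close> for \<open>k\<close> copies yields
  \<open>(t \<oplus> \<alpha>) \<cdot> \<sigma>\<close> for one more. A partial projection kills the
  new copy, or acts on the old ones, or does both. When it kills the new copy, the discarded
  component is that of \<open>\<sigma>\<close> at \<open>t\<close>, which lies in \<open>C\<close>;
  when it acts on the old ones, the component of \<open>\<sigma>\<close> at \<open>a\<close> is an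
  identity and the discarded component is the one from the induction hypothesis.\<close>

lemma canonical_diagonal:
  assumes a: "a \<in> Obj M" and t: "t \<in> Obj M" and \<sigma>: "\<sigma> \<in> Hom M a (t \<oplus>\<^bsub>M\<^esub> a)"
    and \<sigma>1: "proj1 A (FO \<Phi> t) (FO \<Phi> a) \<cdot>\<^bsub>A\<^esub> FA \<Phi> \<sigma> \<in> C"
    and \<sigma>2: "proj2 A (FO \<Phi> t) (FO \<Phi> a) \<cdot>\<^bsub>A\<^esub> FA \<Phi> \<sigma> = Ide A (FO \<Phi> a)"
  shows "\<exists>\<alpha> \<in> Hom M a (T.power_sum t a k). \<forall>e \<in> T.partial_projections t a k.
    canonical C a (T.power_sum t a k) (tComp M e (tclass M a (T.power_sum t a k) (Unit M) \<alpha>))"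
proof (induction k)
  \<comment> \<open>With no copies of \<open>t\<close> there is nothing to kill, and the identity of
    \<open>a\<close> serves as \<open>\<alpha>\<close>.\<close>
  case 0
  then show ?case using M.Ide_Hom[OF a] by auto
next
  case (Suc k)
  define Y where "Y = T.power_sum t a k"
  have Y: "Y \<in> Obj M" unfolding Y_def using T.power_sum_Obj a t by simp
  obtain \<alpha> where \<alpha>: "\<alpha> \<in> Hom M a Y"
    and IH: "\<And>e. e \<in> T.partial_projections t a k \<Longrightarrow> canonical C a Y (tComp M e (tclass M a Y (Unit M) \<alpha>))"
    using Suc unfolding Y_def by blast
  define \<beta> where "\<beta> = (Ide M t \<uplus>\<^bsub>M\<^esub> \<alpha>) \<cdot>\<^bsub>M\<^esub> \<sigma>"
  have t\<alpha>: "Ide M t \<uplus>\<^bsub>M\<^esub> \<alpha> \<in> Hom M (t \<oplus>\<^bsub>M\<^esub> a) (t \<oplus>\<^bsub>M\<^esub> Y)" using M.SumA_Hom[OF M.Ide_Hom[OF t] \<alpha>] .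
  have \<beta>: "\<beta> \<in> Hom M a (t \<oplus>\<^bsub>M\<^esub> Y)" unfolding \<beta>_def by (rule M.Comp_Hom[OF \<sigma> t\<alpha>])
  have tY: "t \<oplus>\<^bsub>M\<^esub> Y \<in> Obj M" using M.SumO_closed[OF t Y] .
  note o = \<Phi>_Obj[OF t] \<Phi>_Obj[OF Y] \<Phi>_Obj[OF a]
  note \<Phi>\<sigma> = \<Phi>_Hom_SumO[OF \<sigma> t a]
  define \<eta> where "\<eta> = tclass M a (t \<oplus>\<^bsub>M\<^esub> Y) (Unit M) \<beta>"
  have \<eta>: "\<eta> \<in> Hom (tilde M) a (t \<oplus>\<^bsub>M\<^esub> Y)"
    using M.eta_Hom[OF \<beta>] by (simp add: \<eta>_def M.HomD[OF \<beta>])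
  define inc where "inc = tSum M (from_Unit (tilde M) t) (tclass M Y Y (Unit M) (Ide M Y))"
  define pr where "pr = tclass M (t \<oplus>\<^bsub>M\<^esub> Y) Y t (Sym M t Y)"
  have incH: "inc \<in> Hom (tilde M) Y (t \<oplus>\<^bsub>M\<^esub> Y)" and prH: "pr \<in> Hom (tilde M) (t \<oplus>\<^bsub>M\<^esub> Y) Y"
    using T.inc_Hom[of t Y] T.pr_Hom[of t Y] t Y by (simp_all add: inc_def pr_def)
  have ip: "tComp M inc pr \<in> Hom (tilde M) (t \<oplus>\<^bsub>M\<^esub> Y) (t \<oplus>\<^bsub>M\<^esub> Y)"
    using T.Comp_Hom[OF prH incH] by simp
  have c1: "canonical C a (t \<oplus>\<^bsub>M\<^esub> Y) (tComp M (tComp M inc pr) \<eta>)"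
  proof -
    \<comment> \<open>The retraction \<open>pr\<close> discards \<open>t\<close>, so the composite
      is represented by \<open>\<beta>\<close> with its summands exchanged. Its discarded component
      is \<open>proj1\<close> of \<open>\<beta>\<close>, which does not see \<open>\<alpha>\<close>
      and equals that of \<open>\<sigma>\<close>.\<close>
    have pe: "tComp M pr \<eta> = tclass M a Y t (Sym M t Y \<cdot>\<^bsub>M\<^esub> \<beta>)"
      using M.tclass_Comp_eta[OF Y t M.Sym_Hom[OF t Y] \<beta>] by (simp add: pr_def \<eta>_def M.HomD[OF \<beta>])
    have "FA \<Phi> (Sym M t Y \<cdot>\<^bsub>M\<^esub> \<beta>) = Sym A (FO \<Phi> t) (FO \<Phi> Y) \<cdot>\<^bsub>A\<^esub> ((Ide A (FO \<Phi> t) \<uplus>\<^bsub>A\<^esub> FA \<Phi> \<alpha>) \<cdot>\<^bsub>A\<^esub> FA \<Phi> \<sigma>)"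
      unfolding \<beta>_def using \<Phi>_Comp[OF M.Comp_Hom[OF \<sigma> t\<alpha>] M.Sym_Hom[OF t Y]] \<Phi>_Comp[OF \<sigma> t\<alpha>]
        \<Phi>_SumA[OF M.Ide_Hom[OF t] \<alpha>] \<Phi>_Ide[OF t] \<Phi>_Sym[OF t Y] by simp
    moreover note ta = A.SumA_Hom[OF A.Ide_Hom[OF o(1)] \<Phi>_Hom[OF \<alpha>]]
    ultimately have "proj2 A (FO \<Phi> Y) (FO \<Phi> t) \<cdot>\<^bsub>A\<^esub> FA \<Phi> (Sym M t Y \<cdot>\<^bsub>M\<^esub> \<beta>)
        = (proj1 A (FO \<Phi> t) (FO \<Phi> Y) \<cdot>\<^bsub>A\<^esub> (Ide A (FO \<Phi> t) \<uplus>\<^bsub>A\<^esub> FA \<Phi> \<alpha>)) \<cdot>\<^bsub>A\<^esub> FA \<Phi> \<sigma>"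
      using A.Comp_assoc[OF A.Comp_Hom[OF \<Phi>\<sigma> ta] A.Sym_Hom[OF o(1,2)] A.proj2_Hom[OF o(2,1)]]
        A.Comp_assoc[OF \<Phi>\<sigma> ta A.proj1_Hom[OF o(1,2)]] A.proj2_Sym[OF o(1,2)] by simp
    also have "\<dots> = proj1 A (FO \<Phi> t) (FO \<Phi> a) \<cdot>\<^bsub>A\<^esub> FA \<Phi> \<sigma>"
      using A.proj1_nat[OF A.Ide_Hom[OF o(1)] \<Phi>_Hom[OF \<alpha>]] A.Comp_Ide_left[OF A.proj1_Hom[OF o(1,3)]] by simp
    finally have "canonical C a Y (tComp M pr \<eta>)"
      unfolding pe canonical_def
      using \<sigma>1 t M.Comp_Hom[OF \<beta> M.Sym_Hom[OF t Y]]
      by (intro bexI[of _ t] bexI[of _ "Sym M t Y \<cdot>\<^bsub>M\<^esub> \<beta>"]) simp_all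
    then have "canonical C a (t \<oplus>\<^bsub>M\<^esub> Y) (tComp M inc (tComp M pr \<eta>))" by (rule canonical_Comp[OF Y _ incH])
    then show ?thesis using T.Comp_assoc[OF \<eta> prH incH] by simp
  qed
  have c2: "canonical C a (t \<oplus>\<^bsub>M\<^esub> Y) (tComp M (tSum M (tclass M t t (Unit M) (Ide M t)) e) \<eta>)"
    if e: "e \<in> T.partial_projections t a k" for e
  proof -
    have eH: "e \<in> Hom (tilde M) Y Y" using T.partial_projections_Hom[OF _ _ e] a t by (simp add: Y_def)
    define \<eta>\<alpha> where "\<eta>\<alpha> = tclass M a Y (Unit M) \<alpha>"
    have \<eta>\<alpha>: "\<eta>\<alpha> \<in> Hom (tilde M) a Y" using M.eta_Hom[OF \<alpha>] by (simp add: \<eta>\<alpha>_def M.HomD[OF \<alpha>])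
    obtain u f where u: "u \<in> Obj M" and f: "f \<in> Hom M a (Y \<oplus>\<^bsub>M\<^esub> u)" and fe: "tComp M e \<eta>\<alpha> = tclass M a Y u f"
      and fC: "proj2 A (FO \<Phi> Y) (FO \<Phi> u) \<cdot>\<^bsub>A\<^esub> FA \<Phi> f \<in> C"
      using IH[OF e] unfolding canonical_def \<eta>\<alpha>_def by blast
    note \<Phi>u = \<Phi>_Obj[OF u]
    define \<eta>\<sigma> where "\<eta>\<sigma> = tclass M a (t \<oplus>\<^bsub>M\<^esub> a) (Unit M) \<sigma>"
    have \<eta>\<sigma>: "\<eta>\<sigma> \<in> Hom (tilde M) a (t \<oplus>\<^bsub>M\<^esub> a)" using M.eta_Hom[OF \<sigma>] by (simp add: \<eta>\<sigma>_def M.HomD[OF \<sigma>])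
    let ?It = "tclass M t t (Unit M) (Ide M t)"
    have t\<eta>: "tSum M ?It \<eta>\<alpha> = tclass M (t \<oplus>\<^bsub>M\<^esub> a) (t \<oplus>\<^bsub>M\<^esub> Y) (Unit M) (Ide M t \<uplus>\<^bsub>M\<^esub> \<alpha>)"
      using M.tSum_Ide_tclass[OF t Y M.Unit_closed, of \<alpha> a] \<alpha> by (simp add: \<eta>\<alpha>_def M.SumO_Unit_right Y)
    \<comment> \<open>Writing \<open>\<eta>\<close> as
      \<open>(t \<oplus> \<alpha>) \<cdot> \<sigma>\<close> inside \<open>tilde M\<close> lets
      \<open>e\<close> act on \<open>\<alpha>\<close> alone, where the induction hypothesis supplies
      the representative \<open>f\<close>.\<close>
    have "\<eta> = tComp M (tSum M ?It \<eta>\<alpha>) \<eta>\<sigma>"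
      using M.tclass_Comp_eta[OF tY M.Unit_closed _ \<sigma>, of "Ide M t \<uplus>\<^bsub>M\<^esub> \<alpha>"] t\<alpha>
      by (simp add: t\<eta> \<eta>\<sigma>_def M.HomD[OF \<sigma>] M.SumO_Unit_right tY \<eta>_def \<beta>_def)
    then have "tComp M (tSum M ?It e) \<eta> = tComp M (tComp M (tSum M ?It e) (tSum M ?It \<eta>\<alpha>)) \<eta>\<sigma>"
      using T.Comp_assoc[OF \<eta>\<sigma> M.tilde_shift_Hom[OF t \<eta>\<alpha>] M.tilde_shift_Hom[OF t eH]] by simp
    also have "tComp M (tSum M ?It e) (tSum M ?It \<eta>\<alpha>) = tSum M ?It (tclass M a Y u f)"
      using T.shift_Comp[of t, OF _ \<eta>\<alpha> eH] t fe by simp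
    also have "\<dots> = tclass M (t \<oplus>\<^bsub>M\<^esub> a) (t \<oplus>\<^bsub>M\<^esub> Y) u (Ide M t \<uplus>\<^bsub>M\<^esub> f)" by (rule M.tSum_Ide_tclass[OF t Y u f])
    also have tf: "Ide M t \<uplus>\<^bsub>M\<^esub> f \<in> Hom M (t \<oplus>\<^bsub>M\<^esub> a) ((t \<oplus>\<^bsub>M\<^esub> Y) \<oplus>\<^bsub>M\<^esub> u)"
      using M.SumA_Hom[OF M.Ide_Hom[OF t] f] by (simp add: M.SumO_assoc t Y u)
    have "tComp M (tclass M (t \<oplus>\<^bsub>M\<^esub> a) (t \<oplus>\<^bsub>M\<^esub> Y) u (Ide M t \<uplus>\<^bsub>M\<^esub> f)) \<eta>\<sigma>
        = tclass M a (t \<oplus>\<^bsub>M\<^esub> Y) u ((Ide M t \<uplus>\<^bsub>M\<^esub> f) \<cdot>\<^bsub>M\<^esub> \<sigma>)"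
      using M.tclass_Comp_eta[OF tY u tf \<sigma>] by (simp add: \<eta>\<sigma>_def M.HomD[OF \<sigma>])
    finally have e1: "tComp M (tSum M ?It e) \<eta> = tclass M a (t \<oplus>\<^bsub>M\<^esub> Y) u ((Ide M t \<uplus>\<^bsub>M\<^esub> f) \<cdot>\<^bsub>M\<^esub> \<sigma>)" .
    note \<Phi>f = \<Phi>_Hom_SumO[OF f Y u]
    note tf' = A.SumA_Hom[OF A.Ide_Hom[OF o(1)] \<Phi>f] and q = A.proj2_Hom[OF o(1) A.SumO_closed[OF o(2) \<Phi>u]]
      and q' = A.proj2_Hom[OF o(2) \<Phi>u]
    have "FA \<Phi> ((Ide M t \<uplus>\<^bsub>M\<^esub> f) \<cdot>\<^bsub>M\<^esub> \<sigma>) = (Ide A (FO \<Phi> t) \<uplus>\<^bsub>A\<^esub> FA \<Phi> f) \<cdot>\<^bsub>A\<^esub> FA \<Phi> \<sigma>"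
      using \<Phi>_Comp[OF \<sigma> M.SumA_Hom[OF M.Ide_Hom[OF t] f]] \<Phi>_SumA[OF M.Ide_Hom[OF t] f] \<Phi>_Ide[OF t] by simp
    then have "proj2 A (FO \<Phi> (t \<oplus>\<^bsub>M\<^esub> Y)) (FO \<Phi> u) \<cdot>\<^bsub>A\<^esub> FA \<Phi> ((Ide M t \<uplus>\<^bsub>M\<^esub> f) \<cdot>\<^bsub>M\<^esub> \<sigma>)
        = proj2 A (FO \<Phi> Y) (FO \<Phi> u) \<cdot>\<^bsub>A\<^esub> ((proj2 A (FO \<Phi> t) (FO \<Phi> Y \<oplus>\<^bsub>A\<^esub> FO \<Phi> u) \<cdot>\<^bsub>A\<^esub>
            (Ide A (FO \<Phi> t) \<uplus>\<^bsub>A\<^esub> FA \<Phi> f)) \<cdot>\<^bsub>A\<^esub> FA \<Phi> \<sigma>)"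
      using A.Comp_assoc[OF A.Comp_Hom[OF \<Phi>\<sigma> tf'] q q'] A.Comp_assoc[OF \<Phi>\<sigma> tf' q] A.proj2_proj2[OF o(1,2) \<Phi>u]
      by (simp add: \<Phi>_SumO t Y)
    also have "\<dots> = proj2 A (FO \<Phi> Y) (FO \<Phi> u) \<cdot>\<^bsub>A\<^esub> FA \<Phi> f"
      using A.proj2_nat[OF A.Ide_Hom[OF o(1)] \<Phi>f] A.Comp_assoc[OF \<Phi>\<sigma> A.proj2_Hom[OF o(1,3)] \<Phi>f] \<sigma>2
        A.Comp_Ide_right[OF \<Phi>f] by simp
    finally show ?thesis
      unfolding canonical_def e1
      using fC u M.Comp_Hom[OF \<sigma> tf]
      by (intro bexI[of _ u] bexI[of _ "(Ide M t \<uplus>\<^bsub>M\<^esub> f) \<cdot>\<^bsub>M\<^esub> \<sigma>"]) simp_all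
  qed
  have c3: "canonical C a (t \<oplus>\<^bsub>M\<^esub> Y) (tComp M e \<eta>)" if "e \<in> T.partial_projections t a (Suc k)" for e
  proof -
    consider "e = tComp M inc pr"
      | e' where "e' \<in> T.partial_projections t a k" "e = tSum M (tclass M t t (Unit M) (Ide M t)) e'"
      | e' where "e' \<in> T.partial_projections t a k"
          "e = tComp M (tComp M inc pr) (tSum M (tclass M t t (Unit M) (Ide M t)) e')"
      using \<open>e \<in> _\<close> by (auto simp: Let_def inc_def pr_def Y_def)
    then show ?thesis
    proof cases
      case 1 then show ?thesis using c1 by simp
    next
      case 2 then show ?thesis using c2 by simp
    next
      \<comment> \<open>Both kinds at once: canonical arrows are stable under postcomposition, so
        killing the new copy after the others needs no new computation.\<close>
      case 3
      have eH: "e' \<in> Hom (tilde M) Y Y" using T.partial_projections_Hom[OF _ _ 3(1)] a t by (simp add: Y_def)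
      show ?thesis
        using canonical_Comp[OF tY c2[OF 3(1)] ip] T.Comp_assoc[OF \<eta> M.tilde_shift_Hom[OF t eH] ip] 3(2) by simp
    qed
  qed
  have "T.power_sum t a (Suc k) = t \<oplus>\<^bsub>M\<^esub> Y" by (simp add: Y_def)
  then show ?case using \<beta> c3 unfolding \<eta>_def by (intro bexI[of _ \<beta>] ballI) simp_all
qed

text \<open>In \<open>zero_of_partial_projections\<close>, \<open>\<theta>\<close> is the identity,
  \<open>g\<close> the image of the class \<open>\<eta>\<close> of \<open>\<alpha>\<close>, and
  \<open>d\<close> the difference of the images of \<open>\<phi> p\<close> and
  \<open>\<phi>' p\<close>. As \<open>p\<close> is a left inverse of \<open>\<eta>\<close>, the
  composite shown to vanish is the difference of \<open>F(\<phi>)\<close> and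
  \<open>F(\<phi>')\<close>.\<close>

lemma polynomial_functor_factors:
  assumes F: "is_functor (tilde M) B F" and van: "T.vanishes (Obj M) k F (\<lambda>y. Ide B (FO F y))"
    and \<phi>: "\<phi> \<in> Hom (tilde M) a b" and \<phi>': "\<phi>' \<in> Hom (tilde M) a b" and eq: "FA E \<phi> = FA E \<phi>'"
  shows "FA F \<phi> = FA F \<phi>'"
proof -
  have a: "a \<in> Obj M" and b: "b \<in> Obj M" using T.HomD[OF \<phi>] by auto
  obtain t \<sigma> where t: "t \<in> Obj M" and \<sigma>: "\<sigma> \<in> Hom M a (t \<oplus>\<^bsub>M\<^esub> a)"
    "proj1 A (FO \<Phi> t) (FO \<Phi> a) \<cdot>\<^bsub>A\<^esub> FA \<Phi> \<sigma> \<in> C" "proj2 A (FO \<Phi> t) (FO \<Phi> a) \<cdot>\<^bsub>A\<^esub> FA \<Phi> \<sigma> = Ide A (FO \<Phi> a)"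
    using splitting_arrow[OF a] .
  define Y where "Y = T.power_sum t a k"
  have Y: "Y \<in> Obj M" unfolding Y_def using T.power_sum_Obj a t by simp
  obtain \<alpha> where \<alpha>: "\<alpha> \<in> Hom M a Y"
    and can: "\<And>e. e \<in> T.partial_projections t a k \<Longrightarrow> canonical C a Y (tComp M e (tclass M a Y (Unit M) \<alpha>))"
    using canonical_diagonal[OF a t \<sigma>, of k] unfolding Y_def by blast
  define \<eta> where "\<eta> = tclass M a Y (Unit M) \<alpha>"
  have \<eta>: "\<eta> \<in> Hom (tilde M) a Y" using M.eta_Hom[OF \<alpha>] by (simp add: \<eta>_def M.HomD[OF \<alpha>])
  obtain z \<psi> where z: "z \<in> Obj M" and \<psi>: "\<psi> \<in> Hom M Y (a \<oplus>\<^bsub>M\<^esub> z)" and \<psi>\<alpha>: "\<psi> \<cdot>\<^bsub>M\<^esub> \<alpha> = inj1 M a z"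
    using complement[OF \<alpha>] by blast
  define p where "p = tclass M Y a z \<psi>"
  have p: "p \<in> Hom (tilde M) Y a" unfolding p_def by (rule M.tclass_Hom[OF a z \<psi>])
  \<comment> \<open>The canonical arrow \<open>a -> a \<oplus> z\<close> is the result of letting
    \<open>0 -> z\<close> act on the identity, so in the colimit it is the identity of
    \<open>a\<close>.\<close>
  have p\<eta>: "tComp M p \<eta> = tclass M a a (Unit M) (Ide M a)"
  proof -
    have "tComp M p \<eta> = tclass M a a z (inj1 M a z)"
      using M.tclass_Comp_eta[OF a z \<psi> \<alpha>] by (simp add: p_def \<eta>_def M.HomD[OF \<alpha>] \<psi>\<alpha>)
    moreover have "Ide M a \<in> Hom M a (a \<oplus>\<^bsub>M\<^esub> Unit M)" using M.Ide_Hom[OF a] by (simp add: M.SumO_Unit_right a)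
    ultimately show ?thesis
      using M.tclass_step[of "Ide M a" a a "Unit M" "from_Unit M z" z] M.from_Unit_Hom[OF z]
        M.Comp_Ide_right[OF M.inj1_Hom[OF a z]] by (simp add: inj1_def)
  qed
  have factor: "tComp M (tComp M \<chi> p) \<eta> = \<chi>" if "\<chi> \<in> Hom (tilde M) a b" for \<chi>
    using T.Comp_assoc[OF \<eta> p that] T.Comp_Ide_right[OF that] p\<eta> by simp
  define \<beta> where "\<beta> = tComp M \<phi> p"
  define \<beta>' where "\<beta>' = tComp M \<phi>' p"
  have \<beta>: "\<beta> \<in> Hom (tilde M) Y b" and \<beta>': "\<beta>' \<in> Hom (tilde M) Y b"
    using T.Comp_Hom[OF p \<phi>] T.Comp_Hom[OF p \<phi>'] by (simp_all add: \<beta>_def \<beta>'_def)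
  have E\<beta>: "FA E \<beta> = FA E \<beta>'"
    using functor_Comp[OF E_functor p \<phi>] functor_Comp[OF E_functor p \<phi>'] eq by (simp add: \<beta>_def \<beta>'_def)
  note F\<beta> = functor_Hom[OF F \<beta>] and F\<beta>' = functor_Hom[OF F \<beta>'] and F\<eta> = functor_Hom[OF F \<eta>]
  define d where "d = sub (FA F \<beta>) (FA F \<beta>')"
  have d: "d \<in> Hom B (FO F Y) (FO F b)" unfolding d_def by (rule B.sub_Hom[OF F\<beta> F\<beta>'])
  have FY: "Ide B (FO F y) \<in> Hom B (FO F y) (FO F y)" if "y \<in> Obj (tilde M)" for y
    using B.Ide_Hom[OF functor_Obj[OF F that]] .
  have "zero_arrow B ((d \<cdot>\<^bsub>B\<^esub> Ide B (FO F (T.power_sum t a k))) \<cdot>\<^bsub>B\<^esub> FA F \<eta>)"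
  proof (rule T.zero_of_partial_projections[OF _ t a F FY van])
    show "d \<in> Hom B (FO F (T.power_sum t a k)) (FO F b)" using d by (simp add: Y_def)
    show "FA F \<eta> \<in> Hom B (FO F a) (FO F (T.power_sum t a k))" using F\<eta> by (simp add: Y_def)
    fix e assume e: "e \<in> T.partial_projections t a k"
    have eH: "e \<in> Hom (tilde M) Y Y" using T.partial_projections_Hom[OF _ _ e] a t by (simp add: Y_def)
    have e\<eta>: "tComp M e \<eta> \<in> Hom (tilde M) a Y" using T.Comp_Hom[OF \<eta> eH] by simp
    have c: "canonical C a Y (tComp M e \<eta>)" using can[OF e] by (simp add: \<eta>_def)
    \<comment> \<open>Both sides postcompose the canonical arrow \<open>e \<cdot> \<eta>\<close>,
      hence are canonical, and they have the same image under \<open>E\<close>.\<close>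
    have "tComp M \<beta> (tComp M e \<eta>) = tComp M \<beta>' (tComp M e \<eta>)"
    proof (rule canonical_eq[OF b canonical_Comp[OF Y c \<beta>] canonical_Comp[OF Y c \<beta>']])
      show "FA E (tComp M \<beta> (tComp M e \<eta>)) = FA E (tComp M \<beta>' (tComp M e \<eta>))"
        using functor_Comp[OF E_functor e\<eta> \<beta>] functor_Comp[OF E_functor e\<eta> \<beta>'] E\<beta> by simp
    qed
    then have "FA F \<beta> \<cdot>\<^bsub>B\<^esub> FA F (tComp M e \<eta>) = FA F \<beta>' \<cdot>\<^bsub>B\<^esub> FA F (tComp M e \<eta>)"
      using functor_Comp[OF F e\<eta> \<beta>] functor_Comp[OF F e\<eta> \<beta>'] by simp
    then have "zero_arrow B (d \<cdot>\<^bsub>B\<^esub> FA F (tComp M e \<eta>))"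
      using B.Comp_sub_left[OF functor_Hom[OF F e\<eta>] F\<beta> F\<beta>']
        B.zero_arrow_sub_self[OF B.Comp_Hom[OF functor_Hom[OF F e\<eta>] F\<beta>']] by (simp add: d_def)
    then show "zero_arrow B ((d \<cdot>\<^bsub>B\<^esub> Ide B (FO F (T.power_sum t a k))) \<cdot>\<^bsub>B\<^esub> (FA F e \<cdot>\<^bsub>B\<^esub> FA F \<eta>))"
      using functor_Comp[OF F \<eta> eH] B.Comp_Ide_right[OF d] by (simp add: Y_def)
  qed simp
  then have "zero_arrow B (sub (FA F \<phi>) (FA F \<phi>'))"
    using B.Comp_Ide_right[OF d] B.Comp_sub_left[OF F\<eta> F\<beta> F\<beta>'] functor_Comp[OF F \<eta> \<beta>] functor_Comp[OF F \<eta> \<beta>']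
      factor[OF \<phi>] factor[OF \<phi>'] by (simp add: d_def \<beta>_def \<beta>'_def Y_def)
  then show ?thesis using B.eq_of_sub_zero[OF functor_Hom[OF F \<phi>] functor_Hom[OF F \<phi>']] by blast
qed

text \<open>Both sides are vanishing conditions on \<open>F\<close>: precomposition with
  \<open>E\<close> restricts the test objects to the image of \<open>E\<close>, and since every
  object of \<open>A\<close> is a retract of one in that image, the restriction loses
  nothing.\<close>

lemma polynomial_precomp_iff:
  assumes F: "F \<in> Fct_Obj A B"
  shows "polynomial A B (int n) F \<longleftrightarrow> polynomial (tilde M) B (int n) (functor_comp (tilde M) F E)"
proof -
  note FF = Fct_ObjD[OF F]
  have FE: "functor_comp (tilde M) F E \<in> Fct_Obj (tilde M) B" by (rule functor_comp_Fct_Obj[OF E_functor FF])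
  have sub: "FO E ` Obj M \<subseteq> Obj A" using \<Phi>_Obj by auto
  have mono: "N.vanishes S' k G \<theta>" if "N.vanishes S k G \<theta>" "S' \<subseteq> S" for S S' k G \<theta>
    using that by (induction k arbitrary: G \<theta>) auto
  have "polynomial (tilde M) B (int n) (functor_comp (tilde M) F E)
      \<longleftrightarrow> T.vanishes (Obj M) (Suc n) (functor_comp (tilde M) F E) (\<lambda>y. Ide B (FO (functor_comp (tilde M) F E) y))"
    using T.polynomial_iff_vanishes[OF FE, of "Suc n"] by simp
  also have "\<dots> \<longleftrightarrow> T.vanishes (Obj M) (Suc n) (functor_comp (tilde M) F E) (\<lambda>y. Ide B (FO F (FO E y)))"
    by (rule T.vanishes_cong) auto
  also have "\<dots> \<longleftrightarrow> N.vanishes (FO E ` Obj M) (Suc n) F (\<lambda>y. Ide B (FO F y))"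
    by (rule vanishes_functor_comp) simp
  also have "\<dots> \<longleftrightarrow> N.vanishes (Obj A) (Suc n) F (\<lambda>y. Ide B (FO F y))"
  proof
    assume "N.vanishes (FO E ` Obj M) (Suc n) F (\<lambda>y. Ide B (FO F y))"
    then show "N.vanishes (Obj A) (Suc n) F (\<lambda>y. Ide B (FO F y))"
      by (rule N.vanishes_retracts[OF sub _ FF FF natural_transformation_Ide[OF FF], rotated])
        (use A_retract in auto)
  next
    assume "N.vanishes (Obj A) (Suc n) F (\<lambda>y. Ide B (FO F y))"
    then show "N.vanishes (FO E ` Obj M) (Suc n) F (\<lambda>y. Ide B (FO F y))" using mono sub by blast
  qed
  also have "\<dots> \<longleftrightarrow> polynomial A B (int n) F"
    using N.polynomial_iff_vanishes[OF F, of "Suc n"] by simp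
  finally show ?thesis by simp
qed

end

section \<open>The equivalence\<close>

lemma Pol_simps [simp]:
  "Obj (Pol n N B) = Fct_Obj N B \<inter> {F. polynomial N B n F}"
  "Ide (Pol n N B) = Ide (Fct N B)"
  "Comp (Pol n N B) = Comp (Fct N B)"
  by (simp_all add: Pol_def full_subcategory_def)

lemma Pol_Hom:
  assumes "category N" "category B"
  shows "(F', G', \<tau>) \<in> Hom (Pol n N B) F G \<longleftrightarrow> polynomial N B n F \<and> polynomial N B n G \<and>
     F' = F \<and> G' = G \<and> F \<in> Fct_Obj N B \<and> G \<in> Fct_Obj N B \<and>
     natural_transformation N B F G \<tau> \<and> \<tau> \<in> extensional (Obj N)"
  unfolding Pol_def category.full_subcategory_Hom[OF Fct_category[OF assms]] by (auto simp: Fct_Hom)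

lemma Pol_category: "category N \<Longrightarrow> category B \<Longrightarrow> category (Pol n N B)"
  unfolding Pol_def by (intro category.full_subcategory_category Fct_category)

section \<open>Precomposition between the categories of polynomial functors\<close>

context polynomial_comparison begin

lemmas A_Pol_Hom = Pol_Hom[OF A.category_axioms B.category_axioms]
  and T_Pol_Hom = Pol_Hom[OF T.category_axioms B.category_axioms]

lemma precomp_FA [simp]: "FA (precomp (tilde M) E) (F, G, \<tau>)
    = (functor_comp (tilde M) F E, functor_comp (tilde M) G E, \<lambda>a \<in> Obj M. \<tau> (FO \<Phi> a))"
  and precomp_FO [simp]: "FO (precomp (tilde M) E) F = functor_comp (tilde M) F E"
  by (simp_all add: precomp_def)

lemma precomp_natural_transformation:
  assumes "natural_transformation A B F G \<tau>"
  shows "natural_transformation (tilde M) B (functor_comp (tilde M) F E) (functor_comp (tilde M) G E) (\<lambda>a \<in> Obj M. \<tau> (FO \<Phi> a))"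
proof (rule natural_transformationI)
  show "(\<lambda>a \<in> Obj M. \<tau> (FO \<Phi> a)) a \<in> Hom B (FO (functor_comp (tilde M) F E) a) (FO (functor_comp (tilde M) G E) a)"
    if "a \<in> Obj (tilde M)" for a
    using natural_transformation_Hom[OF assms \<Phi>_Obj, of a] that by simp
  show "FA (functor_comp (tilde M) G E) f \<cdot>\<^bsub>B\<^esub> (\<lambda>a \<in> Obj M. \<tau> (FO \<Phi> a)) a
      = (\<lambda>a \<in> Obj M. \<tau> (FO \<Phi> a)) b \<cdot>\<^bsub>B\<^esub> FA (functor_comp (tilde M) F E) f" if f: "f \<in> Hom (tilde M) a b" for f a b
    using natural_transformation_nat[OF assms functor_Hom[OF E_functor f]] f T.HomD[OF f] by simp
qed

lemma precomp_Obj: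
  assumes "F \<in> Obj (Pol (int n) A B)"
  shows "functor_comp (tilde M) F E \<in> Obj (Pol (int n) (tilde M) B)"
proof -
  have F: "F \<in> Fct_Obj A B" and "polynomial A B (int n) F" using assms by auto
  then show ?thesis
    using polynomial_precomp_iff[OF F] functor_comp_Fct_Obj[OF E_functor Fct_ObjD[OF F]] by simp
qed

lemma precomp_functor: "is_functor (Pol (int n) A B) (Pol (int n) (tilde M) B) (precomp (tilde M) E)"
proof (rule is_functorI)
  fix F assume F: "F \<in> Obj (Pol (int n) A B)"
  then show "FO (precomp (tilde M) E) F \<in> Obj (Pol (int n) (tilde M) B)"
    unfolding precomp_FO by (rule precomp_Obj)
  show "FA (precomp (tilde M) E) (Ide (Pol (int n) A B) F) = Ide (Pol (int n) (tilde M) B) (FO (precomp (tilde M) E) F)"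
    by (auto simp: fun_eq_iff \<Phi>_Obj)
next
  fix f F G assume f: "f \<in> Hom (Pol (int n) A B) F G"
  obtain F' G' \<tau> where fe: "f = (F', G', \<tau>)" by (cases f)
  have F: "F \<in> Fct_Obj A B" "polynomial A B (int n) F" and G: "G \<in> Fct_Obj A B" "polynomial A B (int n) G"
    and \<tau>: "natural_transformation A B F G \<tau>" and e: "f = (F, G, \<tau>)"
    using f by (auto simp: fe A_Pol_Hom)
  show "FA (precomp (tilde M) E) f \<in> Hom (Pol (int n) (tilde M) B) (FO (precomp (tilde M) E) F) (FO (precomp (tilde M) E) G)"
    using precomp_Obj[of F n] precomp_Obj[of G n] F G precomp_natural_transformation[OF \<tau>]
    by (simp add: e T_Pol_Hom)
  fix g H assume g: "g \<in> Hom (Pol (int n) A B) G H"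
  obtain G'' H' \<sigma> where "g = (G'', H', \<sigma>)" by (cases g)
  then have ge: "g = (G, H, \<sigma>)" using g by (simp add: A_Pol_Hom)
  show "FA (precomp (tilde M) E) (g \<cdot>\<^bsub>Pol (int n) A B\<^esub> f)
      = FA (precomp (tilde M) E) g \<cdot>\<^bsub>Pol (int n) (tilde M) B\<^esub> FA (precomp (tilde M) E) f"
    by (auto simp: e ge fun_eq_iff \<Phi>_Obj)
qed (use Pol_category A.category_axioms T.category_axioms B.category_axioms in auto)

text \<open>The identity of \<open>F\<close> is \<open>\<tau>'\<close> after \<open>\<tau>\<close>,
  so vanishing for \<open>G\<close> is pulled back along \<open>\<tau>\<close> and pushed forward
  along \<open>\<tau>'\<close>. The latter stands on the left of all factors \<open>red\<close> and
  therefore enters as a mere family of arrows.\<close>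

lemma polynomial_iso:
  assumes F: "F \<in> Fct_Obj (tilde M) B" and G: "G \<in> Fct_Obj (tilde M) B" and pol: "polynomial (tilde M) B (int n) G"
    and \<tau>: "natural_transformation (tilde M) B F G \<tau>"
    and \<tau>': "\<And>c. c \<in> Obj M \<Longrightarrow> \<tau>' c \<in> Hom B (FO G c) (FO F c)"
    and \<tau>'\<tau>: "\<And>c. c \<in> Obj M \<Longrightarrow> \<tau>' c \<cdot>\<^bsub>B\<^esub> \<tau> c = Ide B (FO F c)"
  shows "polynomial (tilde M) B (int n) F"
proof -
  note FF = Fct_ObjD[OF F] and GF = Fct_ObjD[OF G]
  note \<tau>H = natural_transformation_Hom[OF \<tau>]
  have i: "Ide B (FO G y) \<in> Hom B (FO G y) (FO G y)" if "y \<in> Obj (tilde M)" for y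
    using B.Ide_Hom[OF functor_Obj[OF GF that]] .
  have "T.vanishes (Obj (tilde M)) (Suc n) G (\<lambda>y. Ide B (FO G y))"
    using T.polynomial_iff_vanishes[OF G, of "Suc n"] pol by simp
  then have "T.vanishes (Obj (tilde M)) (Suc n) F (\<lambda>y. Ide B (FO G y) \<cdot>\<^bsub>B\<^esub> \<tau> y)"
    by (rule T.vanishes_Comp_right[OF subset_refl FF GF \<tau>, rotated]) (rule i)
  then have "T.vanishes (Obj (tilde M)) (Suc n) F (\<lambda>y. \<tau>' y \<cdot>\<^bsub>B\<^esub> (Ide B (FO G y) \<cdot>\<^bsub>B\<^esub> \<tau> y))"
    by (rule T.vanishes_Comp_left[OF subset_refl FF, rotated 2])
      (use B.Comp_Hom[OF \<tau>H i] \<tau>' in auto)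
  then have "T.vanishes (Obj (tilde M)) (Suc n) F (\<lambda>y. Ide B (FO F y))"
    by (rule T.vanishes_cong[OF subset_refl, THEN iffD1, rotated]) (use \<tau>'\<tau> B.Comp_Ide_left[OF \<tau>H] in auto)
  then show ?thesis using T.polynomial_iff_vanishes[OF F, of "Suc n"] by simp
qed

text \<open>Fullness and faithfulness are the extension and uniqueness of natural transformations
  given on the image of \<open>E\<close>. For essential surjectivity, polynomiality of
  \<open>G\<close> makes it invariant under the identifications of \<open>E\<close>, so that it
  extends to \<open>A\<close>, and then shows that the extension is polynomial.\<close>

theorem precomp_equivalence:
  "equivalence_of_categories (Pol (int n) A B) (Pol (int n) (tilde M) B) (precomp (tilde M) E)"
proof (rule equivalence_of_categoriesI[OF precomp_functor])
  fix F G f g assume f: "f \<in> Hom (Pol (int n) A B) F G" and g: "g \<in> Hom (Pol (int n) A B) F G"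
    and eq: "FA (precomp (tilde M) E) f = FA (precomp (tilde M) E) g"
  obtain \<tau> where \<tau>: "f = (F, G, \<tau>)" "natural_transformation A B F G \<tau>" "\<tau> \<in> extensional (Obj A)"
    and F: "F \<in> Fct_Obj A B" and G: "G \<in> Fct_Obj A B"
    using f by (cases f) (auto simp: A_Pol_Hom)
  obtain \<sigma> where \<sigma>: "g = (F, G, \<sigma>)" "natural_transformation A B F G \<sigma>" "\<sigma> \<in> extensional (Obj A)"
    using g by (cases g) (auto simp: A_Pol_Hom)
  have "(\<lambda>a \<in> Obj M. \<tau> (FO \<Phi> a)) = (\<lambda>a \<in> Obj M. \<sigma> (FO \<Phi> a))" using eq \<tau>(1) \<sigma>(1) by simp
  then have "\<tau> (FO E c) = \<sigma> (FO E c)" if "c \<in> Obj (tilde M)" for c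
    using that by (auto dest: fun_cong[of _ _ c])
  then have "\<tau> d = \<sigma> d" if "d \<in> Obj A" for d
    using natural_transformation_eq[OF Fct_ObjD[OF F] Fct_ObjD[OF G] \<tau>(2) \<sigma>(2) _ that] by blast
  then show "f = g" using \<tau> \<sigma> by (auto intro: extensionalityI)
next
  fix F G h assume F: "F \<in> Obj (Pol (int n) A B)" and G: "G \<in> Obj (Pol (int n) A B)"
    and h: "h \<in> Hom (Pol (int n) (tilde M) B) (FO (precomp (tilde M) E) F) (FO (precomp (tilde M) E) G)"
  note FF = Fct_ObjD[of F A B] and GF = Fct_ObjD[of G A B]
  obtain \<tau> where \<tau>: "h = (functor_comp (tilde M) F E, functor_comp (tilde M) G E, \<tau>)"
    "natural_transformation (tilde M) B (functor_comp (tilde M) F E) (functor_comp (tilde M) G E) \<tau>"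
    "\<tau> \<in> extensional (Obj M)"
    using h by (cases h) (auto simp: T_Pol_Hom)
  obtain \<sigma> where \<sigma>: "natural_transformation A B F G \<sigma>" "\<And>c. c \<in> Obj (tilde M) \<Longrightarrow> \<sigma> (FO E c) = \<tau> c"
    using natural_transformation_extends[OF FF GF \<tau>(2)] F G by auto
  have "(F, G, restrict \<sigma> (Obj A)) \<in> Hom (Pol (int n) A B) F G"
    using F G natural_transformation_cong[OF A.category_axioms _ \<sigma>(1), of "restrict \<sigma> (Obj A)"]
    by (simp add: A_Pol_Hom)
  moreover have "FA (precomp (tilde M) E) (F, G, restrict \<sigma> (Obj A)) = h"
    using \<sigma>(2) \<tau>(3) by (auto simp: \<tau>(1) fun_eq_iff \<Phi>_Obj extensional_def)
  ultimately show "\<exists>f \<in> Hom (Pol (int n) A B) F G. FA (precomp (tilde M) E) f = h" by blast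
next
  fix G assume G0: "G \<in> Obj (Pol (int n) (tilde M) B)"
  then have G: "G \<in> Fct_Obj (tilde M) B" and pol: "polynomial (tilde M) B (int n) G" by auto
  note GF = Fct_ObjD[OF G]
  have van: "T.vanishes (Obj M) (Suc n) G (\<lambda>y. Ide B (FO G y))"
    using T.polynomial_iff_vanishes[OF G, of "Suc n"] pol by simp
  have inv: "FA G f = FA G g" if "f \<in> Hom (tilde M) a b" "g \<in> Hom (tilde M) a b" "FA E f = FA E g" for f g a b
    by (rule polynomial_functor_factors[OF GF van that])
  obtain F \<tau> \<tau>' where F: "F \<in> Fct_Obj A B"
    and \<tau>: "natural_transformation (tilde M) B (functor_comp (tilde M) F E) G \<tau>"
    and \<tau>': "\<And>c. c \<in> Obj (tilde M) \<Longrightarrow> \<tau>' c \<in> Hom B (FO G c) (FO F (FO E c))"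
    and \<tau>'\<tau>: "\<And>c. c \<in> Obj (tilde M) \<Longrightarrow> \<tau>' c \<cdot>\<^bsub>B\<^esub> \<tau> c = Ide B (FO F (FO E c))"
    and \<tau>\<tau>': "\<And>c. c \<in> Obj (tilde M) \<Longrightarrow> \<tau> c \<cdot>\<^bsub>B\<^esub> \<tau>' c = Ide B (FO G c)"
    by (rule functor_extends[OF B.difference_category_axioms GF inv]) (assumption | rule that)+
  define H where "H = functor_comp (tilde M) F E"
  have H: "H \<in> Fct_Obj (tilde M) B" unfolding H_def by (rule functor_comp_Fct_Obj[OF E_functor Fct_ObjD[OF F]])
  have HO: "FO H c = FO F (FO E c)" if "c \<in> Obj M" for c using that by (simp add: H_def)
  \<comment> \<open>The restriction of the extension to \<open>tilde M\<close> inherits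
    polynomiality from \<open>G\<close>; by the test on the image of \<open>E\<close> this suffices
    for the extension itself.\<close>
  have polH: "polynomial (tilde M) B (int n) H"
    by (rule polynomial_iso[OF H G pol \<tau>[folded H_def]]) (use \<tau>' \<tau>'\<tau> HO in auto)
  then have FP: "F \<in> Obj (Pol (int n) A B)" using polynomial_precomp_iff[OF F] F by (simp add: H_def)
  \<comment> \<open>The extension lemma provides the inverse componentwise; its naturality follows
    from that of \<open>\<tau>\<close> by cancelling on both sides.\<close>
  have \<tau>'n: "natural_transformation (tilde M) B G H \<tau>'"
  proof (rule natural_transformationI)
    show "\<tau>' c \<in> Hom B (FO G c) (FO H c)" if "c \<in> Obj (tilde M)" for c using \<tau>'[OF that] HO that by simp
    fix f a b assume f: "f \<in> Hom (tilde M) a b"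
    have a: "a \<in> Obj (tilde M)" and b: "b \<in> Obj (tilde M)" using T.HomD[OF f] by auto
    note Hf = functor_Hom[OF Fct_ObjD[OF H] f] and Gf = functor_Hom[OF GF f]
    have ta: "\<tau> a \<in> Hom B (FO H a) (FO G a)" and tb: "\<tau> b \<in> Hom B (FO H b) (FO G b)"
      using natural_transformation_Hom[OF \<tau>] a b by (simp_all add: H_def)
    have ta': "\<tau>' a \<in> Hom B (FO G a) (FO H a)" and tb': "\<tau>' b \<in> Hom B (FO G b) (FO H b)"
      using \<tau>' a b HO by simp_all
    have n: "FA G f \<cdot>\<^bsub>B\<^esub> \<tau> a = \<tau> b \<cdot>\<^bsub>B\<^esub> FA H f" using natural_transformation_nat[OF \<tau> f] by (simp add: H_def)
    have "FA H f \<cdot>\<^bsub>B\<^esub> \<tau>' a = (\<tau>' b \<cdot>\<^bsub>B\<^esub> (\<tau> b \<cdot>\<^bsub>B\<^esub> FA H f)) \<cdot>\<^bsub>B\<^esub> \<tau>' a"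
      using B.Comp_assoc[OF Hf tb tb'] \<tau>'\<tau>[OF b] B.Comp_Ide_left[OF Hf] HO b by simp
    also have "\<dots> = \<tau>' b \<cdot>\<^bsub>B\<^esub> ((FA G f \<cdot>\<^bsub>B\<^esub> \<tau> a) \<cdot>\<^bsub>B\<^esub> \<tau>' a)"
      using n B.Comp_assoc[OF ta' B.Comp_Hom[OF ta Gf] tb'] by simp
    also have "\<dots> = \<tau>' b \<cdot>\<^bsub>B\<^esub> FA G f"
      using B.Comp_assoc[OF ta' ta Gf] \<tau>\<tau>'[OF a] B.Comp_Ide_right[OF Gf] by simp
    finally show "FA H f \<cdot>\<^bsub>B\<^esub> \<tau>' a = \<tau>' b \<cdot>\<^bsub>B\<^esub> FA G f" .
  qed
  define t where "t = (H, G, restrict \<tau> (Obj M))"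
  define t' where "t' = (G, H, restrict \<tau>' (Obj M))"
  have tH: "t \<in> Hom (Pol (int n) (tilde M) B) H G" and t'H: "t' \<in> Hom (Pol (int n) (tilde M) B) G H"
    using H G polH pol natural_transformation_cong[OF T.category_axioms _ \<tau>[folded H_def], of "restrict \<tau> (Obj M)"]
      natural_transformation_cong[OF T.category_axioms _ \<tau>'n, of "restrict \<tau>' (Obj M)"]
    by (simp_all add: t_def t'_def T_Pol_Hom)
  interpret P: category "Pol (int n) (tilde M) B" by (rule Pol_category[OF T.category_axioms B.category_axioms])
  have "is_iso (Pol (int n) (tilde M) B) t"
    by (rule P.is_isoI[OF tH t'H]) (auto simp: t_def t'_def fun_eq_iff \<tau>'\<tau> \<tau>\<tau>' HO)
  then show "\<exists>F \<in> Obj (Pol (int n) A B). isomorphic (Pol (int n) (tilde M) B) (FO (precomp (tilde M) E) F) G"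
    unfolding isomorphic_def using FP tH by (auto simp: H_def)
qed

end

theorem proposition6p6:
  fixes M :: "('o, 'a) smcat"
    and A :: "('p, 'b) smcat"
    and \<Phi> :: "('o, 'a, 'p, 'b) functr"
    and C :: "'b set"
    and B :: "('q, 'c) cat"
    and n :: nat
  assumes M: "Mon_ini M"
    and A: "Mon_nul A"
    and \<Phi>: "strict_symmetric_monoidal_functor M A \<Phi>"
    and C: "wide_monoidal_subcategory A C"
    and h1: "\<forall>f \<in> Arr A. \<forall>g \<in> Arr A. Dom A g = Cod A f \<and> g \<cdot>\<^bsub>A\<^esub> f \<in> C \<longrightarrow> f \<in> C"
    and h2: "\<forall>a \<in> Obj A. \<exists>x \<in> Obj A. \<exists>m \<in> Obj M. isomorphic A (FO \<Phi> m) (a \<oplus>\<^bsub>A\<^esub> x)"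
    and h3: "\<forall>f \<in> Arr M. FA \<Phi> f \<in> C"
    and h4: "\<forall>x \<in> Obj M. \<forall>y \<in> Obj M. \<forall>f \<in> Hom M x y.
              \<exists>z \<in> Obj M. \<exists>g \<in> Hom M y (x \<oplus>\<^bsub>M\<^esub> z). g \<cdot>\<^bsub>M\<^esub> f = inj1 M x z"
    and h5a: "\<forall>a \<in> Obj M. \<forall>b \<in> Obj M. \<forall>f \<in> Hom A (FO \<Phi> a) (FO \<Phi> b).
              \<exists>t \<in> Obj M. \<exists>\<phi> \<in> Hom M a (b \<oplus>\<^bsub>M\<^esub> t).
                proj1 A (FO \<Phi> b) (FO \<Phi> t) \<cdot>\<^bsub>A\<^esub> FA \<Phi> \<phi> = f \<and>
                proj2 A (FO \<Phi> b) (FO \<Phi> t) \<cdot>\<^bsub>A\<^esub> FA \<Phi> \<phi> \<in> C"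
    and h5b: "\<forall>a \<in> Obj M. \<forall>b \<in> Obj M. \<forall>f \<in> Hom A (FO \<Phi> a) (FO \<Phi> b).
              \<forall>t \<in> Obj M. \<forall>\<phi> \<in> Hom M a (b \<oplus>\<^bsub>M\<^esub> t).
              \<forall>t' \<in> Obj M. \<forall>\<phi>' \<in> Hom M a (b \<oplus>\<^bsub>M\<^esub> t').
                proj1 A (FO \<Phi> b) (FO \<Phi> t) \<cdot>\<^bsub>A\<^esub> FA \<Phi> \<phi> = f \<and>
                proj2 A (FO \<Phi> b) (FO \<Phi> t) \<cdot>\<^bsub>A\<^esub> FA \<Phi> \<phi> \<in> C \<and>
                proj1 A (FO \<Phi> b) (FO \<Phi> t') \<cdot>\<^bsub>A\<^esub> FA \<Phi> \<phi>' = f \<and>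
                proj2 A (FO \<Phi> b) (FO \<Phi> t') \<cdot>\<^bsub>A\<^esub> FA \<Phi> \<phi>' \<in> C \<longrightarrow>
                (\<exists>u \<in> Obj M. \<exists>\<psi> \<in> Hom M t u. \<exists>\<psi>' \<in> Hom M t' u.
                   (Ide M b \<uplus>\<^bsub>M\<^esub> \<psi>) \<cdot>\<^bsub>M\<^esub> \<phi> = (Ide M b \<uplus>\<^bsub>M\<^esub> \<psi>') \<cdot>\<^bsub>M\<^esub> \<phi>')"
    and B: "abelian_category B"
  shows "equivalence_of_categories (Pol (int n) A B) (Pol (int n) (tilde M) B)
           (precomp (tilde M) (tilde_extension A \<Phi>))"
proof -
  interpret M: Mon_ini M by (rule M)
  interpret A: Mon_nul A by (rule A)
  interpret X: monoidal_extension M A \<Phi> by unfold_locales (rule \<Phi>)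
  obtain zer sub where "difference_category B zer sub"
    using abelian_category.difference_category_exists[OF B] by blast
  then interpret B: difference_category B zer sub .
  interpret polynomial_comparison M A \<Phi> B zer sub C
  proof
    show "f \<in> C" if "f \<in> Hom A a b" "g \<in> Hom A b c" "g \<cdot>\<^bsub>A\<^esub> f \<in> C" for f g a b c
      using h1 that A.HomD[OF that(1)] A.HomD[OF that(2)] by metis
    show "\<exists>x \<in> Obj A. \<exists>m \<in> Obj M. isomorphic A (FO \<Phi> m) (a \<oplus>\<^bsub>A\<^esub> x)" if "a \<in> Obj A" for a
      using h2 that by blast
    show "\<exists>z \<in> Obj M. \<exists>g \<in> Hom M y (x \<oplus>\<^bsub>M\<^esub> z). g \<cdot>\<^bsub>M\<^esub> f = inj1 M x z" if "f \<in> Hom M x y" for f x y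
      using h4 M.HomD(4,5)[OF that] that by blast
    show "\<exists>t \<in> Obj M. \<exists>\<phi> \<in> Hom M a (b \<oplus>\<^bsub>M\<^esub> t).
        proj1 A (FO \<Phi> b) (FO \<Phi> t) \<cdot>\<^bsub>A\<^esub> FA \<Phi> \<phi> = f \<and> proj2 A (FO \<Phi> b) (FO \<Phi> t) \<cdot>\<^bsub>A\<^esub> FA \<Phi> \<phi> \<in> C"
      if "a \<in> Obj M" "b \<in> Obj M" "f \<in> Hom A (FO \<Phi> a) (FO \<Phi> b)" for a b f
      using h5a that by blast
    show "\<exists>u \<in> Obj M. \<exists>\<psi> \<in> Hom M t u. \<exists>\<psi>' \<in> Hom M t' u.
        (Ide M b \<uplus>\<^bsub>M\<^esub> \<psi>) \<cdot>\<^bsub>M\<^esub> \<phi> = (Ide M b \<uplus>\<^bsub>M\<^esub> \<psi>') \<cdot>\<^bsub>M\<^esub> \<phi>'"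
      if "b \<in> Obj M" "t \<in> Obj M" "t' \<in> Obj M" "\<phi> \<in> Hom M a (b \<oplus>\<^bsub>M\<^esub> t)" "\<phi>' \<in> Hom M a (b \<oplus>\<^bsub>M\<^esub> t')"
        "proj1 A (FO \<Phi> b) (FO \<Phi> t) \<cdot>\<^bsub>A\<^esub> FA \<Phi> \<phi> = proj1 A (FO \<Phi> b) (FO \<Phi> t') \<cdot>\<^bsub>A\<^esub> FA \<Phi> \<phi>'"
        "proj2 A (FO \<Phi> b) (FO \<Phi> t) \<cdot>\<^bsub>A\<^esub> FA \<Phi> \<phi> \<in> C" "proj2 A (FO \<Phi> b) (FO \<Phi> t') \<cdot>\<^bsub>A\<^esub> FA \<Phi> \<phi>' \<in> C"
      for a b t t' \<phi> \<phi>'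
    proof -
      \<comment> \<open>The arrow \<open>f\<close> of hypothesis 5(b) is instantiated with the
        common value of the two composites, which has the required source and target.\<close>
      have "proj1 A (FO \<Phi> b) (FO \<Phi> t) \<cdot>\<^bsub>A\<^esub> FA \<Phi> \<phi> \<in> Hom A (FO \<Phi> a) (FO \<Phi> b)"
        using A.Comp_Hom[OF X.\<Phi>_Hom_SumO[OF that(4,1,2)] A.proj1_Hom[OF X.\<Phi>_Obj[OF that(1)] X.\<Phi>_Obj[OF that(2)]]] .
      from h5b[rule_format, OF M.HomD(4)[OF that(4)] that(1) this that(2,4,3,5)] show ?thesis
        using that(6-8) by simp
    qed
  qed
  show ?thesis by (rule precomp_equivalence)
qed

end
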